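(* Let $N\ge1$. The images of the vectors $$f_{N-1}^{a_{N-1}}h_{N-1}^{b_{N-1}}\cdots f_2^{a_2}h_2^{b_2}f_1^{a_1}h_1^{b_1}f_0^{a_0}v,\qquad(\mathbf a,\mathbf b)\in\mathcal C^{1,N-1},$$ form a basis of $L^{(N)}_{1,1}(\mathfrak n)$.
   Context: $\widehat{\mathfrak{sl}}_2=\mathfrak{sl}_2\otimes\mathbb C[t,t^{-1}]\oplus\mathbb Cc\oplus\mathbb Cd$ is the affine Lie algebra, $e,f,h$ the standard basis of $\mathfrak{sl}_2$, $x_i=x\otimes t^i$. $L_{1,1}$ is the irreducible integrable level 1 module of weight 1 with highest weight vector $v$ ($cv=v$, $h_0v=v$, $dv=0$, $e_iv=0$ for $i\le0$, $h_iv=f_iv=0$ for $i<0$). $L^{(N)}_{1,1}(\mathfrak n)=L_{1,1}/\mathfrak{sl}_2(\mathfrak n)L_{1,1}$ with $\mathfrak{sl}_2(\mathfrak n)=\mathbb Ce\otimes\mathbb C[t]\oplus(\mathbb Ch\oplus\mathbb Cf)\otimes t^N\mathbb C[t]$. For $n\ge0$, $\mathcal C^{1,n}$ is the set of $(a_n,\dots,a_0;b_n,\dots,b_1)\in\{0,1\}^{2n+1}$ such that (entries with indices outside the range read as $0$): $b_{i+1}+a_{i+1}+a_i\le1$ and $b_{i+1}+b_i+a_i\le1$ for all $i$; for each $i$ with $b_i\ne0$ there is $j>i$ with $a_j\ne0$ and $b_s=0$ for $i+1\le s\le j$; and there is $j$ with $a_j\ne0$ and $b_s=0$ for all $s\le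 j$. *)

theory Defs
  imports Complex_Main
begin

text \<open>Basis of the affine Lie algebra: E i = e (x) t^i, F i = f (x) t^i, H i = h (x) t^i, C = c, D = d.\<close>
datatype gen = E int | F int | H int | C | D

definition comm :: "(gen \<Rightarrow> 'v::ab_group_add \<Rightarrow> 'v) \<Rightarrow> gen \<Rightarrow> gen \<Rightarrow> 'v \<Rightarrow> 'v" where
  "comm rho x y w = rho x (rho y w) - rho y (rho x w)"

definition affine_sl2_module :: "(complex \<Rightarrow> 'v::ab_group_add \<Rightarrow> 'v) \<Rightarrow> (gen \<Rightarrow> 'v \<Rightarrow> 'v) \<Rightarrow> bool" where
  "affine_sl2_module scale rho \<longleftrightarrow>
     vector_space scale \<and>
     (\<forall>x. module_hom scale scale (rho x)) \<and>
     (\<forall>i j w. comm rho (E i) (F j) w = rho (H (i+j)) w + scale (of_int (if i + j = 0 then - i else 0)) (rho C w)) \<and>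
     (\<forall>i j w. comm rho (H i) (E j) w = scale 2 (rho (E (i+j)) w)) \<and>
     (\<forall>i j w. comm rho (H i) (F j) w = scale (-2) (rho (F (i+j)) w)) \<and>
     (\<forall>i j w. comm rho (H i) (H j) w = scale (of_int (if i + j = 0 then - 2 * i else 0)) (rho C w)) \<and>
     (\<forall>i j w. comm rho (E i) (E j) w = 0) \<and>
     (\<forall>i j w. comm rho (F i) (F j) w = 0) \<and>
     (\<forall>x w. comm rho C x w = 0) \<and>
     (\<forall>i w. comm rho D (E i) w = scale (of_int i) (rho (E i) w)) \<and>
     (\<forall>i w. comm rho D (F i) w = scale (of_int i) (rho (F i) w)) \<and>
     (\<forall>i w. comm rho D (H i) w = scale (of_int i) (rho (H i) w))"

definition irreducible_module :: "(complex \<Rightarrow> 'v::ab_group_add \<Rightarrow> 'v) \<Rightarrow> (gen \<Rightarrow> 'v \<Rightarrow> 'v) \<Rightarrow> bool" where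
  "irreducible_module scale rho \<longleftrightarrow>
     (\<exists>w::'v. w \<noteq> 0) \<and>
     (\<forall>S. module.subspace scale S \<and> (\<forall>x. \<forall>w\<in>S. rho x w \<in> S) \<and> S \<noteq> {0} \<longrightarrow> S = UNIV)"

definition integrable_module :: "(gen \<Rightarrow> 'v::ab_group_add \<Rightarrow> 'v) \<Rightarrow> bool" where
  "integrable_module rho \<longleftrightarrow>
     (\<forall>i w. \<exists>n. (rho (E i) ^^ n) w = 0) \<and> (\<forall>i w. \<exists>n. (rho (F i) ^^ n) w = 0)"

definition hw_vector_L11 :: "(gen \<Rightarrow> 'v::ab_group_add \<Rightarrow> 'v) \<Rightarrow> 'v \<Rightarrow> bool" where
  "hw_vector_L11 rho v \<longleftrightarrow> v \<noteq> 0 \<and> rho C v = v \<and> rho (H 0) v = v \<and> rho D v = 0 \<and>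
     (\<forall>i\<le>0. rho (E i) v = 0) \<and> (\<forall>i<0. rho (H i) v = 0 \<and> rho (F i) v = 0)"

definition sl2n_gens :: "nat \<Rightarrow> gen set" where
  "sl2n_gens N = {E i | i. i \<ge> 0} \<union> {H i | i. i \<ge> int N} \<union> {F i | i. i \<ge> int N}"

definition sl2n_sub :: "(complex \<Rightarrow> 'v::ab_group_add \<Rightarrow> 'v) \<Rightarrow> (gen \<Rightarrow> 'v \<Rightarrow> 'v) \<Rightarrow> nat \<Rightarrow> 'v set" where
  "sl2n_sub scale rho N = module.span scale {rho x w | x w. x \<in> sl2n_gens N}"

text \<open>The set C^{1,n}; (a,b) encoded as functions nat => nat, entries outside the range are 0.\<close>
definition C1 :: "nat \<Rightarrow> ((nat \<Rightarrow> nat) \<times> (nat \<Rightarrow> nat)) set" where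
  "C1 n = {(a, b).
     (\<forall>i. a i \<le> 1 \<and> b i \<le> 1) \<and> (\<forall>i>n. a i = 0) \<and> b 0 = 0 \<and> (\<forall>i>n. b i = 0) \<and>
     (\<forall>i. b (Suc i) + a (Suc i) + a i \<le> 1) \<and>
     (\<forall>i. b (Suc i) + b i + a i \<le> 1) \<and>
     (\<forall>i. b i \<noteq> 0 \<longrightarrow> (\<exists>j>i. a j \<noteq> 0 \<and> (\<forall>s. i + 1 \<le> s \<and> s \<le> j \<longrightarrow> b s = 0))) \<and>
     (\<exists>j. a j \<noteq> 0 \<and> (\<forall>s\<le>j. b s = 0))}"

fun mono_vec :: "(gen \<Rightarrow> 'v \<Rightarrow> 'v) \<Rightarrow> 'v \<Rightarrow> (nat \<Rightarrow> nat) \<Rightarrow> (nat \<Rightarrow> nat) \<Rightarrow> nat \<Rightarrow> 'v" where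
  "mono_vec rho v a b 0 = (rho (F 0) ^^ a 0) v"
| "mono_vec rho v a b (Suc k) =
     (rho (F (int (Suc k))) ^^ a (Suc k)) ((rho (H (int (Suc k))) ^^ b (Suc k)) (mono_vec rho v a b k))"

text \<open>The images of the family u indexed by the finite set I form a basis of the quotient V / W.\<close>
definition quotient_basis :: "(complex \<Rightarrow> 'v::ab_group_add \<Rightarrow> 'v) \<Rightarrow> 'v set \<Rightarrow> ('i \<Rightarrow> 'v) \<Rightarrow> 'i set \<Rightarrow> bool" where
  "quotient_basis scale W u I \<longleftrightarrow>
     (\<forall>c. (\<Sum>i\<in>I. scale (c i) (u i)) \<in> W \<longrightarrow> (\<forall>i\<in>I. c i = 0)) \<and>
     (\<forall>w. \<exists>c. w - (\<Sum>i\<in>I. scale (c i) (u i)) \<in> W)"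

end

theory Submission
  imports Defs "HOL-Computational_Algebra.Polynomial"
begin

text \<open>
  Write \<open>W p q\<close> for the span of the images of all \<open>e i\<close> with \<open>i \<ge> p\<close> and all \<open>f i\<close> with
  \<open>i \<ge> q\<close>; then \<open>W 0 N\<close> is the subspace to be factored out.

  Spanning. On a level one module the squares of the currents e(z) and f(z) vanish. Hence \<open>f (q - 1)\<close>
  maps \<open>W (p + 1) (q - 2)\<close> into \<open>W p q\<close>, and symmetrically for e, so that the coinvariants of
  \<open>W p q\<close> are spanned by those of \<open>W p (q - 1)\<close> together with \<open>f (q - 1)\<close> applied to those of
  \<open>W (p + 1) (q - 2)\<close>. This recursion for \<open>p = 0, 1\<close> reproduces the recursive structure of the
  index set, which has at most \<open>2 ^ (N - 1)\<close> elements.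

  Independence. Replace the N-fold point 0 by N distinct points. Every subset of odd size r of these
  points carries a functional that kills the deformed subspace: take a functional concentrated on the
  extremal weight space of weight -r and compose it, for each point x of the subset, with the
  exponential of \<open>- (\<Sum>n\<ge>1. x ^ n / (2 * n) * h (- n))\<close>. The \<open>2 ^ (N - 1)\<close> functionals so obtained
  are separated by the action of the h, so the spanning monomials are independent modulo the deformed
  subspace; comparing leading terms for the grading by d, they are independent modulo \<open>W 0 N\<close>.
\<close>


text \<open>Spanning bounds the dimension of the coinvariants only from above, since the recursion
  is not claimed to be exact, and the functionals bound it only from below; the two bounds meet at
  \<open>2 ^ (N - 1)\<close>, the number of odd subsets of N points. The factors h come from the
  recursion at \<open>p = 1\<close>: it produces f_n e_1 b, and because e_1 f_n b lies in
  \<open>W 1 (n + 1)\<close>, what remains is - h_(n+1) b. The coefficients 1 / (2n) of the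
  exponential turn conjugation by it into log (1 - z) = - (sum of z^n / n): it replaces e_j by e_j -
  z e_(j-1), and f by the inverse of that substitution. So each inserted point x raises by one the
  index from which e is killed, gives the condition on f a factor t - x and lowers its starting
  index by one. At the extremal weight -r these indices start at -r for e and r for f, so exactly r
  points bring both to 0; r is odd because all weights of the module are. Distinct points let the
  power sum eigenvalues of the h_j separate the subsets; at the N-fold point 0 they would all vanish
  for j > 0.\<close>

lemma (in vector_space) eigenvectors_sum_eq_0:
  assumes lin: "module_hom scale scale T" and "finite A"
    and "\<And>l. l \<in> A \<Longrightarrow> T (g l) = ev l *s g l" and "inj_on ev A"
    and "(\<Sum>l\<in>A. g l) = 0" and "l \<in> A"
  shows "g l = 0"
  using assms(2-)
proof (induction A arbitrary: g l rule: finite_induct)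
  case empty
  then show ?case by simp
next
  case (insert a A)
  interpret T: module_hom scale scale T by (rule lin)
  have 1: "g a + (\<Sum>l\<in>A. g l) = 0"
    using insert by simp
  have "T (g a + (\<Sum>l\<in>A. g l)) = 0"
    unfolding 1 by simp
  then have "ev a *s g a + (\<Sum>l\<in>A. ev l *s g l) = 0"
    using insert.prems(1) by (simp add: T.add T.sum)
  moreover have "ev a *s (g a + (\<Sum>l\<in>A. g l)) = 0"
    unfolding 1 by simp
  ultimately have "(\<Sum>l\<in>A. ev l *s g l) = (\<Sum>l\<in>A. ev a *s g l)"
    by (metis add_left_imp_eq scale_right_distrib scale_sum_right)
  then have "(\<Sum>l\<in>A. (ev l - ev a) *s g l) = 0"
    by (simp add: algebra_simps sum_subtractf)
  then have "(ev l - ev a) *s g l = 0" if "l \<in> A" for l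
    using insert.IH[of "\<lambda>l. (ev l - ev a) *s g l" l] insert.prems(1,2) that
    by (auto simp: T.scale mult.commute)
  moreover have "ev l \<noteq> ev a" if "l \<in> A" for l
    using inj_onD[OF insert.prems(2), of l a] that insert.hyps by auto
  ultimately have *: "g l = 0" if "l \<in> A" for l
    using that by auto
  with 1 have "g a = 0"
    by simp
  with * show ?case
    using insert.prems by auto
qed

text \<open>The coefficients are indexed by \<open>I\<close> and not by the vectors, because
  \<open>u\<close> need not be injective; the coefficient of a vector goes to one chosen
  preimage.\<close>

lemma (in vector_space) span_image_eq_sum:
  assumes "y \<in> span (u ` I)" "finite I"
  shows "\<exists>c. y = (\<Sum>i\<in>I. c i *s u i)"
  using assms(1)
proof (induction rule: span_induct_alt)
  case base
  show ?case
    by (intro exI[of _ "\<lambda>_. 0"]) simp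
next
  case (step c x y)
  then obtain d j where d: "y = (\<Sum>i\<in>I. d i *s u i)" and j: "j \<in> I" "x = u j"
    by auto
  have "c *s x = (\<Sum>i\<in>I. (if i = j then c else 0) *s u i)"
    using j assms(2) by (simp add: if_distrib[of "\<lambda>c. c *s _"] sum.delta cong: if_cong)
  then have "c *s x + y = (\<Sum>i\<in>I. ((if i = j then c else 0) + d i) *s u i)"
    unfolding d by (simp add: scale_left_distrib sum.distrib)
  then show ?case
    by (intro exI[of _ "\<lambda>i. (if i = j then c else 0) + d i"]) simp
qed

section \<open>Level one modules and their commutation relations\<close>

locale level_one_module = vector_space scale
  for scale :: "complex \<Rightarrow> 'v::ab_group_add \<Rightarrow> 'v" (infixr \<open>*s\<close> 75) +
  fixes rho :: "gen \<Rightarrow> 'v \<Rightarrow> 'v" and v :: 'v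
  assumes affine: "affine_sl2_module scale rho"
    and irr: "irreducible_module scale rho"
    and integrable: "integrable_module rho"
    and level [simp]: "rho C w = w"
    and hw: "hw_vector_L11 rho v"
begin

abbreviation e :: "int \<Rightarrow> 'v \<Rightarrow> 'v" where "e i \<equiv> rho (E i)"
abbreviation f :: "int \<Rightarrow> 'v \<Rightarrow> 'v" where "f i \<equiv> rho (F i)"
abbreviation h :: "int \<Rightarrow> 'v \<Rightarrow> 'v" where "h i \<equiv> rho (H i)"
abbreviation d :: "'v \<Rightarrow> 'v" where "d \<equiv> rho D"

lemma rho_hom: "module_hom scale scale (rho x)"
  using affine unfolding affine_sl2_module_def by simp

lemma rho_add: "rho x (a + b) = rho x a + rho x b"
  and rho_scale: "rho x (c *s a) = c *s rho x a"
  and rho_0 [simp]: "rho x 0 = 0"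
  and rho_minus: "rho x (- a) = - rho x a"
  and rho_diff: "rho x (a - b) = rho x a - rho x b"
  and rho_sum: "rho x (sum g A) = (\<Sum>i\<in>A. rho x (g i))"
proof -
  interpret module_hom scale scale "rho x" by (rule rho_hom)
  show "rho x (a + b) = rho x a + rho x b" "rho x (c *s a) = c *s rho x a"
    "rho x 0 = 0" "rho x (- a) = - rho x a" "rho x (a - b) = rho x a - rho x b"
    "rho x (sum g A) = (\<Sum>i\<in>A. rho x (g i))"
    by (simp_all add: add scale neg diff sum)
qed

lemmas rho_linear = rho_add rho_scale rho_minus rho_diff rho_sum

lemma e_f: "e i (f j w) = f j (e i w) + h (i + j) w + of_int (if i + j = 0 then - i else 0) *s w"
  and h_e: "h i (e j w) = e j (h i w) + 2 *s e (i + j) w"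
  and h_f: "h i (f j w) = f j (h i w) - 2 *s f (i + j) w"
  and h_h: "h i (h j w) = h j (h i w) + of_int (if i + j = 0 then - 2 * i else 0) *s w"
  and e_e: "e i (e j w) = e j (e i w)"
  and f_f: "f i (f j w) = f j (f i w)"
  and d_e: "d (e i w) = e i (d w) + of_int i *s e i w"
  and d_f: "d (f i w) = f i (d w) + of_int i *s f i w"
  and d_h: "d (h i w) = h i (d w) + of_int i *s h i w"
proof -
  have "comm rho (E i) (F j) w = h (i + j) w + of_int (if i + j = 0 then - i else 0) *s w"
    "comm rho (H i) (E j) w = 2 *s e (i + j) w" "comm rho (H i) (F j) w = (- 2) *s f (i + j) w"
    "comm rho (H i) (H j) w = of_int (if i + j = 0 then - 2 * i else 0) *s w"
    "comm rho (E i) (E j) w = 0" "comm rho (F i) (F j) w = 0"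
    "comm rho D (E i) w = of_int i *s e i w" "comm rho D (F i) w = of_int i *s f i w"
    "comm rho D (H i) w = of_int i *s h i w"
    using affine unfolding affine_sl2_module_def by simp_all
  then show "e i (f j w) = f j (e i w) + h (i + j) w + of_int (if i + j = 0 then - i else 0) *s w"
    "h i (e j w) = e j (h i w) + 2 *s e (i + j) w" "h i (f j w) = f j (h i w) - 2 *s f (i + j) w"
    "h i (h j w) = h j (h i w) + of_int (if i + j = 0 then - 2 * i else 0) *s w"
    "e i (e j w) = e j (e i w)" "f i (f j w) = f j (f i w)"
    "d (e i w) = e i (d w) + of_int i *s e i w" "d (f i w) = f i (d w) + of_int i *s f i w"
    "d (h i w) = h i (d w) + of_int i *s h i w"
    unfolding comm_def by (simp_all add: diff_eq_eq add_ac)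
qed

lemma v_nz: "v \<noteq> 0" and h0_v: "h 0 v = v" and d_v: "d v = 0"
  and e_v: "i \<le> 0 \<Longrightarrow> e i v = 0" and h_v: "i < 0 \<Longrightarrow> h i v = 0" and f_v: "i < 0 \<Longrightarrow> f i v = 0"
  using hw unfolding hw_vector_L11_def by auto

text \<open>A weak form of all relations at once, enough for the reordering in
  \<open>rho_span_words\<close>. The central terms fit in because \<open>rho C w = w\<close> puts
  \<open>w\<close> itself into the span.\<close>

lemma comm_in_span: "rho x (rho y w) - rho y (rho x w) \<in> span (range (\<lambda>z. rho z w))"
proof -
  have base: "rho z w \<in> span (range (\<lambda>z. rho z w))" for z
    by (rule span_base) auto
  have w: "w \<in> span (range (\<lambda>z. rho z w))"
    using base[of C] by simp
  note in_span = span_add span_diff span_scale span_neg base w span_zero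
  have ef: "e i (f j w) - f j (e i w) \<in> span (range (\<lambda>z. rho z w))"
    and he: "h i (e j w) - e j (h i w) \<in> span (range (\<lambda>z. rho z w))"
    and hf: "h i (f j w) - f j (h i w) \<in> span (range (\<lambda>z. rho z w))"
    and hh: "h i (h j w) - h j (h i w) \<in> span (range (\<lambda>z. rho z w))"
    and de: "d (e i w) - e i (d w) \<in> span (range (\<lambda>z. rho z w))"
    and df: "d (f i w) - f i (d w) \<in> span (range (\<lambda>z. rho z w))"
    and dh: "d (h i w) - h i (d w) \<in> span (range (\<lambda>z. rho z w))" for i j
    by (simp_all only: e_f[of i j] h_e[of i j] h_f[of i j] h_h[of i j] d_e[of i] d_f[of i] d_h[of i] add_diff_cancel_left'
        add_diff_eq diff_add_eq diff_right_commute)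
      (auto intro!: in_span simp: algebra_simps)
  have swap: "- (a - b) \<in> span S \<Longrightarrow> b - a \<in> span S" for a b S
    by simp
  show ?thesis
    by (cases x; cases y)
      (auto intro: ef he hf hh de df dh swap[OF span_neg[OF ef]] swap[OF span_neg[OF he]]
        swap[OF span_neg[OF hf]] swap[OF span_neg[OF de]] swap[OF span_neg[OF df]]
        swap[OF span_neg[OF dh]] span_zero simp: e_e[of _ _ w] f_f[of _ _ w])
qed

end

subsection \<open>Generation and weights\<close>

context level_one_module
begin

text \<open>The generators whose action on \<open>v\<close> is not prescribed by
  \<open>hw_vector_L11\<close>; the others annihilate \<open>v\<close> or scale it.\<close>

definition creation :: "gen set" where
  "creation = {E i | i. i \<ge> 1} \<union> {H i | i. i \<ge> 1} \<union> {F i | i. i \<ge> 0}"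

inductive_set words :: "'v set" where
  words_v: "v \<in> words"
| words_step: "w \<in> words \<Longrightarrow> x \<in> creation \<Longrightarrow> rho x w \<in> words"

lemma rho_span_subset:
  assumes "\<And>w. w \<in> A \<Longrightarrow> rho x w \<in> span B" "w \<in> span A"
  shows "rho x w \<in> span B"
  using assms(2)
  by (induction rule: span_induct_alt) (auto simp: rho_linear intro!: span_add span_scale assms(1) span_zero)

text \<open>Words in arbitrary order suffice: moving \<open>x\<close> past \<open>y\<close> leaves
  only generators applied to the shorter word \<open>w\<close>, and the induction hypothesis covers
  all generators at once.\<close>

lemma rho_span_words: "w \<in> words \<Longrightarrow> rho x w \<in> span words"
proof (induction arbitrary: x rule: words.induct)
  case words_v
  have v: "v \<in> span words"
    by (intro span_base words.words_v)
  have "rho x v \<in> span words" if "x \<in> creation"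
    using that by (intro span_base words.words_step words.words_v)
  then show ?case
  proof (cases x)
    case (E i)
    with \<open>x \<in> creation \<Longrightarrow> rho x v \<in> span words\<close> show ?thesis
      by (cases "i \<ge> 1") (auto simp: creation_def e_v span_zero)
  next
    case (F i)
    with \<open>x \<in> creation \<Longrightarrow> rho x v \<in> span words\<close> show ?thesis
      by (cases "i \<ge> 0") (auto simp: creation_def f_v span_zero)
  next
    case (H i)
    with \<open>x \<in> creation \<Longrightarrow> rho x v \<in> span words\<close> v show ?thesis
      by (cases "i \<ge> 1"; cases "i = 0") (auto simp: creation_def h_v h0_v span_zero)
  qed (use v in \<open>auto simp: d_v span_zero\<close>)
next
  case (words_step w y)
  have y: "rho y u \<in> span words" if "u \<in> span words" for u
    by (rule rho_span_subset[OF _ that]) (auto intro: span_base words.words_step words_step.hyps)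
  have "range (\<lambda>z. rho z w) \<subseteq> span words"
    using words_step.IH by auto
  then have "span (range (\<lambda>z. rho z w)) \<subseteq> span words"
    using span_minimal subspace_span by blast
  then have "rho x (rho y w) - rho y (rho x w) \<in> span words"
    using comm_in_span by blast
  from span_add[OF this y[OF words_step.IH[of x]]] show ?case
    by simp
qed

lemma irreducible_eq_UNIV:
  assumes "subspace S" "\<And>x w. w \<in> S \<Longrightarrow> rho x w \<in> S" "w \<in> S" "w \<noteq> 0"
  shows "S = UNIV"
  using irr assms unfolding irreducible_module_def by blast

lemma span_words: "span words = UNIV"
  by (rule irreducible_eq_UNIV[of _ v])
    (auto intro: rho_span_subset[OF rho_span_words] span_base words_v simp: v_nz)

section \<open>Weight spaces and the projections onto them\<close>

definition wt :: "int \<Rightarrow> int \<Rightarrow> 'v \<Rightarrow> bool" where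
  "wt k n w \<longleftrightarrow> h 0 w = of_int k *s w \<and> d w = of_int n *s w"

lemma wt_0 [simp]: "wt k n 0"
  and wt_add: "wt k n a \<Longrightarrow> wt k n b \<Longrightarrow> wt k n (a + b)"
  and wt_diff: "wt k n a \<Longrightarrow> wt k n b \<Longrightarrow> wt k n (a - b)"
  and wt_scale: "wt k n a \<Longrightarrow> wt k n (c *s a)"
  by (auto simp: wt_def rho_linear algebra_simps)

lemma wt_sum: "(\<And>i. i \<in> A \<Longrightarrow> wt k n (g i)) \<Longrightarrow> wt k n (sum g A)"
  by (induction A rule: infinite_finite_induct) (auto simp: wt_add)

lemma wt_v: "wt 1 0 v"
  by (simp add: wt_def h0_v d_v)

lemma wt_e: "wt k n w \<Longrightarrow> wt (k + 2) (n + i) (e i w)"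
  and wt_f: "wt k n w \<Longrightarrow> wt (k - 2) (n + i) (f i w)"
  and wt_h: "wt k n w \<Longrightarrow> wt k (n + i) (h i w)"
  by (auto simp: wt_def h_e[of 0] h_f[of 0] h_h[of 0] d_e d_f d_h rho_linear algebra_simps)

text \<open>The eigenvalues of this operator encode the pair of weights injectively.\<close>
definition h0d :: "'v \<Rightarrow> 'v" where
  "h0d w = h 0 w + \<i> *s d w"

lemma h0d_hom: "module_hom scale scale h0d"
  by (auto simp: module_hom_iff h0d_def rho_linear algebra_simps module_axioms)

lemma h0d_wt: "wt k n w \<Longrightarrow> h0d w = Complex (of_int k) (of_int n) *s w"
  by (auto simp: wt_def h0d_def complex_eq algebra_simps Complex_eq)

definition decomposition :: "'v \<Rightarrow> (int \<times> int \<Rightarrow> 'v) \<Rightarrow> bool" where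
  "decomposition w g \<longleftrightarrow> (\<forall>k n. wt k n (g (k, n))) \<and>
     (\<exists>A. finite A \<and> (\<forall>a. a \<notin> A \<longrightarrow> g a = 0) \<and> w = (\<Sum>a\<in>A. g a))"

lemma decompositionE:
  assumes "decomposition w g"
  obtains A where "finite A" "\<forall>a. a \<notin> A \<longrightarrow> g a = 0" "w = (\<Sum>a\<in>A. g a)"
proof -
  from assms have "\<exists>A. finite A \<and> (\<forall>a. a \<notin> A \<longrightarrow> g a = 0) \<and> w = (\<Sum>a\<in>A. g a)"
    unfolding decomposition_def by (rule conjunct2)
  with that show ?thesis by blast
qed

lemma decomposition_wtD: "decomposition w g \<Longrightarrow> wt k n (g (k, n))"
  unfolding decomposition_def by blast

lemma decomposition_unique:
  assumes "decomposition w g" "decomposition w g'"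
  shows "g = g'"
proof
  fix a
  obtain A where A: "finite A" "\<forall>a. a \<notin> A \<longrightarrow> g a = 0" "w = (\<Sum>a\<in>A. g a)"
    using assms(1) by (rule decompositionE)
  obtain A' where A': "finite A'" "\<forall>a. a \<notin> A' \<longrightarrow> g' a = 0" "w = (\<Sum>a\<in>A'. g' a)"
    using assms(2) by (rule decompositionE)
  define B where "B = insert a (A \<union> A')"
  have B: "finite B" "a \<in> B"
    using A A' by (auto simp: B_def)
  have "w = (\<Sum>a\<in>B. g a)" unfolding A(3)
    by (rule sum.mono_neutral_left) (use A A' in \<open>auto simp: B_def\<close>)
  moreover have "w = (\<Sum>a\<in>B. g' a)" unfolding A'(3)
    by (rule sum.mono_neutral_left) (use A A' in \<open>auto simp: B_def\<close>)
  ultimately have "(\<Sum>a\<in>B. g a - g' a) = 0"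
    by (simp add: sum_subtractf)
  moreover have "h0d (g l - g' l) = (case l of (k, n) \<Rightarrow> Complex (of_int k) (of_int n)) *s (g l - g' l)" for l
    using decomposition_wtD[OF assms(1)] decomposition_wtD[OF assms(2)]
    by (cases l) (simp add: h0d_wt wt_diff)
  ultimately have "g a - g' a = 0"
    using B by (intro eigenvectors_sum_eq_0[OF h0d_hom, of B "\<lambda>a. g a - g' a"
        "\<lambda>(k, n). Complex (of_int k) (of_int n)"]) (auto simp: inj_on_def)
  then show "g a = g' a" by simp
qed

lemma decomposition_lincomb:
  assumes "decomposition x g" "decomposition y g'"
  shows "decomposition (c *s x + y) (\<lambda>a. c *s g a + g' a)"
proof -
  obtain A where A: "finite A" "\<forall>a. a \<notin> A \<longrightarrow> g a = 0" "x = (\<Sum>a\<in>A. g a)"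
    using assms(1) by (rule decompositionE)
  obtain A' where A': "finite A'" "\<forall>a. a \<notin> A' \<longrightarrow> g' a = 0" "y = (\<Sum>a\<in>A'. g' a)"
    using assms(2) by (rule decompositionE)
  have "x = (\<Sum>a\<in>A \<union> A'. g a)" unfolding A(3)
    by (rule sum.mono_neutral_left) (use A A' in auto)
  moreover have "y = (\<Sum>a\<in>A \<union> A'. g' a)" unfolding A'(3)
    by (rule sum.mono_neutral_left) (use A A' in auto)
  ultimately have "c *s x + y = (\<Sum>a\<in>A \<union> A'. c *s g a + g' a)"
    by (simp add: sum.distrib scale_sum_right)
  moreover have "wt k n (c *s g (k, n) + g' (k, n))" for k n
    using decomposition_wtD[OF assms(1)] decomposition_wtD[OF assms(2)] by (intro wt_add wt_scale)
  ultimately show ?thesis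
    unfolding decomposition_def using A(1,2) A'(1,2) by (intro conjI allI exI[of _ "A \<union> A'"]) auto
qed

lemma decomposition_wt:
  assumes "wt k n w"
  shows "decomposition w (\<lambda>a. if a = (k, n) then w else 0)"
  unfolding decomposition_def using assms by (auto intro!: exI[of _ "{(k, n)}"])

text \<open>A first bound on the weights, sharpened in \<open>weight_bound\<close>. Oddness makes
  h_0 invertible, which is what \<open>spans_0_0\<close> rests on.\<close>

definition good :: "int \<times> int \<Rightarrow> bool" where
  "good a \<longleftrightarrow> odd (fst a) \<and> snd a \<ge> 0"

lemma words_wt: "w \<in> words \<Longrightarrow> \<exists>k n. good (k, n) \<and> wt k n w"
proof (induction rule: words.induct)
  case words_v
  show ?case by (intro exI[of _ 1] exI[of _ 0]) (simp add: good_def wt_v)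
next
  case (words_step w x)
  from words_step.IH obtain k n where "good (k, n)" and "wt k n w" by blast
  then have "odd k" "n \<ge> 0" by (simp_all add: good_def)
  from words_step.hyps(2) consider i where "x = E i" "i \<ge> 1" | i where "x = H i" "i \<ge> 1" | i where "x = F i" "i \<ge> 0"
    unfolding creation_def by blast
  then show ?case
  proof cases
    case 1
    with \<open>odd k\<close> \<open>n \<ge> 0\<close> wt_e[OF \<open>wt k n w\<close>, of i] show ?thesis
      by (intro exI[of _ "k + 2"] exI[of _ "n + i"]) (simp add: good_def)
  next
    case 2
    with \<open>odd k\<close> \<open>n \<ge> 0\<close> wt_h[OF \<open>wt k n w\<close>, of i] show ?thesis
      by (intro exI[of _ k] exI[of _ "n + i"]) (simp add: good_def)
  next
    case 3
    with \<open>odd k\<close> \<open>n \<ge> 0\<close> wt_f[OF \<open>wt k n w\<close>, of i] show ?thesis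
      by (intro exI[of _ "k - 2"] exI[of _ "n + i"]) (simp add: good_def)
  qed
qed

lemma decomposition_exists: "\<exists>g. decomposition w g \<and> (\<forall>a. \<not> good a \<longrightarrow> g a = 0)"
proof -
  have "w \<in> span words"
    by (simp add: span_words)
  then show ?thesis
  proof (induction rule: span_induct_alt)
    case base
    show ?case
      by (intro exI[of _ "\<lambda>_. 0"]) (auto simp: decomposition_def)
  next
    case (step c x y)
    then obtain g k n where "decomposition y g" "\<forall>a. \<not> good a \<longrightarrow> g a = 0" "good (k, n)" "wt k n x"
      using words_wt by blast
    then show ?case
      using decomposition_lincomb[OF decomposition_wt[of k n x], of y g c]
      by (intro exI[of _ "\<lambda>a. c *s (if a = (k, n) then x else 0) + g a"]) auto
  qed
qed

definition pr :: "int \<Rightarrow> int \<Rightarrow> 'v \<Rightarrow> 'v" where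
  "pr k n w = (THE g. decomposition w g) (k, n)"

lemma pr_eq: "decomposition w g \<Longrightarrow> pr k n w = g (k, n)"
  unfolding pr_def by (metis decomposition_unique the_equality)

lemma decomposition_pr: "decomposition w (\<lambda>(k, n). pr k n w)"
proof -
  obtain g where g: "decomposition w g"
    using decomposition_exists by blast
  then have "(\<lambda>(k, n). pr k n w) = g"
    by (auto simp: pr_eq)
  then show ?thesis using g by simp
qed

lemma pr_not_good: "\<not> good (k, n) \<Longrightarrow> pr k n w = 0"
proof -
  assume a: "\<not> good (k, n)"
  obtain g where "decomposition w g" "\<forall>a. \<not> good a \<longrightarrow> g a = 0"
    using decomposition_exists[of w] by blast
  then show ?thesis using a by (simp add: pr_eq)
qed

lemma pr_wt: "wt k n (pr k n w)"
proof -
  have "\<forall>k n. wt k n ((\<lambda>(k, n). pr k n w) (k, n))"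
    using decomposition_pr[of w] unfolding decomposition_def by (rule conjunct1)
  then show ?thesis by simp
qed

lemma pr_same: "wt k n w \<Longrightarrow> pr k n w = w"
  using pr_eq[OF decomposition_wt, of k n w k n] by simp

lemma pr_other: "wt k n w \<Longrightarrow> (k, n) \<noteq> (k', n') \<Longrightarrow> pr k' n' w = 0"
  using pr_eq[OF decomposition_wt, of k n w k' n'] by auto

lemma pr_lincomb: "pr k n (c *s x + y) = c *s pr k n x + pr k n y"
  using pr_eq[OF decomposition_lincomb[OF decomposition_pr[of x] decomposition_pr[of y], of c], of k n] by simp

lemma pr_hom: "module_hom scale scale (pr k n)"
proof -
  have "pr k n 0 = 0"
    using pr_other[of "k + 1" n 0 k n] by simp
  then have "pr k n (c *s x) = c *s pr k n x" for c x
    using pr_lincomb[of k n c x 0] by simp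
  moreover have "pr k n (x + y) = pr k n x + pr k n y" for x y
    using pr_lincomb[of k n 1 x y] by simp
  ultimately show ?thesis
    by (simp add: module_hom_iff module_axioms)
qed

lemma pr_add: "pr k n (x + y) = pr k n x + pr k n y"
  and pr_scale: "pr k n (c *s x) = c *s pr k n x"
  and pr_0 [simp]: "pr k n 0 = 0"
  and pr_diff: "pr k n (x - y) = pr k n x - pr k n y"
  and pr_sum: "pr k n (sum g A) = (\<Sum>i\<in>A. pr k n (g i))"
proof -
  interpret p: module_hom scale scale "pr k n" by (rule pr_hom)
  show "pr k n (x + y) = pr k n x + pr k n y" "pr k n (c *s x) = c *s pr k n x" "pr k n 0 = 0"
    "pr k n (x - y) = pr k n x - pr k n y" "pr k n (sum g A) = (\<Sum>i\<in>A. pr k n (g i))"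
    by (simp_all add: p.add p.scale p.diff p.sum)
qed

lemma sum_pr: "\<exists>A. finite A \<and> (\<Sum>(k, n)\<in>A. pr k n w) = w"
proof -
  obtain A where "finite A" "w = (\<Sum>(k, n)\<in>A. pr k n w)"
    using decomposition_pr by (rule decompositionE)
  then show ?thesis by (intro exI[of _ A] conjI) (assumption, rule sym)
qed

lemma wt_good: "wt k n w \<Longrightarrow> w \<noteq> 0 \<Longrightarrow> odd k \<and> n \<ge> 0"
  using pr_not_good[of k n w] pr_same by (auto simp: good_def)

lemma weight_induct [case_names wt add]:
  assumes "\<And>k n w. wt k n w \<Longrightarrow> odd k \<Longrightarrow> n \<ge> 0 \<Longrightarrow> P w"
    and "\<And>x y. P x \<Longrightarrow> P y \<Longrightarrow> P (x + y)"
  shows "P w"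
proof -
  obtain A where "finite A" and w: "(\<Sum>(k, n)\<in>A. pr k n w) = w"
    using sum_pr by blast
  \<comment> \<open>Outside the good weights the projection is 0, which counts as a vector of weight
    (1, 0).\<close>
  have P: "P (pr k n u)" for k n u
    using assms(1)[of k n "pr k n u"] pr_wt[of k n u] pr_not_good[of k n u] assms(1)[of 1 0 0]
    by (cases "good (k, n)") (auto simp: good_def)
  have "P (\<Sum>(k, n)\<in>A. pr k n w)" 
    using \<open>finite A\<close>
  proof (induction A rule: finite_induct)
    case empty
    then show ?case using assms(1)[of 1 0 0] by simp
  next
    case (insert a A)
    then show ?case using assms(2) P by (cases a) simp
  qed
  then show ?thesis unfolding w .
qed

lemma pr_shift:
  assumes "\<And>k n w. wt k n w \<Longrightarrow> wt (k + a) (n + i) (rho x w)"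
  shows "pr k n (rho x w) = rho x (pr (k - a) (n - i) w)"
proof (induction w rule: weight_induct)
  case (wt k' n' w)
  show ?case
  proof (cases "k' = k - a \<and> n' = n - i")
    case True
    then show ?thesis
      using pr_same[OF wt(1)] pr_same[OF assms[OF wt(1)]] by auto
  next
    case False
    then have "(k' + a, n' + i) \<noteq> (k, n)" "(k', n') \<noteq> (k - a, n - i)" by auto
    then show ?thesis
      using pr_other[OF wt(1)] pr_other[OF assms[OF wt(1)]] by simp
  qed
qed (simp add: pr_add rho_add)

lemma pr_e: "pr k n (e i w) = e i (pr (k - 2) (n - i) w)"
  by (rule pr_shift) (rule wt_e)

lemma pr_f: "pr k n (f i w) = f i (pr (k + 2) (n - i) w)"
  using pr_shift[of "-2" i "F i" k n w] wt_f by simp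

lemma pr_h: "pr k n (h i w) = h i (pr k (n - i) w)"
  using pr_shift[of 0 i "H i" k n w] wt_h by simp

text \<open>Nonzero weight vectors have degree at least 0, and an operator of index \<open>i\<close>
  shifts the degree by \<open>i\<close>.\<close>

lemma locally_finite: "\<exists>L\<ge>0. \<forall>i < - L. e i w = 0 \<and> h i w = 0 \<and> f i w = 0"
proof (induction w rule: weight_induct)
  case (wt k n w)
  show ?case
  proof (intro exI[of _ n] conjI allI impI)
    fix i assume i: "i < - n"
    then have n: "\<not> n + i \<ge> 0" by simp
    show "e i w = 0" using wt_good[OF wt_e[OF wt(1), of i]] n by auto
    show "h i w = 0" using wt_good[OF wt_h[OF wt(1), of i]] n by auto
    show "f i w = 0" using wt_good[OF wt_f[OF wt(1), of i]] n by auto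
  qed (use wt in auto)
next
  case (add x y)
  then obtain L M where "L \<ge> 0" "\<forall>i < - L. e i x = 0 \<and> h i x = 0 \<and> f i x = 0"
    "M \<ge> 0" "\<forall>i < - M. e i y = 0 \<and> h i y = 0 \<and> f i y = 0" by blast
  then show ?case
    by (intro exI[of _ "max L M"]) (auto simp: rho_add)
qed


text \<open>Reflection of a weight in an sl2-triple whose Cartan element has eigenvalue
  \<open>s k\<close>. Climb with \<open>x\<close> to the top vector \<open>u\<close> of the string,
  reached after \<open>p\<close> steps and of eigenvalue \<open>l = s k + 2 * p\<close>. Up to
  \<open>l\<close> applications of \<open>y\<close> do not kill \<open>u\<close>, as
  \<open>x\<close> takes each of them back to a nonzero multiple of the previous one; the reflected
  weight is reached after \<open>s k + p\<close> of them.\<close>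

lemma sl2_string:
  fixes s :: "int \<Rightarrow> int"
  assumes X: "\<And>k n w. wt k n w \<Longrightarrow> wt (k + a) (n + i) (rho x w)"
    and Y: "\<And>k n w. wt k n w \<Longrightarrow> wt (k - a) (n - i) (rho y w)"
    and XY: "\<And>k n w. wt k n w \<Longrightarrow> rho x (rho y w) = rho y (rho x w) + of_int (s k) *s w"
    and s: "\<And>k. s (k + a) = s k + 2"
    and nil: "\<exists>p. (rho x ^^ p) w = 0"
    and w: "wt k n w" "w \<noteq> 0" "s k \<ge> 0"
  shows "\<exists>u. u \<noteq> 0 \<and> wt (k - a * s k) (n - i * s k) u"
proof -
  define p where "p = (LEAST p. (rho x ^^ Suc p) w = 0)"
  define u where "u = (rho x ^^ p) w"
  obtain p0 where "(rho x ^^ p0) w = 0" using nil by blast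
  with w have "(rho x ^^ Suc (p0 - 1)) w = 0"
    by (cases p0) auto
  then have "(rho x ^^ Suc p) w = 0"
    unfolding p_def by (rule LeastI)
  then have xu: "rho x u = 0"
    by (simp add: u_def)
  have u: "u \<noteq> 0"
  proof (cases p)
    case 0
    then show ?thesis using w by (simp add: u_def)
  next
    case (Suc q)
    then show ?thesis using not_less_Least[of q "\<lambda>p. (rho x ^^ Suc p) w = 0"]
      by (simp add: u_def p_def)
  qed
  have "wt (k + a * int q) (n + i * int q) ((rho x ^^ q) w)" for q
  proof (induction q)
    case (Suc q)
    from X[OF this] show ?case by (simp add: algebra_simps)
  qed (use w in simp)
  then have wtu: "wt (k + a * int p) (n + i * int p) u"
    by (simp add: u_def)
  define l where "l = s k + 2 * int p"
  have sm: "s (k + a * int q) = s k + 2 * int q" for q k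
  proof (induction q)
    case (Suc q)
    then show ?case using s[of "k + a * int q"] by (simp add: algebra_simps)
  qed simp
  have yu: "wt (k + a * int p - a * int q) (n + i * int p - i * int q) ((rho y ^^ q) u)" for q
  proof (induction q)
    case (Suc q)
    from Y[OF this] show ?case by (simp add: algebra_simps)
  qed (use wtu in simp)
  have sl: "s (k + a * int p - a * int q) = l - 2 * int q" for q
    using sm[of "k + a * int p - a * int q" q] sm[of k p] by (simp add: l_def)
  have xy: "rho x ((rho y ^^ Suc q) u) = of_int ((int q + 1) * (l - int q)) *s (rho y ^^ q) u" for q
  proof (induction q)
    case 0
    show ?case using XY[OF wtu] xu sl[of 0] by simp
  next
    case (Suc q)
    have "rho x ((rho y ^^ Suc (Suc q)) u) = rho y (rho x ((rho y ^^ Suc q) u)) + of_int (l - 2 * int (Suc q)) *s (rho y ^^ Suc q) u"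
      using XY[OF yu[of "Suc q"]] unfolding sl by simp
    also have "\<dots> = of_int ((int q + 1) * (l - int q) + (l - 2 * int (Suc q))) *s (rho y ^^ Suc q) u"
      unfolding Suc by (simp add: rho_scale scale_left_distrib del: of_int_mult)
    also have "(int q + 1) * (l - int q) + (l - 2 * int (Suc q)) = (int (Suc q) + 1) * (l - int (Suc q))"
      by (simp add: algebra_simps)
    finally show ?case .
  qed
  have nz: "int q \<le> l \<Longrightarrow> (rho y ^^ q) u \<noteq> 0" for q
  proof (induction q)
    case (Suc q)
    then have "of_int ((int q + 1) * (l - int q)) *s (rho y ^^ q) u \<noteq> 0"
      by (auto simp del: of_int_mult)
    then show ?case using xy[of q] by (metis rho_0)
  qed (use u in simp)
  have q: "int (nat (s k) + p) \<le> l"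
    using w by (simp add: l_def)
  have "wt (k - a * s k) (n - i * s k) ((rho y ^^ (nat (s k) + p)) u)"
    using yu[of "nat (s k) + p"] w(3) by (simp add: algebra_simps)
  with nz[OF q] show ?thesis
    by blast
qed

text \<open>The quantity 4n - k^2 is invariant under the two affine reflections used here, which
  send (k, n) to (2 - k, n - k + 1) and to (- k - 2, n + k + 1). They decrease the absolute value of
  k by 2, until k is 1 or -1 and the claim reads n \<ge> 0.\<close>

lemma weight_bound: "wt k n w \<Longrightarrow> w \<noteq> 0 \<Longrightarrow> 4 * n \<ge> k\<^sup>2 - 1"
proof (induction "nat \<bar>k\<bar>" arbitrary: k n w rule: less_induct)
  case less
  from wt_good[OF less.prems] have kn: "odd k" "n \<ge> 0" by auto
  consider "k \<ge> 3" | "k \<le> -3" | "\<bar>k\<bar> \<le> 2" by linarith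
  then show ?case
  proof cases
    case 1
    have "\<exists>u. u \<noteq> 0 \<and> wt (k - 2 * (k - 1)) (n - 1 * (k - 1)) u"
    proof (rule sl2_string[of 2 1 "E 1" "F (-1)" "\<lambda>k. k - 1" w])
      show "rho (E 1) (rho (F (-1)) w) = rho (F (-1)) (rho (E 1) w) + of_int (k - 1) *s w" if "wt k n w" for k n w
        using that e_f[of 1 "-1" w] by (simp add: wt_def algebra_simps)
    qed (use wt_e[where i=1] wt_f[where i="-1"] integrable less.prems 1 in \<open>auto simp: integrable_module_def\<close>)
    then obtain u where u: "u \<noteq> 0" "wt (2 - k) (n - k + 1) u" by (auto simp: algebra_simps)
    have "4 * (n - k + 1) \<ge> (2 - k)\<^sup>2 - 1"
      by (rule less.hyps[OF _ u(2,1)]) (use 1 in auto)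
    then show ?thesis by (simp add: power2_eq_square algebra_simps)
  next
    case 2
    have "\<exists>u. u \<noteq> 0 \<and> wt (k - (-2) * (- k - 1)) (n - 1 * (- k - 1)) u"
    proof (rule sl2_string[of "-2" 1 "F 1" "E (-1)" "\<lambda>k. - k - 1" w])
      show "rho (F 1) (rho (E (-1)) w) = rho (E (-1)) (rho (F 1) w) + of_int (- k - 1) *s w" if "wt k n w" for k n w
        using that e_f[of "-1" 1 w] by (simp add: wt_def algebra_simps)
    qed (use wt_f[where i=1] wt_e[where i="-1"] integrable less.prems 2 in \<open>auto simp: integrable_module_def\<close>)
    then obtain u where u: "u \<noteq> 0" "wt (- k - 2) (n + k + 1) u" by (auto simp: algebra_simps)
    have "4 * (n + k + 1) \<ge> (- k - 2)\<^sup>2 - 1"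
      by (rule less.hyps[OF _ u(2,1)]) (use 2 in auto)
    then show ?thesis by (simp add: power2_eq_square algebra_simps)
  next
    case 3
    with kn have "k = 1 \<or> k = -1" by (auto simp: abs_le_iff) presburger
    then show ?thesis using kn by auto
  qed
qed

lemma pr_eq_0: "4 * n < k\<^sup>2 - 1 \<Longrightarrow> pr k n w = 0"
  using weight_bound[OF pr_wt[of k n w]] by auto

end

subsection \<open>The relation f(z)^2 = 0\<close>

lemma sum_shift_diff:
  fixes g :: "int \<Rightarrow> 'a::ab_group_add"
  assumes "a \<le> b + 1"
  shows "(\<Sum>i=a..b. g (i + int m) - g i) = (\<Sum>j<m. g (b + 1 + int j) - g (a + int j))"
proof (induction m)
  case (Suc m)
  have "(\<Sum>i=a..b. G (i + 1) - G i) = G (b + 1) - G a" for G :: "int \<Rightarrow> 'a"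
  proof -
    have "a - 1 \<le> b" using assms by simp
    then show ?thesis
    proof (induction rule: int_ge_induct)
      case (step b)
      have "{a..b + 1} = insert (b + 1) {a..b}" using step.hyps by auto
      then show ?case using step by simp
    qed simp
  qed
  from this[of "\<lambda>i. g (i + int m)"]
  have "(\<Sum>i=a..b. g (i + int (Suc m)) - g (i + int m)) = g (b + 1 + int m) - g (a + int m)"
    by (simp add: algebra_simps)
  then have "(\<Sum>i=a..b. (g (i + int m) - g i) + (g (i + int (Suc m)) - g (i + int m)))
    = (\<Sum>j<m. g (b + 1 + int j) - g (a + int j)) + (g (b + 1 + int m) - g (a + int m))"
    unfolding sum.distrib Suc by simp
  then show ?case by simp
qed simp

text \<open>The shift formula behind the central term: the boundary value at minus infinity is not zero.\<close>
lemma (in module) sum_shift_diff_const: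
  fixes g :: "int \<Rightarrow> 'b"
  assumes lo: "\<And>i. i < - L \<Longrightarrow> g i = c" and hi: "\<And>i. i > U \<Longrightarrow> g i = 0"
    and M: "a + \<bar>k\<bar> < - L" "b - \<bar>k\<bar> > U" "a \<le> b + 1"
  shows "(\<Sum>i=a..b. g (i + k) - g i) = of_int (- k) *s c"
proof (cases "k \<ge> 0")
  case True
  then obtain m where m: "k = int m" using nonneg_eq_int by blast
  have "(\<Sum>j<m. g (b + 1 + int j) - g (a + int j)) = (\<Sum>j<m. - c)"
    by (rule sum.cong) (use M m in \<open>auto simp: lo hi\<close>)
  then show ?thesis
    using sum_shift_diff[of a b g m] M by (simp add: m sum_constant_scale del: sum_constant)
next
  case False
  then obtain m where m: "k = - int m" by (metis int_cases2 neg_0_le_iff_le of_nat_0_le_iff)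
  define g' where "g' i = g (i + k)" for i
  have "(\<Sum>i=a..b. g' (i + int m) - g' i) = (\<Sum>j<m. g' (b + 1 + int j) - g' (a + int j))"
    by (rule sum_shift_diff) (use M in simp)
  also have "\<dots> = (\<Sum>j<m. - c)"
    by (rule sum.cong) (use M m in \<open>auto simp: g'_def lo hi\<close>)
  finally have "(\<Sum>i=a..b. g i - g (i + k)) = - of_nat m *s c"
    by (simp add: g'_def m sum_constant_scale del: sum_constant)
  then have "- (\<Sum>i=a..b. g i - g (i + k)) = of_nat m *s c"
    by simp
  then show ?thesis
    by (simp add: m flip: sum_negf)
qed

section \<open>The coefficients of f(z)^2 and their commutators with the generators\<close>

context level_one_module begin

text \<open>Coefficients of \<open>f(z)^2\<close>, where \<open>f(z) = (\<Sum>i. z ^ i * f i)\<close>; by \<open>locally_finite\<close> the sum is finite.\<close>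
definition f2 :: "int \<Rightarrow> 'v \<Rightarrow> 'v" where
  "f2 s w = (\<Sum>i | f i (f (s - i) w) \<noteq> 0. f i (f (s - i) w))"

text \<open>The range \<open>A\<close> is left free so that coefficients for different
  \<open>s\<close> and different vectors can be summed over a common window.\<close>

lemma f2_eq:
  assumes "\<And>i. i < - L \<Longrightarrow> f i w = 0" and "finite A" "{- L..s + L} \<subseteq> A"
  shows "f2 s w = (\<Sum>i\<in>A. f i (f (s - i) w))"
proof -
  have "f i (f (s - i) w) = 0" if "i \<notin> A" for i
  proof -
    have "i \<notin> {- L..s + L}" using that assms(3) by blast
    then have "i < - L \<or> s - i < - L" by auto
    then show ?thesis using assms(1) f_f[of i "s - i" w] by auto
  qed
  then show ?thesis
    unfolding f2_def by (intro sum.mono_neutral_left) (use assms in auto)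
qed

lemma f2_hom: "module_hom scale scale (f2 s)"
proof -
  have "f2 s (x + y) = f2 s x + f2 s y" for x y
  proof -
    obtain L M where L: "\<forall>i < - L. e i x = 0 \<and> h i x = 0 \<and> f i x = 0"
      and M: "\<forall>i < - M. e i y = 0 \<and> h i y = 0 \<and> f i y = 0"
      using locally_finite by blast
    define K where "K = max L M"
    have "f2 s z = (\<Sum>i=-K..s+K. f i (f (s - i) z))" if "z \<in> {x, y, x + y}" for z
      by (rule f2_eq[of K]) (use that L M in \<open>auto simp: K_def rho_add\<close>)
    then show ?thesis by (simp add: rho_add sum.distrib)
  qed
  moreover have "f2 s (c *s x) = c *s f2 s x" for c x
  proof -
    obtain L where L: "\<forall>i < - L. e i x = 0 \<and> h i x = 0 \<and> f i x = 0"
      using locally_finite by blast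
    have "f2 s z = (\<Sum>i=-L..s+L. f i (f (s - i) z))" if "z \<in> {x, c *s x}" for z
      by (rule f2_eq[of L]) (use that L in \<open>auto simp: rho_scale\<close>)
    then show ?thesis by (simp add: rho_scale scale_sum_right)
  qed
  ultimately show ?thesis
    by (simp add: module_hom_iff module_axioms)
qed

lemma f2_0: "f2 s 0 = 0"
  using module_hom.zero[OF f2_hom] .

lemma locally_finite2: "\<exists>L\<ge>0. \<forall>i < - L. f i w = 0 \<and> h i w = 0 \<and> f i w' = 0"
proof -
  obtain L M where "L \<ge> 0" "M \<ge> 0" and L: "\<forall>i < - L. e i w = 0 \<and> h i w = 0 \<and> f i w = 0"
    and M: "\<forall>i < - M. e i w' = 0 \<and> h i w' = 0 \<and> f i w' = 0"
    using locally_finite by meson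
  then show ?thesis by (intro exI[of _ "max L M"]) auto
qed

lemma f_f2: "f k (f2 s w) = f2 s (f k w)"
proof -
  obtain L where L: "\<forall>i < - L. f i w = 0 \<and> h i w = 0 \<and> f i (f k w) = 0"
    using locally_finite2 by blast
  have "f2 s z = (\<Sum>i=-L..s+L. f i (f (s - i) z))" if "z \<in> {w, f k w}" for z
    by (rule f2_eq[of L]) (use that L in auto)
  then have "f k (f2 s w) = (\<Sum>i=-L..s+L. f k (f i (f (s - i) w)))"
    "f2 s (f k w) = (\<Sum>i=-L..s+L. f i (f (s - i) (f k w)))" by (simp_all add: rho_sum)
  moreover have "f k (f i (f (s - i) w)) = f i (f (s - i) (f k w))" for i
    using f_f[of k i] f_f[of k "s - i"] by simp
  ultimately show ?thesis by simp
qed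

lemma h_f2: "h k (f2 s w) = f2 s (h k w) - 4 *s f2 (s + k) w"
proof -
  obtain L where L: "\<forall>i < - L. f i w = 0 \<and> h i w = 0 \<and> f i (h k w) = 0"
    using locally_finite2 by blast
  define M where "M = L + \<bar>k\<bar>"
  have s: "f2 s z = (\<Sum>i=-M..s+M. f i (f (s - i) z))" if "z \<in> {w, h k w}" for z
    by (rule f2_eq[of L]) (use that L in \<open>auto simp: M_def\<close>)
  have a: "f2 (s + k) w = (\<Sum>i=-M..s+M. f i (f (s + k - i) w))"
    by (rule f2_eq[of L]) (use L in \<open>auto simp: M_def\<close>)
  \<comment> \<open>The same coefficient over a shifted window: reindexing gives the sum in which
    h_k has hit the first factor.\<close>
  have "f2 (s + k) w = (\<Sum>i=-M+k..s+M+k. f i (f (s + k - i) w))"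
    by (rule f2_eq[of L]) (use L in \<open>auto simp: M_def\<close>)
  also have "\<dots> = (\<Sum>i=-M..s+M. f (i + k) (f (s - i) w))"
    by (rule sum.reindex_bij_witness[of _ "\<lambda>i. i + k" "\<lambda>i. i - k"]) (auto simp: algebra_simps)
  finally have b: "f2 (s + k) w = (\<Sum>i=-M..s+M. f (i + k) (f (s - i) w))" .
  have "h k (f i (f (s - i) w)) = f i (f (s - i) (h k w)) - 2 *s f i (f (s + k - i) w) - 2 *s f (i + k) (f (s - i) w)" for i
    by (simp add: h_f rho_diff rho_scale algebra_simps)
  then have "h k (f2 s w) = f2 s (h k w) - 2 *s f2 (s + k) w - 2 *s f2 (s + k) w"
    using a b by (simp add: s rho_sum sum_subtractf flip: scale_sum_right)
  then show ?thesis
    by (simp flip: scale_left_distrib add: diff_diff_eq)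
qed

lemma d_f2: "d (f2 s w) = f2 s (d w) + of_int s *s f2 s w"
proof -
  obtain L where L: "\<forall>i < - L. f i w = 0 \<and> h i w = 0 \<and> f i (d w) = 0"
    using locally_finite2 by blast
  have s: "f2 s z = (\<Sum>i=-L..s+L. f i (f (s - i) z))" if "z \<in> {w, d w}" for z
    by (rule f2_eq[of L]) (use that L in auto)
  have "d (f i (f (s - i) w)) = f i (f (s - i) (d w)) + of_int s *s f i (f (s - i) w)" for i
    by (simp add: d_f rho_linear algebra_simps)
  then show ?thesis
    by (simp add: s rho_sum sum.distrib scale_sum_right)
qed

text \<open>The commutator of e_k with \<open>f2 s\<close> depends on \<open>s + k\<close> only. The
  two sides differ by the sum of \<open>g (i + k) - g i\<close> and two central terms. With the
  value -2 f_(s+k) w of \<open>g\<close> at minus infinity the sum is 2k f_(s+k) w, and at level 1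
  the central terms are - k f_(s+k) w each, so everything cancels.\<close>

lemma e_f2: "e k (f2 s w) - f2 s (e k w) = e 0 (f2 (s + k) w) - f2 (s + k) (e 0 w)"
proof -
  obtain L0 where L0: "\<forall>i < - L0. f i w = 0 \<and> h i w = 0 \<and> f i (e k w) = 0"
    using locally_finite2 by blast
  obtain L1 where L1: "\<forall>i < - L1. f i w = 0 \<and> h i w = 0 \<and> f i (e 0 w) = 0"
    using locally_finite2 by blast
  define L where "L = max 0 (max L0 L1) + \<bar>s\<bar>"
  define M where "M = L + 2 * \<bar>k\<bar> + 1"
  have Lw: "f i w = 0" "h i w = 0" "f i (e k w) = 0" "f i (e 0 w) = 0" if "i < - L" for i
    using L0 L1 that by (auto simp: L_def)
  have s: "f2 s z = (\<Sum>i=-M..s+M. f i (f (s - i) z))" if "z \<in> {w, e k w}" for z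
    by (rule f2_eq[of L]) (use that Lw in \<open>auto simp: M_def\<close>)
  have sk: "f2 (s + k) z = (\<Sum>i=-M..s+M. f i (f (s + k - i) z))" if "z \<in> {w, e 0 w}" for z
    by (rule f2_eq[of L]) (use that Lw in \<open>auto simp: M_def\<close>)
  define g where "g i = h i (f (s + k - i) w)" for i
  define c :: "int \<Rightarrow> complex" where "c j = of_int (if j = 0 then - k else 0)" for j
  have 1: "e k (f i (f (s - i) w)) - f i (f (s - i) (e k w)) =
      g (i + k) + f i (h (s + k - i) w) + c (k + i) *s f (s - i) w + c (k + s - i) *s f i w" for i
  proof -
    have "e k (f i (f (s - i) w)) = f i (e k (f (s - i) w)) + h (k + i) (f (s - i) w) + c (k + i) *s f (s - i) w"
      using e_f[of k i "f (s - i) w"] unfolding c_def .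
    also have "e k (f (s - i) w) = f (s - i) (e k w) + h (s + k - i) w + c (k + s - i) *s w"
      using e_f[of k "s - i" w] unfolding c_def by (simp add: algebra_simps)
    finally show ?thesis
      by (simp add: g_def rho_add rho_scale algebra_simps)
  qed
  have 2: "e 0 (f i (f (s + k - i) w)) - f i (f (s + k - i) (e 0 w)) = g i + f i (h (s + k - i) w)" for i
    by (simp add: e_f[of 0] rho_add g_def algebra_simps)
  have "(\<Sum>i=-M..s+M. c (k + i) *s f (s - i) w) = (\<Sum>i=-M..s+M. if i = - k then of_int (- k) *s f (s + k) w else 0)"
    by (rule sum.cong) (auto simp: c_def)
  also have "\<dots> = of_int (- k) *s f (s + k) w"
    by (subst sum.delta) (auto simp: M_def L_def)
  finally have 3: "(\<Sum>i=-M..s+M. c (k + i) *s f (s - i) w) = of_int (- k) *s f (s + k) w" .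
  have "(\<Sum>i=-M..s+M. c (k + s - i) *s f i w) = (\<Sum>i=-M..s+M. if i = s + k then of_int (- k) *s f (s + k) w else 0)"
    by (rule sum.cong) (auto simp: c_def)
  also have "\<dots> = of_int (- k) *s f (s + k) w"
    by (subst sum.delta) (auto simp: M_def L_def)
  finally have 4: "(\<Sum>i=-M..s+M. c (k + s - i) *s f i w) = of_int (- k) *s f (s + k) w" .
  have 5: "(\<Sum>i=-M..s+M. g (i + k) - g i) = of_int (- k) *s ((- 2) *s f (s + k) w)"
  proof (rule sum_shift_diff_const[of L _ _ "s + k + L"])
    \<comment> \<open>Far to the left h_i kills \<open>w\<close> but not f_(s+k-i) w, so the
      commutator of h and f survives as boundary value.\<close>
    show "g i = (- 2) *s f (s + k) w" if "i < - L" for i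
      using h_f[of i "s + k - i" w] Lw[OF that] by (simp add: g_def)
    show "g i = 0" if "i > s + k + L" for i
      using Lw(1)[of "s + k - i"] that by (simp add: g_def)
  qed (auto simp: M_def L_def)
  have "(e k (f2 s w) - f2 s (e k w)) - (e 0 (f2 (s + k) w) - f2 (s + k) (e 0 w)) =
    (\<Sum>i=-M..s+M. (e k (f i (f (s - i) w)) - f i (f (s - i) (e k w))) - (e 0 (f i (f (s + k - i) w)) - f i (f (s + k - i) (e 0 w))))"
    by (simp add: s sk rho_sum sum_subtractf)
  also have "\<dots> = (\<Sum>i=-M..s+M. (g (i + k) - g i) + (c (k + i) *s f (s - i) w + c (k + s - i) *s f i w))"
    unfolding 1 2 by (rule sum.cong) auto
  also have "\<dots> = 0"
    unfolding sum.distrib 3 4 5 by (simp only: scale_scale flip: scale_left_distrib) simp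
  finally show ?thesis by simp
qed


text \<open>The a-th power of ad e_0 applied to \<open>f2 s\<close>. By \<open>e_f2\<close> these
  operators form a loop module under the adjoint action; the factors 2a - 4 and a (5 - a) in
  \<open>h_f2ad\<close> and \<open>f_f2ad\<close> are those of the five-dimensional sl2-module with
  lowest weight vector f^2.\<close>

primrec f2ad :: "nat \<Rightarrow> int \<Rightarrow> 'v \<Rightarrow> 'v" where
  "f2ad 0 s w = f2 s w"
| "f2ad (Suc a) s w = e 0 (f2ad a s w) - f2ad a s (e 0 w)"

lemma f2ad_hom: "module_hom scale scale (f2ad a s)"
proof (induction a)
  case 0
  show ?case using f2_hom by (simp add: module_hom_iff)
next
  case (Suc a)
  then show ?case
    by (simp add: module_hom_iff rho_add rho_scale scale_right_diff_distrib)
qed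

lemma f2ad_add: "f2ad a s (x + y) = f2ad a s x + f2ad a s y"
  and f2ad_scale: "f2ad a s (c *s x) = c *s f2ad a s x"
  and f2ad_diff: "f2ad a s (x - y) = f2ad a s x - f2ad a s y"
  and f2ad_0: "f2ad a s 0 = 0"
  using module_hom.add[OF f2ad_hom] module_hom.scale[OF f2ad_hom] module_hom.diff[OF f2ad_hom]
    module_hom.zero[OF f2ad_hom] by auto

lemma e_f2ad: "e k (f2ad a s w) = f2ad a s (e k w) + f2ad (Suc a) (s + k) w"
proof (induction a arbitrary: w)
  case 0
  then show ?case using e_f2[of k s w] by (simp add: algebra_simps)
next
  case (Suc a)
  have "e k (f2ad (Suc a) s w) = e 0 (e k (f2ad a s w)) - e k (f2ad a s (e 0 w))"
    by (simp add: rho_diff e_e[of k 0])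
  also have "\<dots> = f2ad (Suc a) s (e k w) + f2ad (Suc (Suc a)) (s + k) w"
    by (simp add: Suc rho_add e_e[of k 0] del: f2ad.simps(2)) (simp add: rho_diff algebra_simps)
  finally show ?case .
qed

lemma h_f2ad: "h k (f2ad a s w) = f2ad a s (h k w) + (2 * of_nat a - 4) *s f2ad a (s + k) w"
proof (induction a arbitrary: w)
  case 0
  then show ?case using h_f2[of k s w] by simp
next
  case (Suc a)
  have "h k (f2ad (Suc a) s w) = e 0 (h k (f2ad a s w)) + 2 *s e k (f2ad a s w) - h k (f2ad a s (e 0 w))"
    by (simp add: rho_diff h_e)
  also have "\<dots> = f2ad (Suc a) s (h k w) + (2 * of_nat (Suc a) - 4) *s f2ad (Suc a) (s + k) w"
    using scale_left_distrib[of 2 2] unfolding Suc e_f2ad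
    by (simp add: h_e rho_linear f2ad_add f2ad_scale algebra_simps)
  finally show ?case .
qed

lemma f_f2ad: "f k (f2ad a s w) = f2ad a s (f k w) + (of_nat a * (5 - of_nat a)) *s f2ad (a - 1) (s + k) w"
proof (induction a arbitrary: w)
  case 0
  then show ?case by (simp add: f_f2)
next
  case (Suc a)
  have fe: "f k (e 0 u) = e 0 (f k u) - h k u" for u
    using e_f[of 0 k u] by simp
  \<comment> \<open>For \<open>a = 0\<close> the factor \<open>of_nat a\<close> annihilates both
    sides, so the truncated \<open>a - 1\<close> does no harm.\<close>
  have *: "(of_nat a * (5 - of_nat a)) *s (e 0 (f2ad (a - 1) (s + k) w) - f2ad (a - 1) (s + k) (e 0 w))
    = (of_nat a * (5 - of_nat a)) *s f2ad a (s + k) w"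
    by (cases a) simp_all
  have "f k (f2ad (Suc a) s w) = e 0 (f k (f2ad a s w)) - h k (f2ad a s w) - f k (f2ad a s (e 0 w))"
    by (simp add: rho_diff fe)
  also have "\<dots> = f2ad (Suc a) s (f k w)
     + (of_nat a * (5 - of_nat a)) *s (e 0 (f2ad (a - 1) (s + k) w) - f2ad (a - 1) (s + k) (e 0 w))
     - (2 * of_nat a - 4) *s f2ad a (s + k) w"
    unfolding Suc h_f2ad by (simp add: fe rho_add rho_scale f2ad_diff scale_right_diff_distrib)
  also have "\<dots> = f2ad (Suc a) s (f k w) + (of_nat a * (5 - of_nat a) - (2 * of_nat a - 4)) *s f2ad a (s + k) w"
    unfolding * by (simp add: scale_left_diff_distrib)
  also have "of_nat a * (5 - of_nat a) - (2 * of_nat a - 4) = (of_nat (Suc a) * (5 - of_nat (Suc a)) :: complex)"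
    by (simp add: algebra_simps)
  finally show ?case by simp
qed

lemma d_f2ad: "d (f2ad a s w) = f2ad a s (d w) + of_int s *s f2ad a s w"
proof (induction a arbitrary: w)
  case (Suc a)
  then show ?case
    by (simp add: rho_diff d_e[of 0] rho_add rho_scale scale_right_diff_distrib)
qed (simp add: d_f2)

lemma wt_f2ad:
  assumes "wt k n w"
  shows "wt (k + 2 * int a - 4) (n + s) (f2ad a s w)"
  using assms h_f2ad[of 0 a s w] d_f2ad[of a s w]
  by (simp add: wt_def f2ad_scale scale_left_distrib scale_left_diff_distrib)

text \<open>A component of weight (1, 0) would come from weight (-1, -i), (1, -i) or (3, -i), all
  excluded by \<open>weight_bound\<close>; for \<open>F 0\<close> it is (3, 0) that is
  excluded.\<close>

lemma pr_creation: "x \<in> creation \<Longrightarrow> pr 1 0 (rho x w) = 0"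
  unfolding creation_def by (auto simp: pr_e pr_h pr_f pr_eq_0)

lemma f0_f0_v: "f 0 (f 0 v) = 0"
proof (rule ccontr)
  assume "f 0 (f 0 v) \<noteq> 0"
  moreover have "wt (-3) 0 (f 0 (f 0 v))"
    using wt_f[OF wt_f[OF wt_v, of 0], of 0] by simp
  ultimately show False using weight_bound by fastforce
qed

lemma f2_0_v: "f2 0 v = 0"
  using f2_eq[of 0 v "{0}" 0] by (simp add: f_v f0_f0_v)

text \<open>Creation generators are moved to the left, where \<open>pr_creation\<close> removes
  them; the commutators are again of the form \<open>f2ad a s\<close>, hence the generality in
  \<open>a\<close> and \<open>s\<close>. At \<open>v\<close> only \<open>a = 2\<close>,
  \<open>s = 0\<close> has weight (1, 0), and there e_0 v = 0 and f_0 f_0 v = 0 give the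
  claim.\<close>

lemma pr_f2ad_words: "w \<in> words \<Longrightarrow> pr 1 0 (f2ad a s w) = 0"
proof (induction arbitrary: a s rule: words.induct)
  case words_v
  show ?case
  proof (cases "a = 2 \<and> s = 0")
    case True
    have "f2ad 2 0 v = 0"
      by (simp add: numeral_2_eq_2 e_v f2_0 f2_0_v)
    with True show ?thesis by simp
  next
    case False
    then have "(1 + 2 * int a - 4, 0 + s) \<noteq> (1, 0)" by auto
    then show ?thesis using pr_other[OF wt_f2ad[OF wt_v, of a s]] by blast
  qed
next
  case (words_step w x)
  have *: "pr 1 0 (rho x u) = 0" for u
    by (rule pr_creation) (rule words_step.hyps)
  consider i where "x = E i" | i where "x = H i" | i where "x = F i"
    using words_step.hyps(2) unfolding creation_def by blast
  then show ?case
  proof cases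
    case 1
    then have "f2ad a s (rho x w) = rho x (f2ad a s w) - f2ad (Suc a) (s + i) w"
      using e_f2ad[of i a s w] by (simp add: algebra_simps)
    then show ?thesis unfolding pr_diff[symmetric] by (simp only: pr_diff * words_step.IH) simp
  next
    case 2
    then have "f2ad a s (rho x w) = rho x (f2ad a s w) - (2 * of_nat a - 4) *s f2ad a (s + i) w"
      using h_f2ad[of i a s w] by (simp add: algebra_simps)
    then show ?thesis by (simp only: pr_diff pr_scale * words_step.IH) simp
  next
    case 3
    then have "f2ad a s (rho x w) = rho x (f2ad a s w) - (of_nat a * (5 - of_nat a)) *s f2ad (a - 1) (s + i) w"
      using f_f2ad[of i a s w] by (simp add: algebra_simps)
    then show ?thesis by (simp only: pr_diff pr_scale * words_step.IH) simp
  qed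
qed

lemma pr_f2ad: "pr 1 0 (f2ad a s w) = 0"
proof -
  have "w \<in> span words" by (simp add: span_words)
  then show ?thesis
    by (induction rule: span_induct_alt)
      (simp_all add: f2ad_add f2ad_scale f2ad_0 pr_add pr_scale pr_f2ad_words)
qed

text \<open>The operators \<open>f2ad a s\<close> are permuted by the adjoint action, so their joint image is a
  submodule; it misses the highest weight vector and is therefore zero.\<close>
theorem f2_eq_0: "f2 s w = 0"
proof -
  define Y where "Y = span {f2ad a s w | a s w. True}"
  have base: "f2ad a s w \<in> Y" for a s w
    unfolding Y_def by (rule span_base) blast
  have sub: "subspace Y" unfolding Y_def by simp
  note Y_intros = subspace_add[OF sub] subspace_scale[OF sub] base
  have "rho x (f2ad a s w) \<in> Y" for x a s w
  proof (cases x)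
    case (E k)
    show ?thesis unfolding E e_f2ad by (intro Y_intros)
  next
    case (F k)
    show ?thesis unfolding F f_f2ad by (intro Y_intros)
  next
    case (H k)
    show ?thesis unfolding H h_f2ad by (intro Y_intros)
  next
    case D
    show ?thesis unfolding D d_f2ad by (intro Y_intros)
  next
    case C
    show ?thesis using base by (simp add: C)
  qed
  then have "rho x u \<in> Y" if "u \<in> {f2ad a s w | a s w. True}" for x u
    using that by blast
  then have inv: "rho x u \<in> Y" if "u \<in> Y" for x u
    using that rho_span_subset[of "{f2ad a s w | a s w. True}" x "{f2ad a s w | a s w. True}" u]
    by (simp only: Y_def)
  have pr0: "pr 1 0 u = 0" if "u \<in> Y" for u
    using that unfolding Y_def
  proof (induction rule: span_induct_alt)
    case (step c x y)
    then obtain a s w where "x = f2ad a s w" by blast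
    with step show ?case by (simp add: pr_add pr_scale pr_f2ad)
  qed simp
  have "Y \<noteq> UNIV"
    using pr0[of v] pr_same[OF wt_v] v_nz by auto
  then have "f2ad 0 s w = 0"
    using irreducible_eq_UNIV[OF sub inv base[of 0 s w]] by blast
  then show ?thesis by simp
qed

text \<open>Read off the coefficients 2a and 2a - 1 of f(z)^2 = 0: apart from f_a f_a, respectively
  f_a f_(a-1) counted twice, every product has a factor of index greater than a, which can be moved
  to the front.\<close>

lemma f_square_span:
  shows "f a (f a w) \<in> span {f i w | i w. i > a}" and "f a (f (a - 1) w) \<in> span {f i w | i w. i > a}"
proof -
  obtain L where "L \<ge> 0" and L: "\<forall>i < - L. e i w = 0 \<and> h i w = 0 \<and> f i w = 0"
    using locally_finite by blast
  define M where "M = L + \<bar>a\<bar> + 1"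
  have f2: "(\<Sum>i=-M..s+M. f i (f (s - i) w)) = 0" if "s = 2 * a \<or> s = 2 * a - 1" for s
    by (subst f2_eq[of L w "{-M..s+M}" s, symmetric]) (use L in \<open>auto simp: M_def f2_eq_0\<close>)
  let ?S = "span {f i w | i w. i > a}"
  have in_S: "f i (f j w) \<in> ?S" if "i > a \<or> j > a" for i j
  proof -
    have *: "f i u \<in> ?S" if "i > a" for i u
      using that by (intro span_base) blast
    show ?thesis
      using that *[of i "f j w"] *[of j "f i w"] by (subst f_f) (auto simp: f_f[of j i])
  qed
  have sub: "t \<in> ?S" if "c *s t + r = 0" "r \<in> ?S" "c \<noteq> 0" for c t r
  proof -
    have "c *s t \<in> ?S" using span_neg[OF that(2)] that(1) by (simp add: eq_neg_iff_add_eq_0[symmetric])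
    from span_scale[OF this, of "inverse c"] show ?thesis using that(3) by simp
  qed
  have "(\<Sum>i=-M..2*a+M. f i (f (2 * a - i) w)) = f a (f (2 * a - a) w) + (\<Sum>i\<in>{-M..2*a+M} - {a}. f i (f (2 * a - i) w))"
    by (rule sum.remove) (use \<open>L \<ge> 0\<close> in \<open>auto simp: M_def\<close>)
  then have "1 *s f a (f a w) + (\<Sum>i\<in>{-M..2*a+M} - {a}. f i (f (2 * a - i) w)) = 0"
    using f2[of "2 * a"] by simp
  moreover have "(\<Sum>i\<in>{-M..2*a+M} - {a}. f i (f (2 * a - i) w)) \<in> ?S"
    by (intro span_sum in_S) auto
  ultimately show "f a (f a w) \<in> ?S"
    by (rule sub) simp
  have mem: "a \<in> {-M..2*a-1+M}" "a - 1 \<in> {-M..2*a-1+M}"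
    using \<open>L \<ge> 0\<close> by (auto simp: M_def)
  have "{-M..2*a-1+M} = insert a (insert (a - 1) ({-M..2*a-1+M} - {a, a - 1}))"
    using mem by blast
  then have "(\<Sum>i=-M..2*a-1+M. f i (f (2 * a - 1 - i) w)) =
     (\<Sum>i\<in>insert a (insert (a - 1) ({-M..2*a-1+M} - {a, a - 1})). f i (f (2 * a - 1 - i) w))"
    by (rule sum.cong) (rule refl)
  also have "\<dots> = f a (f (a - 1) w) + (f (a - 1) (f a w) + (\<Sum>i\<in>{-M..2*a-1+M} - {a, a - 1}. f i (f (2 * a - 1 - i) w)))"
    by simp
  finally have "2 *s f a (f (a - 1) w) + (\<Sum>i\<in>{-M..2*a-1+M} - {a, a - 1}. f i (f (2 * a - 1 - i) w)) = 0"
    using f2[of "2 * a - 1"] scale_left_distrib[of 1 1 "f a (f (a - 1) w)"] f_f[of "a - 1" a w] by (simp add: add.assoc)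
  moreover have "(\<Sum>i\<in>{-M..2*a-1+M} - {a, a - 1}. f i (f (2 * a - 1 - i) w)) \<in> ?S"
    by (intro span_sum in_S) auto
  ultimately show "f a (f (a - 1) w) \<in> ?S"
    by (rule sub) simp
qed

text \<open>The Chevalley involution exchanging e and f, with t, c and d fixed. Twisting by it keeps
  the level and the highest weight 1, with f_0 v, of h_0-weight -1, as the new highest weight
  vector; so results on f carry over to e.\<close>

definition flip_rho :: "gen \<Rightarrow> 'v \<Rightarrow> 'v" where
  "flip_rho x = (case x of E i \<Rightarrow> f i | F i \<Rightarrow> e i | H i \<Rightarrow> (\<lambda>w. - h i w) | C \<Rightarrow> rho C | D \<Rightarrow> d)"

lemma flip_rho_simps:
  "flip_rho (E i) = f i" "flip_rho (F i) = e i" "flip_rho (H i) = (\<lambda>w. - h i w)"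
  "flip_rho C = rho C" "flip_rho D = d"
  by (simp_all add: flip_rho_def)

lemma level_one_module_flip: "level_one_module scale flip_rho (f 0 v)"
proof (unfold_locales)
  have hom: "module_hom scale scale (flip_rho x)" for x
    by (cases x) (simp_all add: flip_rho_simps rho_hom module_hom_iff rho_add rho_scale module_axioms)
  show "affine_sl2_module scale flip_rho"
    unfolding affine_sl2_module_def comm_def flip_rho_simps
  proof (intro conjI allI)
    show "vector_space scale" by (rule vector_space_axioms)
    show "module_hom scale scale (flip_rho x)" for x by (rule hom)
    show "f i (e j w) - e j (f i w) = - h (i + j) w + of_int (if i + j = 0 then - i else 0) *s rho C w" for i j w
    proof (cases "i + j = 0")
      case True
      then have "i = - j" by simp
      then show ?thesis using e_f[of j i w] by simp
    next
      case False
      then show ?thesis using e_f[of j i w] by (simp add: add.commute)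
    qed
    show "- h i (f j w) - f j (- h i w) = 2 *s f (i + j) w" for i j w
      using h_f[of i j w] by (simp add: rho_minus)
    show "- h i (e j w) - e j (- h i w) = (- 2) *s e (i + j) w" for i j w
      using h_e[of i j w] by (simp add: rho_minus)
    show "- h i (- h j w) - - h j (- h i w) = of_int (if i + j = 0 then - 2 * i else 0) *s rho C w" for i j w
      using h_h[of i j w] by (simp add: rho_minus)
    show "rho C (flip_rho x w) - flip_rho x (rho C w) = 0" for x w
      by simp
    show "d (- h i w) - - h i (d w) = of_int i *s - h i w" for i w
      using d_h[of i w] by (simp add: rho_minus)
  qed (auto simp: f_f e_e d_e d_f)
  show "irreducible_module scale flip_rho"
    unfolding irreducible_module_def
  proof (intro conjI allI impI)
    show "\<exists>w. w \<noteq> (0::'v)" using v_nz by blast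
    fix S assume S: "subspace S \<and> (\<forall>x. \<forall>w\<in>S. flip_rho x w \<in> S) \<and> S \<noteq> {0}"
    then have fl: "flip_rho x w \<in> S" if "w \<in> S" for x w using that by blast
    have "rho x w \<in> S" if "w \<in> S" for x w
    proof (cases x)
      case (H i)
      have "- (- h i w) \<in> S"
        using fl[OF that, of "H i"] S subspace_neg[of S "- h i w"] by (simp add: flip_rho_simps)
      then show ?thesis by (simp add: H)
    next
      case (E i)
      then show ?thesis using fl[OF that, of "F i"] by (simp add: flip_rho_simps)
    next
      case (F i)
      then show ?thesis using fl[OF that, of "E i"] by (simp add: flip_rho_simps)
    next
      case C
      then show ?thesis using that by simp
    next
      case D
      then show ?thesis using fl[OF that, of D] by (simp add: flip_rho_simps)
    qed
    then show "S = UNIV"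
      using S irr unfolding irreducible_module_def by blast
  qed
  show "integrable_module flip_rho"
    using integrable unfolding integrable_module_def by (simp add: flip_rho_simps)
  show "flip_rho C w = w" for w by (simp add: flip_rho_simps)
  have "f 0 v \<noteq> 0"
  proof
    assume "f 0 v = 0"
    then have "e 0 (f 0 v) = 0" by simp
    then show False using e_f[of 0 0 v] v_nz by (simp add: e_v h0_v)
  qed
  moreover have "h 0 (f 0 v) = - f 0 v"
    using wt_f[OF wt_v, of 0] by (simp add: wt_def)
  moreover have "d (f 0 v) = 0"
    using wt_f[OF wt_v, of 0] by (simp add: wt_def)
  moreover have "f i (f 0 v) = 0" if "i \<le> 0" for i
    using that f_f[of i 0 v] f0_f0_v by (cases "i = 0") (auto simp: f_v)
  moreover have "h i (f 0 v) = 0" "e i (f 0 v) = 0" if "i < 0" for i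
    using that h_f[of i 0 v] e_f[of i 0 v] by (auto simp: h_v f_v e_v)
  ultimately show "hw_vector_L11 flip_rho (f 0 v)"
    unfolding hw_vector_L11_def by (simp add: flip_rho_simps)
qed

lemma e_square_span:
  shows "e a (e a w) \<in> span {e i w | i w. i > a}" and "e a (e (a - 1) w) \<in> span {e i w | i w. i > a}"
  using level_one_module.f_square_span[OF level_one_module_flip] by (simp_all add: flip_rho_simps)

end

subsection \<open>The index set\<close>

text \<open>The shift of the index lets the recursion start with the empty set at
  \<open>N = 0\<close>, in accordance with \<open>spans_0_0\<close>; \<open>C1 0\<close> already has
  one element.\<close>

definition Cpairs :: "nat \<Rightarrow> ((nat \<Rightarrow> nat) \<times> (nat \<Rightarrow> nat)) set" where
  "Cpairs N = (if N = 0 then {} else C1 (N - 1))"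

lemma Cpairs_iff:
  "(a, b) \<in> Cpairs N \<longleftrightarrow>
     (\<forall>i. a i \<le> 1 \<and> b i \<le> 1) \<and> (\<forall>i\<ge>N. a i = 0 \<and> b i = 0) \<and> b 0 = 0 \<and>
     (\<forall>i. b (Suc i) + a (Suc i) + a i \<le> 1) \<and> (\<forall>i. b (Suc i) + b i + a i \<le> 1) \<and>
     (\<forall>i. b i \<noteq> 0 \<longrightarrow> (\<exists>j>i. a j \<noteq> 0 \<and> (\<forall>s. i < s \<and> s \<le> j \<longrightarrow> b s = 0))) \<and>
     (\<exists>j. a j \<noteq> 0 \<and> (\<forall>s\<le>j. b s = 0))"
proof (cases N)
  case 0
  then show ?thesis by (auto simp: Cpairs_def)
next
  case (Suc n)
  have "(\<forall>i\<ge>N. a i = 0 \<and> b i = 0) \<longleftrightarrow> (\<forall>i>n. a i = 0) \<and> (\<forall>i>n. b i = 0)"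
    by (auto simp: Suc Suc_le_eq)
  then show ?thesis
    by (simp add: Cpairs_def C1_def Suc Suc_le_eq) blast
qed

lemma CpairsD:
  assumes "(a, b) \<in> Cpairs N"
  shows "a i \<le> 1" "b i \<le> 1" "i \<ge> N \<Longrightarrow> a i = 0" "i \<ge> N \<Longrightarrow> b i = 0" "b 0 = 0"
    "b (Suc i) + a (Suc i) + a i \<le> 1" "b (Suc i) + b i + a i \<le> 1"
    "b i \<noteq> 0 \<Longrightarrow> \<exists>j>i. a j \<noteq> 0 \<and> (\<forall>s. i < s \<and> s \<le> j \<longrightarrow> b s = 0)"
    "\<exists>j. a j \<noteq> 0 \<and> (\<forall>s\<le>j. b s = 0)"
  using assms unfolding Cpairs_iff by blast+

lemma CpairsI:
  assumes "\<And>i. a i \<le> 1" "\<And>i. b i \<le> 1" "\<And>i. i \<ge> N \<Longrightarrow> a i = 0 \<and> b i = 0" "b 0 = 0"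
    "\<And>i. b (Suc i) + a (Suc i) + a i \<le> 1" "\<And>i. b (Suc i) + b i + a i \<le> 1"
    "\<And>i. b i \<noteq> 0 \<Longrightarrow> \<exists>j>i. a j \<noteq> 0 \<and> (\<forall>s. i < s \<and> s \<le> j \<longrightarrow> b s = 0)"
    "\<exists>j. a j \<noteq> 0 \<and> (\<forall>s\<le>j. b s = 0)"
  shows "(a, b) \<in> Cpairs N"
  using assms unfolding Cpairs_iff by blast

definition zero_pair :: "(nat \<Rightarrow> nat) \<times> (nat \<Rightarrow> nat)" where
  "zero_pair = (\<lambda>_. 0, \<lambda>_. 0)"

definition addf :: "nat \<Rightarrow> (nat \<Rightarrow> nat) \<times> (nat \<Rightarrow> nat) \<Rightarrow> (nat \<Rightarrow> nat) \<times> (nat \<Rightarrow> nat)" where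
  "addf i p = ((fst p)(i := 1), snd p)"

definition addh :: "nat \<Rightarrow> (nat \<Rightarrow> nat) \<times> (nat \<Rightarrow> nat) \<Rightarrow> (nat \<Rightarrow> nat) \<times> (nat \<Rightarrow> nat)" where
  "addh i p = (fst p, (snd p)(i := 1))"

text \<open>The pairs that may follow a leading f of index at least \<open>n + 1\<close>.\<close>
definition Xpairs :: "nat \<Rightarrow> ((nat \<Rightarrow> nat) \<times> (nat \<Rightarrow> nat)) set" where
  "Xpairs n = insert zero_pair (Cpairs n \<union> (\<Union>i\<in>{2..n}. addh i ` Cpairs (i - 1)))"

lemma Cpairs_mono: "N \<le> M \<Longrightarrow> Cpairs N \<subseteq> Cpairs M"
  by (auto simp: Cpairs_iff)

lemma addf_zero_pair: "addf N zero_pair \<in> Cpairs (Suc N)"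
  by (auto simp: addf_def zero_pair_def Cpairs_iff)

lemma addf_Cpairs:
  assumes ab: "(a, b) \<in> Cpairs (N - 1)"
  shows "addf N (a, b) \<in> Cpairs (Suc N)"
proof -
  note A = CpairsD[OF ab]
  have z: "a i = 0" "b i = 0" if "i \<ge> N - 1" for i using A(3,4) that by auto
  have "(a(N := 1), b) \<in> Cpairs (Suc N)"
  proof (rule CpairsI)
    fix i assume "b i \<noteq> 0"
    from A(8)[OF this] obtain j where "j > i" "a j \<noteq> 0" "\<forall>s. i < s \<and> s \<le> j \<longrightarrow> b s = 0" by blast
    then show "\<exists>j>i. (a(N := 1)) j \<noteq> 0 \<and> (\<forall>s. i < s \<and> s \<le> j \<longrightarrow> b s = 0)"
      by (intro exI[of _ j]) auto
  next
    from A(9) obtain j where "a j \<noteq> 0" "\<forall>s\<le>j. b s = 0" by blast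
    then show "\<exists>j. (a(N := 1)) j \<noteq> 0 \<and> (\<forall>s\<le>j. b s = 0)" by (intro exI[of _ j]) auto
  next
    fix i show "b (Suc i) + (a(N := 1)) (Suc i) + (a(N := 1)) i \<le> 1"
      using A(6)[of i] z[of i] z[of "Suc i"] by (cases "i = N"; cases "Suc i = N") auto
  next
    fix i show "b (Suc i) + b i + (a(N := 1)) i \<le> 1"
      using A(7)[of i] z[of N] z[of "Suc N"] by (cases "i = N") auto
  qed (use A(1,2,5) z in auto)
  then show ?thesis by (simp add: addf_def)
qed

lemma addf_addh_Cpairs:
  assumes ab: "(a, b) \<in> Cpairs (i - 1)" and i: "2 \<le> i" "i \<le> N - 1"
  shows "addf N (addh i (a, b)) \<in> Cpairs (Suc N)"
proof -
  note A = CpairsD[OF ab]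
  have z: "a l = 0" "b l = 0" if "l \<ge> i - 1" for l using A(3,4) that by auto
  have "(a(N := 1), b(i := 1)) \<in> Cpairs (Suc N)"
  proof (rule CpairsI)
    fix l assume l: "(b(i := 1)) l \<noteq> 0"
    show "\<exists>j>l. (a(N := 1)) j \<noteq> 0 \<and> (\<forall>s. l < s \<and> s \<le> j \<longrightarrow> (b(i := 1)) s = 0)"
    proof (cases "l = i")
      case True
      then show ?thesis using i z by (intro exI[of _ N]) auto
    next
      case False
      with l have "b l \<noteq> 0" by simp
      from A(8)[OF this] obtain j where j: "j > l" "a j \<noteq> 0" "\<forall>s. l < s \<and> s \<le> j \<longrightarrow> b s = 0" by blast
      have "j < i - 1" using z(1)[of j] j(2) by (meson not_le)
      then show ?thesis using j i by (intro exI[of _ j]) auto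
    qed
  next
    from A(9) obtain j where j: "a j \<noteq> 0" "\<forall>s\<le>j. b s = 0" by blast
    have "j < i - 1" using z(1)[of j] j(1) by (meson not_le)
    then show "\<exists>j. (a(N := 1)) j \<noteq> 0 \<and> (\<forall>s\<le>j. (b(i := 1)) s = 0)" using j i by (intro exI[of _ j]) auto
  next
    fix l show "(b(i := 1)) (Suc l) + (a(N := 1)) (Suc l) + (a(N := 1)) l \<le> 1"
      using A(6)[of l] z[of l] z[of "Suc l"] i by (cases "l \<ge> i - 1") auto
  next
    fix l show "(b(i := 1)) (Suc l) + (b(i := 1)) l + (a(N := 1)) l \<le> 1"
      using A(7)[of l] z[of l] z[of "Suc l"] i by (cases "l \<ge> i - 1") auto
  qed (use A(1,2,5) z i in auto)
  then show ?thesis by (simp add: addf_def addh_def)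
qed

text \<open>Every nonzero b must be followed by a nonzero a above it, so b_N = 0. If a_N = 1, look
  at the largest index k < N with a nonzero entry. If b_k = 0, then a_k is nonzero and can replace
  a_N wherever that served as a witness, so the rest is in \<open>Cpairs (N - 1)\<close>. If b_k =
  1, then a_k, a_(k-1) and b_(k-1) vanish, and the rest without b_k is in
  \<open>Cpairs (k - 1)\<close>; some nonzero a lies below the lowest b, and it is not a_(k-1),
  whence k \<ge> 2.\<close>

lemma Cpairs_Suc_subset: "Cpairs (Suc N) \<subseteq> Cpairs N \<union> addf N ` Xpairs (N - 1)"
proof
  fix p assume p: "p \<in> Cpairs (Suc N)"
  obtain a b where ab: "p = (a, b)" by (cases p)
  note A = CpairsD[OF p[unfolded ab]]
  note le1 = A(1,2) and c1 = A(6) and c2 = A(7)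
  have zN: "a i = 0" "b i = 0" if "i > N" for i using A(3,4) that by auto
  have bN: "b N = 0"
  proof (rule ccontr)
    assume "b N \<noteq> 0"
    from A(8)[OF this] obtain j where "j > N" "a j \<noteq> 0" by blast
    then show False using zN by simp
  qed
  show "p \<in> Cpairs N \<union> addf N ` Xpairs (N - 1)"
  proof (cases "a N = 0")
    case True
    have "a i = 0 \<and> b i = 0" if "i \<ge> N" for i
      using True bN zN[of i] that by (cases "i = N") auto
    then have "(a, b) \<in> Cpairs N"
      by (intro CpairsI A) auto
    then show ?thesis by (simp add: ab)
  next
    case False
    then have aN: "a N = 1" using le1(1)[of N] by simp
    define a' where "a' = a(N := 0)"
    have pa: "p = addf N (a', b)" using aN by (auto simp: ab a'_def addf_def)
    have aN1: "a (N - 1) = 0" if "N > 0" using c1[of "N - 1"] that aN by simp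
    define K where "K = {k. k < N \<and> (a k \<noteq> 0 \<or> b k \<noteq> 0)}"
    have "(a', b) \<in> Xpairs (N - 1)"
    proof (cases "K = {}")
      case True
      have "a' k = 0 \<and> b k = 0" for k
        using True zN[of k] bN by (cases k N rule: linorder_cases) (auto simp: K_def a'_def)
      then show ?thesis by (auto simp: Xpairs_def zero_pair_def)
    next
      case False
      define k where "k = Max K"
      have fin: "finite K" by (simp add: K_def)
      have k: "k < N" "a k \<noteq> 0 \<or> b k \<noteq> 0"
        using Max_in[OF fin False] by (auto simp: K_def k_def)
      have ktop: "a l = 0" "b l = 0" if "l > k" "l < N" for l
      proof -
        have "l \<notin> K" using Max_ge[OF fin, of l] that(1) by (fastforce simp: k_def)
        then show "a l = 0" "b l = 0" using that(2) by (simp_all add: K_def)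
      qed
      have btop: "b l = 0" if "l > k" for l
        using that ktop(2)[of l] bN zN(2)[of l] by (cases l N rule: linorder_cases) auto
      show ?thesis
      proof (cases "b k = 0")
        case True
        then have ak: "a k \<noteq> 0" using k by simp
        have kN: "k < N - 1"
        proof -
          have "k \<noteq> N - 1" using ak aN1 k(1) by (metis gr_implies_not0 not_gr_zero)
          then show ?thesis using k(1) by simp
        qed
        have z: "a' l = 0 \<and> b l = 0" if "l \<ge> N - 1" for l
          using that ktop(1)[of l] btop[of l] kN zN(1)[of l] by (cases l N rule: linorder_cases) (auto simp: a'_def)
        have 3: "\<exists>j>i. a' j \<noteq> 0 \<and> (\<forall>s. i < s \<and> s \<le> j \<longrightarrow> b s = 0)" if bi: "b i \<noteq> 0" for i
        proof -
          from A(8)[OF bi] obtain j where j: "j > i" "a j \<noteq> 0" "\<forall>s. i < s \<and> s \<le> j \<longrightarrow> b s = 0" by blast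
          show ?thesis
          proof (cases "j = N")
            case True
            \<comment> \<open>The witness was the removed a_N; the highest remaining entry a_k lies
              above \<open>i\<close> and takes its place.\<close>
            have "i < k" using bi \<open>b k = 0\<close> btop[of i] by (metis linorder_neqE_nat)
            then show ?thesis using ak kN j True by (intro exI[of _ k]) (auto simp: a'_def)
          next
            case False
            then show ?thesis using j by (intro exI[of _ j]) (auto simp: a'_def)
          qed
        qed
        from A(9) obtain j where j: "a j \<noteq> 0" "\<forall>s\<le>j. b s = 0" by blast
        have 4: "\<exists>j. a' j \<noteq> 0 \<and> (\<forall>s\<le>j. b s = 0)"
        proof (cases "j = N")
          case True
          then show ?thesis using ak kN j by (intro exI[of _ k]) (auto simp: a'_def)
        next
          case False
          then show ?thesis using j by (intro exI[of _ j]) (auto simp: a'_def)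
        qed
        have a'a: "a' i \<le> a i" for i by (simp add: a'_def)
        have 1: "b (Suc i) + a' (Suc i) + a' i \<le> 1" "b (Suc i) + b i + a' i \<le> 1" "a' i \<le> 1" for i
          using c1[of i] c2[of i] a'a[of i] a'a[of "Suc i"] le1[of i] by linarith+
        have "(a', b) \<in> Cpairs (N - 1)"
          by (intro CpairsI z 3 4 1 A)
        then show ?thesis by (simp add: Xpairs_def)
      next
        case bk: False
        then have bk1: "b k = 1" using le1(2)[of k] by simp
        have "k \<noteq> 0" using A(5) bk by (cases k) auto
        then obtain m where m: "k = Suc m" using not0_implies_Suc by blast
        have z0: "a k = 0" "a m = 0" "b m = 0" using c1[of m] c2[of m] bk1 m by auto
        define b' where "b' = b(k := 0)"
        have z: "a' l = 0 \<and> b' l = 0" if "l \<ge> k - 1" for l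
          using that z0 ktop(1)[of l] btop[of l] m zN(1)[of l]
          by (cases l N rule: linorder_cases; cases "l = m"; cases "l = k") (auto simp: a'_def b'_def)
        from A(9) obtain j where j: "a j \<noteq> 0" "\<forall>s\<le>j. b s = 0" by blast
        have jk: "j < k" using j(2) bk by (meson not_le)
        then have 4: "\<exists>j. a' j \<noteq> 0 \<and> (\<forall>s\<le>j. b' s = 0)"
          using j k(1) by (intro exI[of _ j]) (auto simp: a'_def b'_def)
        have "j \<noteq> m" using j(1) z0 by auto
        with jk m have k2: "2 \<le> k" by simp
        have 3: "\<exists>j>i. a' j \<noteq> 0 \<and> (\<forall>s. i < s \<and> s \<le> j \<longrightarrow> b' s = 0)" if bi: "b' i \<noteq> 0" for i
        proof -
          have ik: "i < k" using bi btop[of i] by (metis b'_def fun_upd_apply linorder_neqE_nat)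
          then have "b i \<noteq> 0" using bi by (simp add: b'_def)
          from A(8)[OF this] obtain j where j: "j > i" "a j \<noteq> 0" "\<forall>s. i < s \<and> s \<le> j \<longrightarrow> b s = 0" by blast
          then have "j < k" using bk ik by (meson not_le)
          then show ?thesis using j k(1) by (intro exI[of _ j]) (auto simp: a'_def b'_def)
        qed
        have le: "a' i \<le> a i" "b' i \<le> b i" for i by (simp_all add: a'_def b'_def)
        have 1: "b' (Suc i) + a' (Suc i) + a' i \<le> 1" "b' (Suc i) + b' i + a' i \<le> 1" "a' i \<le> 1" "b' i \<le> 1" for i
          using c1[of i] c2[of i] le[of i] le[of "Suc i"] le1[of i] by linarith+
        have b0: "b' 0 = 0" using A(5) by (simp add: b'_def)
        have "(a', b') \<in> Cpairs (k - 1)"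
          by (intro CpairsI z 3 4 1 b0)
        moreover have "(a', b) = addh k (a', b')"
          using bk1 by (auto simp: addh_def b'_def)
        ultimately show ?thesis
          using k2 k(1) by (auto simp: Xpairs_def)
      qed
    qed
    then show ?thesis using pa by blast
  qed
qed

lemma Cpairs_Suc: "Cpairs (Suc N) = Cpairs N \<union> addf N ` Xpairs (N - 1)"
proof (rule antisym[OF Cpairs_Suc_subset])
  show "Cpairs N \<union> addf N ` Xpairs (N - 1) \<subseteq> Cpairs (Suc N)"
    using Cpairs_mono[of N "Suc N"] addf_zero_pair addf_Cpairs addf_addh_Cpairs
    unfolding Xpairs_def by fastforce
qed

lemma Cpairs_0 [simp]: "Cpairs 0 = {}"
  by (simp add: Cpairs_def)

text \<open>By \<open>Cpairs_Suc\<close> the bound 2^(N-1) follows from 2^(n-1) for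
  \<open>Cpairs n\<close> and from 1 + 2^(n-2) + (1 + 2 + ... + 2^(n-3)) = 2^(n-1) for
  \<open>Xpairs (n - 1)\<close>, where N = n + 1. The doubled form avoids the exponent N - 1 at N =
  0.\<close>

lemma finite_Cpairs_card: "finite (Cpairs N) \<and> 2 * card (Cpairs N) \<le> 2 ^ N"
proof (induction N rule: less_induct)
  case (less N)
  show ?case
  proof (cases N)
    case 0
    then show ?thesis by simp
  next
    case (Suc n)
    have fin: "finite (Cpairs m)" and card: "2 * card (Cpairs m) \<le> 2 ^ m" if "m < N" for m
      using less that by auto
    have finU: "finite (\<Union>i\<in>{2..n - 1}. addh i ` Cpairs (i - 1))"
      using Suc by (intro finite_UN_I finite_imageI fin) auto
    then have finX: "finite (Xpairs (n - 1))"
      using Suc by (auto simp: Xpairs_def intro!: fin)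
    have "2 * card (\<Union>i\<in>{2..n - 1}. addh i ` Cpairs (i - 1)) \<le> 2 * (\<Sum>i\<in>{2..n - 1}. card (addh i ` Cpairs (i - 1)))"
      by (simp add: card_UN_le)
    also have "\<dots> \<le> (\<Sum>i\<in>{2..n - 1}. 2 * card (Cpairs (i - 1)))"
      unfolding sum_distrib_left using Suc by (intro sum_mono mult_left_mono card_image_le fin) auto
    also have "\<dots> \<le> (\<Sum>i\<in>{2..n - 1}. 2 ^ (i - 1))"
      using Suc by (intro sum_mono card) auto
    also have "\<dots> = (\<Sum>i\<in>{1..<n - 1}. 2 ^ i)"
      by (rule sum.reindex_bij_witness[of _ Suc "\<lambda>i. i - 1"]) auto
    finally have U: "2 * card (\<Union>i\<in>{2..n - 1}. addh i ` Cpairs (i - 1)) \<le> (\<Sum>i\<in>{1..<n - 1}. 2 ^ i)" .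
    have geo: "2 + (\<Sum>i\<in>{1..<m}. 2 ^ i) = (2::nat) ^ m" if "m \<ge> 1" for m
      using that by (induction m rule: nat_induct_at_least) auto
    have X: "2 * card (Xpairs (n - 1)) \<le> 2 ^ n" if "n > 0"
    proof (cases "n \<ge> 2")
      case True
      have "card (Xpairs (n - 1)) \<le> Suc (card (Cpairs (n - 1) \<union> (\<Union>i\<in>{2..n - 1}. addh i ` Cpairs (i - 1))))"
        unfolding Xpairs_def by (rule card_insert_le_m1) auto
      also have "\<dots> \<le> Suc (card (Cpairs (n - 1)) + card (\<Union>i\<in>{2..n - 1}. addh i ` Cpairs (i - 1)))"
        using card_Un_le by simp
      finally have "2 * card (Xpairs (n - 1)) \<le> 2 + 2 ^ (n - 1) + (\<Sum>i\<in>{1..<n - 1}. 2 ^ i)"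
        using U card[of "n - 1"] Suc by linarith
      also have "\<dots> = 2 ^ n" using geo[of "n - 1"] True by (cases n) auto
      finally show ?thesis .
    next
      case False
      then have "n = 1" using that by simp
      then show ?thesis by (simp add: Xpairs_def)
    qed
    have "card (Cpairs N) \<le> card (Cpairs n) + card (addf n ` Xpairs (n - 1))"
      unfolding Suc Cpairs_Suc by (rule card_Un_le)
    also have "\<dots> \<le> card (Cpairs n) + card (Xpairs (n - 1))"
      using card_image_le[OF finX, of "addf n"] by simp
    finally have "2 * card (Cpairs N) \<le> 2 ^ n + 2 ^ n"
      using card[of n] X Suc by (cases "n = 0") (simp_all add: Xpairs_def)
    moreover have "finite (Cpairs N)"
      unfolding Suc Cpairs_Suc using finX fin[of n] Suc by simp
    ultimately show ?thesis by (simp add: Suc)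
  qed
qed

subsection \<open>Spanning\<close>

context level_one_module begin

definition W :: "int \<Rightarrow> int \<Rightarrow> 'v set" where
  "W p q = span ({e i w | i w. i \<ge> p} \<union> {f i w | i w. i \<ge> q})"

lemma subspace_W: "subspace (W p q)"
  by (simp add: W_def)

lemmas W_add = subspace_add[OF subspace_W] and W_diff = subspace_diff[OF subspace_W]
  and W_scale = subspace_scale[OF subspace_W] and W_0 = subspace_0[OF subspace_W]

lemma e_in_W: "i \<ge> p \<Longrightarrow> e i w \<in> W p q"
  unfolding W_def by (rule span_base) blast

lemma f_in_W: "i \<ge> q \<Longrightarrow> f i w \<in> W p q"
  unfolding W_def by (rule span_base) blast

text \<open>A commutator of e_p and f_(i-p); at \<open>i = 0\<close> the central term would
  enter.\<close>

lemma h_in_W: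
  assumes "i \<ge> p + q" "i \<noteq> 0"
  shows "h i w \<in> W p q"
proof -
  have "h i w = e p (f (i - p) w) - f (i - p) (e p w)"
    using e_f[of p "i - p" w] assms(2) by simp
  then show ?thesis
    using assms(1) by (simp add: W_diff e_in_W f_in_W)
qed

lemma W_induct [consumes 1, case_names e f 0 add]:
  assumes "y \<in> W p q" and e: "\<And>i w. i \<ge> p \<Longrightarrow> P (e i w)" and f: "\<And>i w. i \<ge> q \<Longrightarrow> P (f i w)"
    and 0: "P 0" and add: "\<And>x y. P x \<Longrightarrow> P y \<Longrightarrow> P (x + y)"
  shows "P y"
  using assms(1) unfolding W_def
proof (induction rule: span_induct_alt)
  case (step c x y)
  then consider i w where "x = e i w" "i \<ge> p" | i w where "x = f i w" "i \<ge> q" by blast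
  then have "P (c *s x)"
  proof cases
    case 1
    then show ?thesis using e[of i "c *s w"] by (simp add: rho_scale)
  next
    case 2
    then show ?thesis using f[of i "c *s w"] by (simp add: rho_scale)
  qed
  then show ?case using add step.IH by blast
qed (rule 0)

lemma W_mono: "p' \<le> p \<Longrightarrow> q' \<le> q \<Longrightarrow> W p q \<subseteq> W p' q'"
  unfolding W_def by (rule span_mono) (blast intro: order_trans)

text \<open>The commutator with e_i, i \<ge> p + 1, is h of index at least p + q, which is in
  \<open>W p q\<close> and is not h_0 because p + q \<ge> 1. Against f_i the only indices below q
  are q - 1 and q - 2, precisely the two cases of \<open>f_square_span\<close>; this dictates the
  shifts by 1 and 2.\<close>

lemma f_W:
  assumes "y \<in> W (p + 1) (q - 2)" "p + q \<ge> 1"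
  shows "f (q - 1) y \<in> W p q"
  using assms(1)
proof (induction rule: W_induct)
  case (e i w)
  have "f (q - 1) (e i w) = e i (f (q - 1) w) - h (i + q - 1) w"
    using e_f[of i "q - 1" w] e assms(2) by (simp add: algebra_simps)
  then show ?case using e assms(2) by (simp add: W_diff e_in_W h_in_W)
next
  case (f i w)
  have sub: "span {f i w | i w. i > q - 1} \<subseteq> W p q"
    unfolding W_def by (rule span_mono) force
  consider "i \<ge> q" | "i = q - 1" | "i = (q - 1) - 1" using f by linarith
  then show ?case
  proof cases
    case 1
    then show ?thesis using f_f[of "q - 1" i w] by (simp add: f_in_W)
  next
    case 2
    then show ?thesis using f_square_span(1)[of "q - 1" w] sub by blast
  next
    case 3
    then show ?thesis using f_square_span(2)[of "q - 1" w] sub by blast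
  qed
qed (simp_all add: rho_add W_add W_0)

lemma e_W:
  assumes "y \<in> W (p - 2) (q + 1)" "p + q \<ge> 1"
  shows "e (p - 1) y \<in> W p q"
  using assms(1)
proof (induction rule: W_induct)
  case (f i w)
  have "e (p - 1) (f i w) = f i (e (p - 1) w) + h (p - 1 + i) w"
    using e_f[of "p - 1" i w] f assms(2) by simp
  then show ?case using f assms(2) by (simp add: W_add f_in_W h_in_W)
next
  case (e i w)
  have sub: "span {e i w | i w. i > p - 1} \<subseteq> W p q"
    unfolding W_def by (rule span_mono) force
  consider "i \<ge> p" | "i = p - 1" | "i = (p - 1) - 1" using e by linarith
  then show ?case
  proof cases
    case 1
    then show ?thesis using e_e[of "p - 1" i w] by (simp add: e_in_W)
  next
    case 2
    then show ?thesis using e_square_span(1)[of "p - 1" w] sub by blast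
  next
    case 3
    then show ?thesis using e_square_span(2)[of "p - 1" w] sub by blast
  qed
qed (simp_all add: rho_add W_add W_0)

lemma W_step_f: "y \<in> W p (q - 1) \<Longrightarrow> \<exists>u. y - f (q - 1) u \<in> W p q"
proof (induction rule: W_induct)
  case (e i w)
  then show ?case by (intro exI[of _ 0]) (simp add: e_in_W)
next
  case (f i w)
  show ?case
  proof (cases "i = q - 1")
    case True
    then show ?thesis by (intro exI[of _ w]) (simp add: W_0)
  next
    case False
    then show ?thesis using f by (intro exI[of _ 0]) (simp add: f_in_W)
  qed
next
  case 0
  show ?case by (intro exI[of _ 0]) (simp add: W_0)
next
  case (add x y)
  then obtain u u' where "x - f (q - 1) u \<in> W p q" "y - f (q - 1) u' \<in> W p q" by blast
  from W_add[OF this] show ?case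
    by (intro exI[of _ "u + u'"]) (simp add: rho_add algebra_simps)
qed

lemma W_step_e: "y \<in> W (p - 1) q \<Longrightarrow> \<exists>u. y - e (p - 1) u \<in> W p q"
proof (induction rule: W_induct)
  case (f i w)
  then show ?case by (intro exI[of _ 0]) (simp add: f_in_W)
next
  case (e i w)
  show ?case
  proof (cases "i = p - 1")
    case True
    then show ?thesis by (intro exI[of _ w]) (simp add: W_0)
  next
    case False
    then show ?thesis using e by (intro exI[of _ 0]) (simp add: e_in_W)
  qed
next
  case 0
  show ?case by (intro exI[of _ 0]) (simp add: W_0)
next
  case (add x y)
  then obtain u u' where "x - e (p - 1) u \<in> W p q" "y - e (p - 1) u' \<in> W p q" by blast
  from W_add[OF this] show ?case
    by (intro exI[of _ "u + u'"]) (simp add: rho_add algebra_simps)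
qed

section \<open>Spanning sets of the coinvariants\<close>

definition spans :: "int \<Rightarrow> int \<Rightarrow> 'v set \<Rightarrow> bool" where
  "spans p q X \<longleftrightarrow> (\<forall>w. \<exists>y\<in>span X. w - y \<in> W p q)"

lemma spansE:
  assumes "spans p q X"
  obtains y where "y \<in> span X" "w - y \<in> W p q"
  using assms unfolding spans_def by blast

lemma spans_mono: "spans p q X \<Longrightarrow> p' \<le> p \<Longrightarrow> q' \<le> q \<Longrightarrow> spans p' q' X"
  unfolding spans_def using W_mono by blast

text \<open>The commutator of e_0 and f_0 is h_0, which is invertible because all weights are
  odd.\<close>

lemma spans_0_0: "spans 0 0 {}"
proof -
  have "w \<in> W 0 0" for w
  proof (induction w rule: weight_induct)
    case (wt k n w)
    have "of_int k *s w = e 0 (f 0 w) - f 0 (e 0 w)"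
      using e_f[of 0 0 w] wt(1) by (simp add: wt_def)
    then have "of_int k *s w \<in> W 0 0"
      by (simp add: W_diff e_in_W f_in_W)
    from W_scale[OF this, of "inverse (of_int k)"] show ?case
      using wt(2) by (cases "k = 0") auto
  qed (rule W_add)
  then show ?thesis by (simp add: spans_def)
qed

text \<open>Every creation generator maps into \<open>W 1 0\<close>, so among the words only
  \<open>v\<close> itself survives.\<close>

lemma spans_1_0: "spans 1 0 {v}"
  unfolding spans_def
proof
  fix w
  have "w \<in> span words" by (simp add: span_words)
  then show "\<exists>y\<in>span {v}. w - y \<in> W 1 0"
  proof (induction rule: span_induct_alt)
    case base
    show ?case by (intro bexI[of _ 0]) (simp_all add: W_0 span_zero)
  next
    case (step c x y)
    then obtain y' where y': "y' \<in> span {v}" "y - y' \<in> W 1 0" by blast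
    from step.hyps show ?case
    proof (cases rule: words.cases)
      case words_v
      then show ?thesis using y'
        by (intro bexI[of _ "c *s v + y'"]) (auto intro: span_add span_scale span_base)
    next
      case (words_step u g)
      have "rho g u \<in> W 1 0"
        using words_step(3) by (auto simp: creation_def e_in_W f_in_W h_in_W)
      then have "c *s x + (y - y') \<in> W 1 0"
        using words_step(1) y' by (intro W_add W_scale) auto
      then show ?thesis using y' by (intro bexI[of _ y']) (simp_all add: algebra_simps)
    qed
  qed
qed

lemma rho_span_image:
  assumes "y \<in> span A" "rho x ` A \<subseteq> span B"
  shows "rho x y \<in> span B"
  using rho_span_subset[of A x B y] assms by blast

text \<open>The product always runs up to the same cutoff \<open>K\<close>, so that pairs from
  different levels of the recursion give comparable vectors; factors beyond the support are
  trivial.\<close>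

definition mv :: "nat \<Rightarrow> (nat \<Rightarrow> nat) \<times> (nat \<Rightarrow> nat) \<Rightarrow> 'v" where
  "mv K p = mono_vec rho v (fst p) (snd p) K"

lemma mv_zero_pair: "mv K zero_pair = v"
  by (induction K) (simp_all add: mv_def zero_pair_def)

lemma mono_vec_cong:
  "(\<And>i. i \<le> K \<Longrightarrow> a i = a' i \<and> b i = b' i) \<Longrightarrow> mono_vec rho v a b K = mono_vec rho v a' b' K"
  by (induction K) auto

lemma mv_addf:
  assumes "\<And>i. i \<ge> N \<Longrightarrow> a i = 0 \<and> b i = 0" "N \<le> K"
  shows "mv K (addf N (a, b)) = f (int N) (mv K (a, b))"
  using assms(2)
proof (induction K)
  case 0
  then show ?case using assms(1)[of 0] by (simp add: mv_def addf_def)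
next
  case (Suc K)
  show ?case
  proof (cases "N = Suc K")
    case True
    then have "mono_vec rho v (a(N := 1)) b K = mono_vec rho v a b K"
      by (intro mono_vec_cong) auto
    then show ?thesis using assms(1)[of "Suc K"] True by (simp add: mv_def addf_def)
  next
    case False
    then show ?thesis using Suc assms(1)[of "Suc K"] by (simp add: mv_def addf_def)
  qed
qed

text \<open>The condition \<open>N > 0\<close> reflects that \<open>mono_vec\<close> has no factor
  h_0.\<close>

lemma mv_addh:
  assumes "\<And>i. i \<ge> N \<Longrightarrow> a i = 0 \<and> b i = 0" "N \<le> K" "N > 0"
  shows "mv K (addh N (a, b)) = h (int N) (mv K (a, b))"
  using assms(2)
proof (induction K)
  case 0
  then show ?case using assms(3) by simp
next
  case (Suc K)
  show ?case
  proof (cases "N = Suc K")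
    case True
    then have "mono_vec rho v a (b(N := 1)) K = mono_vec rho v a b K"
      by (intro mono_vec_cong) auto
    then show ?thesis using assms(1)[of "Suc K"] True by (simp add: mv_def addh_def)
  next
    case False
    then show ?thesis using Suc assms(1)[of "Suc K"] by (simp add: mv_def addh_def)
  qed
qed

lemma Xpairs_support:
  assumes "(a, b) \<in> Xpairs (N - 1)" "i \<ge> N"
  shows "a i = 0 \<and> b i = 0"
  using assms CpairsD(3,4) unfolding Xpairs_def zero_pair_def addh_def by fastforce

lemma f_mv_Xpairs:
  assumes "N \<le> K"
  shows "f (int N) ` mv K ` Xpairs (N - 1) \<subseteq> mv K ` Cpairs (Suc N)"
proof clarify
  fix a b assume ab: "(a, b) \<in> Xpairs (N - 1)"
  have "f (int N) (mv K (a, b)) = mv K (addf N (a, b))"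
    using mv_addf[of N a b K] Xpairs_support[OF ab] assms by simp
  moreover have "addf N (a, b) \<in> Cpairs (Suc N)"
    unfolding Cpairs_Suc using ab by blast
  ultimately show "f (int N) (mv K (a, b)) \<in> mv K ` Cpairs (Suc N)" by simp
qed

lemma h_mv_Cpairs:
  assumes "Suc n \<le> K"
  shows "h (int (Suc n)) ` mv K ` Cpairs n \<subseteq> mv K ` Xpairs (Suc n)"
proof clarify
  fix a b assume ab: "(a, b) \<in> Cpairs n"
  have "h (int (Suc n)) (mv K (a, b)) = mv K (addh (Suc n) (a, b))"
    using mv_addh[of "Suc n" a b K] CpairsD(3,4)[OF ab] assms by simp
  moreover have "n \<noteq> 0" using ab by (cases n) auto
  then have "addh (Suc n) (a, b) \<in> Xpairs (Suc n)"
    unfolding Xpairs_def using ab by force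
  ultimately show "h (int (Suc n)) (mv K (a, b)) \<in> mv K ` Xpairs (Suc n)" by simp
qed

lemma Xpairs_mono: "n \<le> m \<Longrightarrow> Xpairs n \<subseteq> Xpairs m"
  unfolding Xpairs_def using Cpairs_mono by fastforce

text \<open>Both statements advance together. In the step to n + 1 at \<open>p = 1\<close> the
  argument of f_n has to be reduced modulo \<open>W 2 (n - 1)\<close> and not just
  \<open>W 1 (n - 1)\<close>. The extra generator e_1, applied to representatives b of the
  coinvariants of \<open>W 0 n\<close>, yields f_n e_1 b, that is h_(n+1) b up to sign; these are
  the new pairs \<open>addh (n + 1)\<close> in \<open>Xpairs (n + 1)\<close>. The bounds on
  \<open>N\<close> keep all indices at most \<open>K\<close>.\<close>

lemma spans_Cpairs_Xpairs:
  "(N \<le> Suc K \<longrightarrow> spans 0 (int N) (mv K ` Cpairs N)) \<and> (N \<le> K \<longrightarrow> spans 1 (int N) (mv K ` Xpairs N))"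
proof (induction N rule: less_induct)
  case (less N)
  show ?case
  proof (cases N)
    case 0
    have "Xpairs 0 = {zero_pair}" by (auto simp: Xpairs_def)
    then show ?thesis using 0 spans_0_0 spans_1_0 by (simp add: mv_zero_pair)
  next
    case (Suc n)
    \<comment> \<open>For \<open>n = 0\<close> the truncated \<open>n - 1\<close> is 0, and the
      statement at (1, 0) is weakened to (1, -1).\<close>
    have 0: "spans 0 (int n) (mv K ` Cpairs n)" and 1: "spans 1 (int n) (mv K ` Xpairs n)"
      and 2: "spans 1 (int n - 1) (mv K ` Xpairs (n - 1))" if "n \<le> K"
      using less.IH[of n] less.IH[of "n - 1"] Suc that
        spans_mono[of 1 "int (n - 1)" "mv K ` Xpairs (n - 1)" 1 "int n - 1"] spans_mono[of 1 "int n" "mv K ` Xpairs n" 1 "int n - 1"]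
      by (cases n; simp)+
    have fX: "f (int n) x \<in> span (mv K ` Cpairs (Suc n))" if "x \<in> span (mv K ` Xpairs (n - 1))" "n \<le> K" for x
      using rho_span_image[OF that(1)] f_mv_Xpairs[OF that(2)] span_superset by blast
    have "spans 0 (int (Suc n)) (mv K ` Cpairs (Suc n))" if nK: "n \<le> K"
      unfolding spans_def
    proof
      fix w
      obtain y where y: "y \<in> span (mv K ` Cpairs n)" "w - y \<in> W 0 (int n)"
        using 0[OF nK] by (rule spansE)
      obtain t where t: "w - y - f (int n) t \<in> W 0 (int n + 1)"
        using W_step_f[of "w - y" 0 "int n + 1"] y(2) by auto
      obtain x where x: "x \<in> span (mv K ` Xpairs (n - 1))" "t - x \<in> W 1 (int n - 1)"
        using 2[OF nK] by (rule spansE)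
      have "f (int n) (t - x) \<in> W 0 (int n + 1)"
        using f_W[of "t - x" 0 "int n + 1"] x(2) by simp
      from W_add[OF t this] have "w - (y + f (int n) x) \<in> W 0 (int (Suc n))"
        by (simp add: rho_diff algebra_simps)
      moreover have "y \<in> span (mv K ` Cpairs (Suc n))"
        using y(1) span_mono[OF image_mono[OF Cpairs_mono[of n "Suc n"]]] by auto
      ultimately show "\<exists>y\<in>span (mv K ` Cpairs (Suc n)). w - y \<in> W 0 (int (Suc n))"
        using fX[OF x(1) nK] span_add by blast
    qed
    moreover have "spans 1 (int (Suc n)) (mv K ` Xpairs (Suc n))" if nK: "Suc n \<le> K"
      unfolding spans_def
    proof
      fix w
      have nK': "n \<le> K" using nK by simp
      obtain x where x: "x \<in> span (mv K ` Xpairs n)" "w - x \<in> W 1 (int n)"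
        using 1[OF nK'] by (rule spansE)
      obtain t where t: "w - x - f (int n) t \<in> W 1 (int n + 1)"
        using W_step_f[of "w - x" 1 "int n + 1"] x(2) by auto
      obtain x2 where x2: "x2 \<in> span (mv K ` Xpairs (n - 1))" "t - x2 \<in> W 1 (int n - 1)"
        using 2[OF nK'] by (rule spansE)
      \<comment> \<open>Here e_1 is split off; its argument \<open>y\<close> may then be reduced
        modulo \<open>W 0 n\<close>, because e_1 maps that subspace into \<open>W 2 (n - 1)\<close>
        by \<open>e_W\<close>.\<close>
      obtain y where y: "t - x2 - e 1 y \<in> W 2 (int n - 1)"
        using W_step_e[of "t - x2" 2 "int n - 1"] x2(2) by auto
      obtain b where b: "b \<in> span (mv K ` Cpairs n)" "y - b \<in> W 0 (int n)"
        using 0[OF nK'] by (rule spansE)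
      have "e 1 (y - b) \<in> W 2 (int n - 1)"
        using e_W[of "y - b" 2 "int n - 1"] b(2) by simp
      from W_add[OF y this] have "t - x2 - e 1 b \<in> W 2 (int n - 1)"
        by (simp add: rho_diff algebra_simps)
      then have "f (int n) (t - x2 - e 1 b) \<in> W 1 (int n + 1)"
        using f_W[of "t - x2 - e 1 b" 1 "int n + 1"] by simp
      \<comment> \<open>Adding this element turns - f_n e_1 b into h_(n+1) b.\<close>
      moreover have "e 1 (f (int n) b) \<in> W 1 (int n + 1)"
        by (simp add: e_in_W)
      ultimately have "(w - x - f (int n) t) + f (int n) (t - x2 - e 1 b) + e 1 (f (int n) b) \<in> W 1 (int n + 1)"
        using t by (intro W_add)
      moreover have "e 1 (f (int n) b) = f (int n) (e 1 b) + h (int (Suc n)) b"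
        using e_f[of 1 "int n" b] by (simp add: add.commute)
      ultimately have "w - (x + f (int n) x2 - h (int (Suc n)) b) \<in> W 1 (int (Suc n))"
        by (simp add: rho_diff rho_add algebra_simps)
      moreover have "x \<in> span (mv K ` Xpairs (Suc n))"
        using x(1) span_mono[OF image_mono[OF Xpairs_mono[of n "Suc n"]]] by auto
      moreover have "f (int n) x2 \<in> span (mv K ` Xpairs (Suc n))"
        using fX[OF x2(1) nK'] span_mono[of "mv K ` Cpairs (Suc n)" "mv K ` Xpairs (Suc n)"]
        by (auto simp: Xpairs_def)
      moreover have "h (int (Suc n)) b \<in> span (mv K ` Xpairs (Suc n))"
        using rho_span_image[OF b(1)] h_mv_Cpairs[OF nK] span_superset by blast
      ultimately show "\<exists>y\<in>span (mv K ` Xpairs (Suc n)). w - y \<in> W 1 (int (Suc n))"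
        using span_add span_diff by blast
    qed
    ultimately show ?thesis by (simp add: Suc)
  qed
qed

lemma spans_Cpairs: "N \<ge> 1 \<Longrightarrow> spans 0 (int N) (mv (N - 1) ` Cpairs N)"
  using spans_Cpairs_Xpairs[of N "N - 1"] by simp

lemma sl2n_sub_eq_W:
  assumes "N \<ge> 1"
  shows "sl2n_sub scale rho N = W 0 (int N)"
proof
  have "rho x w \<in> W 0 (int N)" if "x \<in> sl2n_gens N" for x w
    using that assms unfolding sl2n_gens_def by (auto simp: e_in_W f_in_W h_in_W)
  then show "sl2n_sub scale rho N \<subseteq> W 0 (int N)"
    unfolding sl2n_sub_def by (intro span_minimal subspace_W) blast
  show "W 0 (int N) \<subseteq> sl2n_sub scale rho N"
    unfolding sl2n_sub_def W_def sl2n_gens_def by (rule span_mono) fast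
qed

end

subsection \<open>Functionals\<close>

context level_one_module begin

text \<open>Extremal vectors of h_0-weight 1 - 2m: they attain equality in
  \<open>weight_bound\<close>.\<close>

primrec ext :: "nat \<Rightarrow> 'v" where
  "ext 0 = v"
| "ext (Suc m) = f (2 * int m) (ext m)"

lemma wt_ext: "wt (1 - 2 * int m) (int m * (int m - 1)) (ext m)"
proof (induction m)
  case (Suc m)
  from wt_f[OF this, of "2 * int m"] show ?case by (simp add: algebra_simps)
qed (simp add: wt_v)

text \<open>In the sl2-triple of e_(-2m) and f_(2m), the vector \<open>ext m\<close> is killed by
  e_(-2m) for weight reasons and has eigenvalue (1 - 2m) + 2m = 1, so e_(-2m) takes
  \<open>ext (Suc m)\<close> back to \<open>ext m\<close>.\<close>

lemma ext_nz: "ext m \<noteq> 0"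
proof (induction m)
  case (Suc m)
  have "e (- 2 * int m) (ext m) = 0"
  proof (rule ccontr)
    assume "e (- 2 * int m) (ext m) \<noteq> 0"
    from weight_bound[OF wt_e[OF wt_ext] this] show False
      by (simp add: power2_eq_square algebra_simps)
  qed
  then have "e (- 2 * int m) (f (2 * int m) (ext m)) = h 0 (ext m) + of_int (2 * int m) *s ext m"
    using e_f[of "- 2 * int m" "2 * int m" "ext m"] by simp
  also have "\<dots> = of_int (1 - 2 * int m + 2 * int m) *s ext m"
    using wt_ext[of m] unfolding wt_def by (simp only: of_int_add scale_left_distrib)
  finally have "e (- 2 * int m) (f (2 * int m) (ext m)) = ext m" by simp
  with Suc show ?case by (metis ext.simps(2) rho_0)
qed (simp add: v_nz)

text \<open>The coefficient of \<open>z ^ k\<close> in the exponential of \<open>- (\<Sum>n\<ge>1. z ^ n / (2 * n) * h (- n))\<close>.\<close>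
fun G :: "nat \<Rightarrow> 'v \<Rightarrow> 'v" where
  "G 0 w = w"
| "G (Suc k) w = (- 1 / (2 * of_nat (Suc k))) *s (\<Sum>i\<le>k. h (- int i - 1) (G (k - i) w))"

text \<open>The differential equation in z of the exponential, read coefficientwise. Each
  commutation rule below is proved by strong induction from it, multiplied by -2k.\<close>

lemma G_sum: "(\<Sum>i<k. h (- int i - 1) (G (k - 1 - i) w)) = (- 2 * of_nat k) *s G k w"
  by (cases k) (simp_all add: lessThan_Suc_atMost del: of_nat_Suc)

declare G.simps(2) [simp del]

lemma G_eqI:
  assumes "k > 0" "(- 2 * of_nat k) *s x = (- 2 * of_nat k) *s y"
  shows "x = y"
  using assms by simp

lemma G_hom: "module_hom scale scale (G k)"
proof (induction k rule: less_induct)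
  case (less k)
  show ?case
  proof (cases k)
    case 0
    then show ?thesis by (simp add: module_hom_iff module_axioms)
  next
    case (Suc l)
    have add: "G (l - i) (x + y) = G (l - i) x + G (l - i) y" and sc: "G (l - i) (c *s x) = c *s G (l - i) x" for i x y c
      using less[of "l - i"] Suc by (auto simp: module_hom_iff)
    show ?thesis
      by (simp add: module_hom_iff Suc G.simps(2) module_axioms add sc rho_add rho_scale sum.distrib
          scale_right_distrib mult.commute flip: scale_sum_right)
  qed
qed

lemma wt_G: "wt k n w \<Longrightarrow> wt k (n - int l) (G l w)"
proof (induction l rule: less_induct)
  case (less l)
  show ?case
  proof (cases l)
    case 0
    then show ?thesis using less.prems by simp
  next
    case (Suc m)
    have "wt k (n - int l) (h (- int i - 1) (G (m - i) w))" if "i \<le> m" for i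
      using wt_h[OF less.IH[of "m - i", OF _ less.prems], of "- int i - 1"] that Suc
      by (simp add: of_nat_diff algebra_simps)
    then show ?thesis
      unfolding Suc G.simps(2) by (intro wt_scale wt_sum) simp
  qed
qed

text \<open>With T the shift from e_j to e_(j-1), the commutator of - z^n / (2n) h_(-n) with e is -
  z^n / n T^n, and exp (- (sum of z^n / n T^n)) = 1 - z T. This is the coefficient of z^k.\<close>

lemma G_e: "G k (e j w) = e j (G k w) - (if k = 0 then 0 else e (j - 1) (G (k - 1) w))"
proof (induction k rule: less_induct)
  case (less k)
  show ?case
  proof (cases k)
    case 0
    then show ?thesis by simp
  next
    case (Suc l)
    have step: "h (- int i - 1) (G (l - i) (e j w)) = e j (h (- int i - 1) (G (l - i) w)) + 2 *s e (j - 1 - int i) (G (l - i) w)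
       - (if i = l then 0 else e (j - 1) (h (- int i - 1) (G (l - 1 - i) w)) + 2 *s e (j - 1 - int (Suc i)) (G (l - Suc i) w))"
      if "i \<le> l" for i
    proof -
      have idx: "- int i - 1 + j = j - 1 - int i" "- int i - 1 + (j - 1) = j - 1 - int (Suc i)" by simp_all
      show ?thesis
      proof (cases "i = l")
        case True
        then show ?thesis using h_e[of "- int i - 1" j w] unfolding idx by simp
      next
        case False
        then have "G (l - i) (e j w) = e j (G (l - i) w) - e (j - 1) (G (l - Suc i) w)"
          using less[of "l - i"] that Suc by simp
        then show ?thesis
          using False h_e[of "- int i - 1" j "G (l - i) w"] h_e[of "- int i - 1" "j - 1" "G (l - Suc i) w"]
          unfolding idx by (simp add: rho_diff)
      qed
    qed
    have if_sum: "(\<Sum>i\<le>l. if i = l then 0 else X i) = (\<Sum>i<l. X i)" for X :: "nat \<Rightarrow> 'v"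
      unfolding lessThan_Suc_atMost[symmetric] by simp
    have "(- 2 * of_nat k) *s G k (e j w) = (\<Sum>i\<le>l. h (- int i - 1) (G (l - i) (e j w)))"
      using G_sum[of k "e j w"] by (simp add: Suc lessThan_Suc_atMost)
    also have "\<dots> = (\<Sum>i\<le>l. e j (h (- int i - 1) (G (l - i) w))) + (\<Sum>i\<le>l. 2 *s e (j - 1 - int i) (G (l - i) w))
      - (\<Sum>i<l. e (j - 1) (h (- int i - 1) (G (l - 1 - i) w)) + 2 *s e (j - 1 - int (Suc i)) (G (l - Suc i) w))"
      by (subst if_sum[symmetric], subst sum.distrib[symmetric], subst sum_subtractf[symmetric])
        (rule sum.cong[OF refl], rule step, simp)
    also have "(\<Sum>i\<le>l. e j (h (- int i - 1) (G (l - i) w))) = e j ((- 2 * of_nat k) *s G k w)"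
      using G_sum[of k w] by (simp add: Suc lessThan_Suc_atMost flip: rho_sum)
    \<comment> \<open>Splitting off \<open>i = 0\<close> matches the remaining terms with those of
      the next sum, with which they cancel.\<close>
    also have "(\<Sum>i\<le>l. 2 *s e (j - 1 - int i) (G (l - i) w)) = 2 *s e (j - 1) (G l w) + (\<Sum>i<l. 2 *s e (j - 1 - int (Suc i)) (G (l - Suc i) w))"
      by (subst sum.atMost_shift) simp
    also have "(\<Sum>i<l. e (j - 1) (h (- int i - 1) (G (l - 1 - i) w)) + 2 *s e (j - 1 - int (Suc i)) (G (l - Suc i) w))
      = e (j - 1) ((- 2 * of_nat l) *s G l w) + (\<Sum>i<l. 2 *s e (j - 1 - int (Suc i)) (G (l - Suc i) w))"
      unfolding sum.distrib G_sum[symmetric] rho_sum ..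
    finally have "(- 2 * of_nat k) *s G k (e j w) = e j ((- 2 * of_nat k) *s G k w) + 2 *s e (j - 1) (G l w) - e (j - 1) ((- 2 * of_nat l) *s G l w)"
      by simp
    also have "\<dots> = (- 2 * of_nat k) *s (e j (G k w) - e (j - 1) (G l w))"
      by (simp add: Suc rho_linear algebra_simps)
    finally show ?thesis
      using G_eqI[of k] Suc by simp
  qed
qed

text \<open>For f the sign is opposite and conjugation gives the geometric series 1 / (1 - z T);
  with f on the left of \<open>G\<close> the rule again has only two terms.\<close>

lemma f_G: "f j (G k w) = G k (f j w) - (if k = 0 then 0 else G (k - 1) (f (j - 1) w))"
proof (induction k arbitrary: j rule: less_induct)
  case (less k)
  show ?case
  proof (cases k)
    case 0
    then show ?thesis by simp
  next
    case (Suc l)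
    have step: "f j (h (- int i - 1) (G (l - i) w)) = h (- int i - 1) (G (l - i) (f j w)) + 2 *s G (l - i) (f (j - 1 - int i) w)
       - (if i = l then 0 else h (- int i - 1) (G (l - 1 - i) (f (j - 1) w)) + 2 *s G (l - Suc i) (f (j - 1 - int (Suc i)) w))"
      if "i \<le> l" for i
    proof -
      have idx: "- int i - 1 + j = j - 1 - int i" "j - 1 - int i - 1 = j - 1 - int (Suc i)" by simp_all
      have fh: "f j (h (- int i - 1) (G (l - i) w)) = h (- int i - 1) (f j (G (l - i) w)) + 2 *s f (j - 1 - int i) (G (l - i) w)"
        using h_f[of "- int i - 1" j "G (l - i) w"] unfolding idx by simp
      show ?thesis
      proof (cases "i = l")
        case True
        then show ?thesis using fh by simp
      next
        case False
        then have "f j' (G (l - i) w) = G (l - i) (f j' w) - G (l - Suc i) (f (j' - 1) w)" for j'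
          using less[of "l - i" j'] that Suc by simp
        then show ?thesis
          using False unfolding fh idx(2)[symmetric] by (simp add: rho_diff scale_right_diff_distrib)
      qed
    qed
    have if_sum: "(\<Sum>i\<le>l. if i = l then 0 else X i) = (\<Sum>i<l. X i)" for X :: "nat \<Rightarrow> 'v"
      unfolding lessThan_Suc_atMost[symmetric] by simp
    have "(- 2 * of_nat k) *s f j (G k w) = (\<Sum>i\<le>l. f j (h (- int i - 1) (G (l - i) w)))"
      using G_sum[of k w] by (simp add: Suc lessThan_Suc_atMost flip: rho_sum rho_scale)
    also have "\<dots> = (\<Sum>i\<le>l. h (- int i - 1) (G (l - i) (f j w))) + (\<Sum>i\<le>l. 2 *s G (l - i) (f (j - 1 - int i) w))
      - (\<Sum>i<l. h (- int i - 1) (G (l - 1 - i) (f (j - 1) w)) + 2 *s G (l - Suc i) (f (j - 1 - int (Suc i)) w))"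
      by (subst if_sum[symmetric], subst sum.distrib[symmetric], subst sum_subtractf[symmetric])
        (rule sum.cong[OF refl], rule step, simp)
    also have "(\<Sum>i\<le>l. h (- int i - 1) (G (l - i) (f j w))) = (- 2 * of_nat k) *s G k (f j w)"
      using G_sum[of k "f j w"] by (simp add: Suc lessThan_Suc_atMost)
    also have "(\<Sum>i\<le>l. 2 *s G (l - i) (f (j - 1 - int i) w)) = 2 *s G l (f (j - 1) w) + (\<Sum>i<l. 2 *s G (l - Suc i) (f (j - 1 - int (Suc i)) w))"
      by (subst sum.atMost_shift) simp
    also have "(\<Sum>i<l. h (- int i - 1) (G (l - 1 - i) (f (j - 1) w)) + 2 *s G (l - Suc i) (f (j - 1 - int (Suc i)) w))
      = (- 2 * of_nat l) *s G l (f (j - 1) w) + (\<Sum>i<l. 2 *s G (l - Suc i) (f (j - 1 - int (Suc i)) w))"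
      unfolding sum.distrib G_sum ..
    finally have "(- 2 * of_nat k) *s f j (G k w) = (- 2 * of_nat k) *s G k (f j w) + 2 *s G l (f (j - 1) w) - (- 2 * of_nat l) *s G l (f (j - 1) w)"
      by simp
    also have "\<dots> = (- 2 * of_nat k) *s (G k (f j w) - G l (f (j - 1) w))"
      by (simp add: Suc algebra_simps)
    finally show ?thesis
      using G_eqI[of k] Suc by simp
  qed
qed

lemma G_h0: "G k (h 0 w) = h 0 (G k w)"
proof (induction k rule: less_induct)
  case (less k)
  show ?case
  proof (cases k)
    case (Suc l)
    have "h (- int i - 1) (G (l - i) (h 0 w)) = h 0 (h (- int i - 1) (G (l - i) w))" for i
      using less[of "l - i"] Suc h_h[of "- int i - 1" 0 "G (l - i) w"] by simp
    then show ?thesis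
      by (simp add: Suc G.simps(2) rho_scale rho_sum rho_minus)
  qed simp
qed

text \<open>Only h_(-j) fails to commute with h_j; its commutator 2j cancels the denominator in -
  z^j / (2j), so the exponential series changes h_j by the scalar - z^j.\<close>

lemma G_h:
  assumes "j > 0"
  shows "G k (h (int j) w) = h (int j) (G k w) - (if j \<le> k then G (k - j) w else 0)"
proof (induction k rule: less_induct)
  case (less k)
  show ?case
  proof (cases k)
    case 0
    then show ?thesis using assms by simp
  next
    case (Suc l)
    \<comment> \<open>The range \<open>{..<k - j}\<close> encodes the condition
      \<open>j \<le> l - i\<close>; for \<open>j > k\<close> the truncated difference makes it
      empty.\<close>
    have step: "h (- int i - 1) (G (l - i) (h (int j) w)) = h (int j) (h (- int i - 1) (G (l - i) w))
       + (if i = j - 1 then (2 * of_nat j) *s G (k - j) w else 0) - (if i \<in> {..<k - j} then h (- int i - 1) (G (k - j - 1 - i) w) else 0)"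
      if "i \<le> l" for i
    proof -
      have 1: "G (l - i) (h (int j) w) = h (int j) (G (l - i) w) - (if i \<in> {..<k - j} then G (k - j - 1 - i) w else 0)"
      proof -
        have "j \<le> l - i \<longleftrightarrow> i \<in> {..<k - j}" using that Suc assms by auto
        moreover have "l - i - j = k - j - 1 - i" using Suc by simp
        ultimately show ?thesis using less[of "l - i"] Suc by simp
      qed
      have "h (- int i - 1) (h (int j) (G (l - i) w)) = h (int j) (h (- int i - 1) (G (l - i) w))
        + (if i = j - 1 then (2 * of_nat j) *s G (k - j) w else 0)"
      proof (cases "i = j - 1")
        case True
        then have "l - i = k - j" "- int i - 1 = - int j" using Suc assms by auto
        then show ?thesis using h_h[of "- int i - 1" "int j" "G (l - i) w"] True by simp
      next
        case False
        then have "- int i - 1 + int j \<noteq> 0" using assms by auto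
        then show ?thesis using h_h[of "- int i - 1" "int j" "G (l - i) w"] False by simp
      qed
      then show ?thesis unfolding 1 by (simp add: rho_diff)
    qed
    have "(- 2 * of_nat k) *s G k (h (int j) w) = (\<Sum>i\<le>l. h (- int i - 1) (G (l - i) (h (int j) w)))"
      using G_sum[of k "h (int j) w"] by (simp add: Suc lessThan_Suc_atMost)
    also have "\<dots> = (\<Sum>i\<le>l. h (int j) (h (- int i - 1) (G (l - i) w))) + (\<Sum>i\<le>l. if i = j - 1 then (2 * of_nat j) *s G (k - j) w else 0)
       - (\<Sum>i\<le>l. if i \<in> {..<k - j} then h (- int i - 1) (G (k - j - 1 - i) w) else 0)"
      by (subst sum.distrib[symmetric], subst sum_subtractf[symmetric])
        (rule sum.cong[OF refl], rule step, simp)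
    also have "(\<Sum>i\<le>l. h (int j) (h (- int i - 1) (G (l - i) w))) = (- 2 * of_nat k) *s h (int j) (G k w)"
      using G_sum[of k w] by (simp add: Suc lessThan_Suc_atMost flip: rho_sum rho_scale)
    also have "(\<Sum>i\<le>l. if i = j - 1 then (2 * of_nat j) *s G (k - j) w else 0) = (if j \<le> k then (2 * of_nat j) *s G (k - j) w else 0)"
      using assms Suc by (auto simp: sum.delta)
    also have "(\<Sum>i\<le>l. if i \<in> {..<k - j} then h (- int i - 1) (G (k - j - 1 - i) w) else 0) = (\<Sum>i<k - j. h (- int i - 1) (G (k - j - 1 - i) w))"
      by (subst sum.inter_restrict[symmetric]) (use Suc assms in \<open>auto intro!: sum.cong\<close>)
    also have "\<dots> = (- 2 * of_nat (k - j)) *s G (k - j) w"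
      by (rule G_sum)
    also have "(- 2 * of_nat k) *s h (int j) (G k w) + (if j \<le> k then (2 * of_nat j) *s G (k - j) w else 0) - (- 2 * of_nat (k - j)) *s G (k - j) w
      = (- 2 * of_nat k) *s (h (int j) (G k w) - (if j \<le> k then G (k - j) w else 0))"
      by (auto simp: of_nat_diff algebra_simps)
    finally show ?thesis
      using G_eqI[of k] Suc by simp
  qed
qed


section \<open>Evaluation of the exponential at a point\<close>

lemma G_add: "G k (x + y) = G k x + G k y" and G_scale: "G k (c *s x) = c *s G k x"
  using module_hom.add[OF G_hom] module_hom.scale[OF G_hom] by auto

lemma G_locally_nilpotent: "\<exists>K. \<forall>k\<ge>K. G k w = 0"
proof (induction w rule: weight_induct)
  case (wt k n w)
  have "G l w = 0" if "l \<ge> nat (n + 1)" for l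
    using wt_good[OF wt_G[OF wt(1), of l]] that by fastforce
  then show ?case by blast
next
  case (add x y)
  then obtain K L where "\<forall>k\<ge>K. G k x = 0" "\<forall>k\<ge>L. G k y = 0" by blast
  then show ?case by (intro exI[of _ "max K L"]) (auto simp: G_add)
qed

definition Gam :: "complex \<Rightarrow> 'v \<Rightarrow> 'v" where
  "Gam z w = (\<Sum>k | G k w \<noteq> 0. z ^ k *s G k w)"

lemma Gam_eq:
  assumes "\<forall>k\<ge>K. G k w = 0"
  shows "Gam z w = (\<Sum>k<K. z ^ k *s G k w)"
  unfolding Gam_def by (rule sum.mono_neutral_left) (use assms in \<open>auto simp: not_le[symmetric]\<close>)

lemma G_locally_nilpotent2: "\<exists>K. (\<forall>k\<ge>K. G k x = 0) \<and> (\<forall>k\<ge>K. G k y = 0) \<and> (\<forall>k\<ge>K. G k z = 0)"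
proof -
  obtain K L M where "\<forall>k\<ge>K. G k x = 0" "\<forall>k\<ge>L. G k y = 0" "\<forall>k\<ge>M. G k z = 0"
    using G_locally_nilpotent by meson
  then show ?thesis by (intro exI[of _ "max K (max L M)"]) auto
qed

lemma Gam_add: "Gam z (x + y) = Gam z x + Gam z y"
proof -
  obtain K where "\<forall>k\<ge>K. G k x = 0" "\<forall>k\<ge>K. G k y = 0" "\<forall>k\<ge>K. G k (x + y) = 0"
    using G_locally_nilpotent2 by blast
  note K = this[THEN Gam_eq]
  show ?thesis unfolding K by (simp add: G_add scale_right_distrib sum.distrib)
qed

lemma Gam_scale: "Gam z (c *s x) = c *s Gam z x"
proof -
  obtain K where "\<forall>k\<ge>K. G k x = 0" "\<forall>k\<ge>K. G k (c *s x) = 0"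
    using G_locally_nilpotent2 by blast
  note K = this[THEN Gam_eq]
  show ?thesis unfolding K by (simp add: G_scale scale_sum_right mult.commute)
qed

lemma Gam_diff: "Gam z (x - y) = Gam z x - Gam z y"
  using Gam_add[of z x "(- 1) *s y"] Gam_scale[of z "- 1" y] by simp

lemma Gam_sum: "Gam z (sum g A) = (\<Sum>i\<in>A. Gam z (g i))"
proof -
  have "Gam z 0 = 0" using Gam_scale[of z 0 0] by simp
  then show ?thesis
    by (induction A rule: infinite_finite_induct) (auto simp: Gam_add)
qed

lemma Gam_e: "Gam z (e j w) = e j (Gam z w) - z *s e (j - 1) (Gam z w)"
proof -
  obtain K where K0: "\<forall>k\<ge>K. G k w = 0" "\<forall>k\<ge>K. G k (e j w) = 0"
    using G_locally_nilpotent2 by blast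
  \<comment> \<open>The sums are cut at \<open>Suc K\<close>, so that the one with
    \<open>G (k - 1)\<close> is cut at \<open>K\<close> after the shift.\<close>
  then have K1: "\<forall>k\<ge>Suc K. G k w = 0" "\<forall>k\<ge>Suc K. G k (e j w) = 0" by auto
  note K = K0(1)[THEN Gam_eq] and K' = K1[THEN Gam_eq]
  have "Gam z (e j w) = (\<Sum>k<Suc K. z ^ k *s e j (G k w)) - (\<Sum>k<Suc K. z ^ k *s (if k = 0 then 0 else e (j - 1) (G (k - 1) w)))"
    unfolding K'(2) by (subst G_e) (simp only: scale_right_diff_distrib sum_subtractf)
  also have "(\<Sum>k<Suc K. z ^ k *s e j (G k w)) = e j (Gam z w)"
    unfolding K'(1) rho_sum rho_scale ..
  also have "(\<Sum>k<Suc K. z ^ k *s (if k = 0 then 0 else e (j - 1) (G (k - 1) w))) = z *s e (j - 1) (Gam z w)"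
    unfolding K rho_sum rho_scale scale_sum_right sum.lessThan_Suc_shift by simp
  finally show ?thesis .
qed

lemma f_Gam: "f j (Gam z w) = Gam z (f j w) - z *s Gam z (f (j - 1) w)"
proof -
  obtain K where K0: "\<forall>k\<ge>K. G k w = 0" "\<forall>k\<ge>K. G k (f j w) = 0" "\<forall>k\<ge>K. G k (f (j - 1) w) = 0"
    using G_locally_nilpotent2 by blast
  then have K1: "\<forall>k\<ge>Suc K. G k w = 0" "\<forall>k\<ge>Suc K. G k (f j w) = 0" by auto
  note K = K0(3)[THEN Gam_eq] and K' = K1[THEN Gam_eq]
  have "f j (Gam z w) = (\<Sum>k<Suc K. z ^ k *s G k (f j w)) - (\<Sum>k<Suc K. z ^ k *s (if k = 0 then 0 else G (k - 1) (f (j - 1) w)))"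
    unfolding K'(1) rho_sum rho_scale f_G by (simp only: scale_right_diff_distrib sum_subtractf)
  also have "(\<Sum>k<Suc K. z ^ k *s G k (f j w)) = Gam z (f j w)"
    unfolding K'(2) ..
  also have "(\<Sum>k<Suc K. z ^ k *s (if k = 0 then 0 else G (k - 1) (f (j - 1) w))) = z *s Gam z (f (j - 1) w)"
    unfolding K scale_sum_right sum.lessThan_Suc_shift by simp
  finally show ?thesis .
qed

lemma Gam_h0: "Gam z (h 0 w) = h 0 (Gam z w)"
proof -
  obtain K where "\<forall>k\<ge>K. G k w = 0" "\<forall>k\<ge>K. G k (h 0 w) = 0"
    using G_locally_nilpotent2 by blast
  note K = this[THEN Gam_eq]
  show ?thesis unfolding K by (simp add: G_h0 rho_sum rho_scale)
qed

lemma Gam_h: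
  assumes "j > 0"
  shows "Gam z (h (int j) w) = h (int j) (Gam z w) - z ^ j *s Gam z w"
proof -
  obtain K where K0: "\<forall>k\<ge>K. G k w = 0" "\<forall>k\<ge>K. G k (h (int j) w) = 0"
    using G_locally_nilpotent2 by blast
  then have K1: "\<forall>k\<ge>K + j. G k w = 0" "\<forall>k\<ge>K + j. G k (h (int j) w) = 0" by auto
  note K = K0(1)[THEN Gam_eq] and K' = K1[THEN Gam_eq]
  have "Gam z (h (int j) w) = (\<Sum>k<K + j. z ^ k *s h (int j) (G k w)) - (\<Sum>k<K + j. z ^ k *s (if j \<le> k then G (k - j) w else 0))"
    unfolding K'(2) G_h[OF assms] by (simp only: scale_right_diff_distrib sum_subtractf)
  also have "(\<Sum>k<K + j. z ^ k *s h (int j) (G k w)) = h (int j) (Gam z w)"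
    unfolding K'(1) rho_sum rho_scale ..
  also have "(\<Sum>k<K + j. z ^ k *s (if j \<le> k then G (k - j) w else 0)) = (\<Sum>k\<in>{j..<K + j}. z ^ k *s G (k - j) w)"
    by (rule sum.mono_neutral_cong_right) auto
  also have "\<dots> = (\<Sum>k<K. z ^ (k + j) *s G k w)"
    by (rule sum.reindex_bij_witness[of _ "\<lambda>k. k + j" "\<lambda>k. k - j"]) auto
  also have "\<dots> = z ^ j *s Gam z w"
    unfolding K scale_sum_right by (simp add: power_add mult.commute)
  finally show ?thesis .
qed

section \<open>Linear functionals killing the deformed subspace\<close>

definition linfun :: "('v \<Rightarrow> complex) \<Rightarrow> bool" where
  "linfun \<phi> \<longleftrightarrow> (\<forall>x y. \<phi> (x + y) = \<phi> x + \<phi> y) \<and> (\<forall>c x. \<phi> (c *s x) = c * \<phi> x)"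

lemma linfunD:
  assumes "linfun \<phi>"
  shows "\<phi> (x + y) = \<phi> x + \<phi> y" "\<phi> (c *s x) = c * \<phi> x" "\<phi> 0 = 0" "\<phi> (x - y) = \<phi> x - \<phi> y"
    "\<phi> (- x) = - \<phi> x" "\<phi> (sum g A) = (\<Sum>i\<in>A. \<phi> (g i))"
proof -
  show add: "\<phi> (x + y) = \<phi> x + \<phi> y" and sc: "\<phi> (c *s x) = c * \<phi> x" for x y c
    using assms by (auto simp: linfun_def)
  show 0: "\<phi> 0 = 0" using sc[of 0 0] by simp
  show neg: "\<phi> (- x) = - \<phi> x" for x using sc[of "-1" x] by simp
  show "\<phi> (x - y) = \<phi> x - \<phi> y" using add[of x "- y"] neg by simp
  show "\<phi> (sum g A) = (\<Sum>i\<in>A. \<phi> (g i))"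
    by (induction A rule: infinite_finite_induct) (auto simp: add 0)
qed

lemma linfun_exists:
  assumes "x \<noteq> 0"
  shows "\<exists>\<phi>. linfun \<phi> \<and> \<phi> x = 1"
proof -
  define B where "B = extend_basis {x}"
  have ind: "independent {x}" using assms by simp
  have B: "x \<in> B" "independent B" "span B = UNIV"
    using extend_basis_superset[OF ind] independent_extend_basis[OF ind] span_extend_basis[OF ind]
    by (auto simp: B_def)
  show ?thesis
  proof (intro exI[of _ "\<lambda>w. representation B w x"] conjI)
    show "linfun (\<lambda>w. representation B w x)"
      using representation_add[OF B(2)] representation_scale[OF B(2)] B(3) by (auto simp: linfun_def)
    show "representation B x x = 1"
      using representation_basis[OF B(2,1)] by simp
  qed
qed

text \<open>The action of f (x) t^j p(t).\<close>

definition fpoly :: "int \<Rightarrow> complex poly \<Rightarrow> 'v \<Rightarrow> 'v" where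
  "fpoly j p w = (\<Sum>k\<le>degree p. coeff p k *s f (j + int k) w)"

lemma fpoly_ge: "degree p \<le> n \<Longrightarrow> fpoly j p w = (\<Sum>k\<le>n. coeff p k *s f (j + int k) w)"
  unfolding fpoly_def by (rule sum.mono_neutral_left) (auto simp: coeff_eq_0)

lemma fpoly_linear_factor:
  "fpoly j ([:- z, 1:] * p) w = fpoly (j + 1) p w - z *s fpoly j p w"
proof -
  define n where "n = Suc (degree p)"
  have eq: "[:- z, 1:] * p = pCons 0 p - smult z p" by simp
  have deg: "degree ([:- z, 1:] * p) \<le> n"
    unfolding eq n_def by (intro degree_diff_le) (auto simp: degree_pCons_le order_trans[OF degree_smult_le])
  have c: "coeff ([:- z, 1:] * p) k = (case k of 0 \<Rightarrow> 0 | Suc k \<Rightarrow> coeff p k) - z * coeff p k" for k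
    unfolding eq by (simp add: coeff_pCons)
  have "fpoly j ([:- z, 1:] * p) w = (\<Sum>k\<le>n. (case k of 0 \<Rightarrow> 0 | Suc k \<Rightarrow> coeff p k) *s f (j + int k) w) - (\<Sum>k\<le>n. (z * coeff p k) *s f (j + int k) w)"
    unfolding fpoly_ge[OF deg] c by (simp only: scale_left_diff_distrib sum_subtractf)
  also have "(\<Sum>k\<le>n. (case k of 0 \<Rightarrow> 0 | Suc k \<Rightarrow> coeff p k) *s f (j + int k) w) = fpoly (j + 1) p w"
    unfolding n_def sum.atMost_Suc_shift fpoly_def by (simp add: algebra_simps)
  also have "(\<Sum>k\<le>n. (z * coeff p k) *s f (j + int k) w) = z *s fpoly j p w"
    by (subst fpoly_ge[of p n]) (simp_all add: n_def scale_sum_right scale_right_distrib)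
  finally show ?thesis .
qed

text \<open>The distinct points are taken to be 0, ..., N - 1, so sets of points are sets of
  naturals.\<close>

definition root_poly :: "nat set \<Rightarrow> complex poly" where
  "root_poly S = (\<Prod>i\<in>S. [:- of_nat i, 1:])"

text \<open>The one-dimensional conformal block of the points of S, which are inserted one at a time by
  composing with \<open>Gam\<close>; the weight of the initial functional fixes the number of points.\<close>
lemma functional_exists:
  assumes m: "m \<ge> 1" and S: "finite S" and card: "card S \<le> 2 * m - 1"
  shows "\<exists>\<phi>. linfun \<phi> \<and>
    (\<forall>j w. j \<ge> int (card S) - (2 * int m - 1) \<longrightarrow> \<phi> (e j w) = 0) \<and>
    (\<forall>j w. j \<ge> 2 * int m - 1 - int (card S) \<longrightarrow> \<phi> (fpoly j (root_poly S) w) = 0) \<and>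
    (\<forall>j>0. \<forall>w. \<phi> (h (int j) w) = - (\<Sum>i\<in>S. of_nat i ^ j) * \<phi> w) \<and>
    (\<forall>w. \<phi> (h 0 w) = - (2 * of_nat m - 1) * \<phi> w) \<and>
    (\<forall>k n w. wt k n w \<and> n < int m * (int m - 1) \<longrightarrow> \<phi> w = 0) \<and> \<phi> (ext m) = 1"
  using S card
proof (induction S rule: finite_induct)
  case empty
  obtain l where l: "linfun l" "l (ext m) = 1" using linfun_exists[OF ext_nz] by blast
  \<comment> \<open>This is the weight of \<open>ext m\<close>. Since 4n = k^2 - 1, it could be
    reached by e_j with j > -2m, f_j with j > 2m - 2 or h_j with j > 0 only from weights violating
    \<open>weight_bound\<close>; this gives the thresholds of the base case.\<close>
  define k n where "k = 1 - 2 * int m" and "n = int m * (int m - 1)"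
  define \<phi> where "\<phi> w = l (pr k n w)" for w
  note L = linfunD[OF l(1)]
  have lin: "linfun \<phi>" by (simp add: linfun_def \<phi>_def pr_add pr_scale L)
  moreover have "\<phi> (e j w) = 0" if "j \<ge> - (2 * int m - 1)" for j w
    unfolding \<phi>_def pr_e by (subst pr_eq_0) (use that in \<open>auto simp: k_def n_def power2_eq_square algebra_simps L\<close>)
  moreover have "\<phi> (f j w) = 0" if "j \<ge> 2 * int m - 1" for j w
    unfolding \<phi>_def pr_f by (subst pr_eq_0) (use that in \<open>auto simp: k_def n_def power2_eq_square algebra_simps L\<close>)
  moreover have "\<phi> (h (int j) w) = 0" if "j > 0" for j w
    unfolding \<phi>_def pr_h by (subst pr_eq_0) (use that in \<open>auto simp: k_def n_def power2_eq_square algebra_simps L\<close>)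
  moreover have "\<phi> (h 0 w) = - (2 * of_nat m - 1) * \<phi> w" for w
    using pr_wt[of k n w] unfolding \<phi>_def pr_h by (simp add: wt_def L k_def)
  moreover have "\<phi> w = 0" if "wt k' n' w" "n' < int m * (int m - 1)" for k' n' w
    using pr_other[OF that(1), of k n] that(2) by (simp add: \<phi>_def n_def L)
  moreover have "\<phi> (ext m) = 1"
    using pr_same[OF wt_ext[of m]] l(2) by (simp add: \<phi>_def k_def n_def)
  ultimately show ?case
    by (intro exI[of _ \<phi>]) (auto simp: root_poly_def fpoly_def)
next
  case (insert x S)
  then obtain \<phi> where lin: "linfun \<phi>"
    and e: "\<And>j w. j \<ge> int (card S) - (2 * int m - 1) \<Longrightarrow> \<phi> (e j w) = 0"
    and f: "\<And>j w. j \<ge> 2 * int m - 1 - int (card S) \<Longrightarrow> \<phi> (fpoly j (root_poly S) w) = 0"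
    and h: "\<And>j w. j > 0 \<Longrightarrow> \<phi> (h (int j) w) = - (\<Sum>i\<in>S. of_nat i ^ j) * \<phi> w"
    and h0: "\<And>w. \<phi> (h 0 w) = - (2 * of_nat m - 1) * \<phi> w"
    and low: "\<And>k n w. wt k n w \<Longrightarrow> n < int m * (int m - 1) \<Longrightarrow> \<phi> w = 0" and ext: "\<phi> (ext m) = 1"
    by auto
  note L = linfunD[OF lin]
  define z :: complex where "z = of_nat x"
  define \<psi> where "\<psi> w = \<phi> (Gam z w)" for w
  have "linfun \<psi>"
    by (simp add: linfun_def \<psi>_def Gam_add Gam_scale L)
  \<comment> \<open>Moving e_j past \<open>Gam z\<close> also produces e_(j-1), so its threshold
    goes up by one. For f the new factor t - z turns into a single shift from j to j + 1, so its
    threshold goes down by one.\<close>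
  moreover have "\<psi> (e j w) = 0" if "j \<ge> int (card (insert x S)) - (2 * int m - 1)" for j w
    using that insert.hyps by (simp add: \<psi>_def Gam_e L e)
  moreover have "\<psi> (fpoly j (root_poly (insert x S)) w) = 0" if j: "j \<ge> 2 * int m - 1 - int (card (insert x S))" for j w
  proof -
    have "root_poly (insert x S) = [:- z, 1:] * root_poly S"
      using insert.hyps by (simp add: root_poly_def z_def)
    then have "fpoly j (root_poly (insert x S)) w = fpoly (j + 1) (root_poly S) w - z *s fpoly j (root_poly S) w"
      by (simp only: fpoly_linear_factor)
    also have "\<dots> = (\<Sum>k\<le>degree (root_poly S). coeff (root_poly S) k *s (f (j + 1 + int k) w - z *s f (j + 1 + int k - 1) w))"
      unfolding fpoly_def scale_sum_right by (simp add: scale_right_diff_distrib sum_subtractf mult.commute)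
    finally have "Gam z (fpoly j (root_poly (insert x S)) w) = (\<Sum>k\<le>degree (root_poly S). coeff (root_poly S) k *s f (j + 1 + int k) (Gam z w))"
      by (simp only: Gam_sum Gam_scale Gam_diff f_Gam)
    then show ?thesis
      unfolding \<psi>_def using f[of "j + 1" "Gam z w"] j insert.hyps by (simp add: fpoly_def)
  qed
  moreover have "\<psi> (h (int j) w) = - (\<Sum>i\<in>insert x S. of_nat i ^ j) * \<psi> w" if "j > 0" for j w
    using that insert.hyps by (simp add: \<psi>_def Gam_h L h z_def algebra_simps)
  moreover have "\<psi> (h 0 w) = - (2 * of_nat m - 1) * \<psi> w" for w
    by (simp add: \<psi>_def Gam_h0 h0)
  \<comment> \<open>The higher coefficients of the exponential lower the degree to where \<phi>
    vanishes, so the normalisation at \<open>ext m\<close> survives.\<close>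
  moreover have low': "\<psi> w = \<phi> w" if w: "wt k n w" "n \<le> int m * (int m - 1)" for k n w
  proof -
    obtain K where K: "\<forall>k\<ge>K. G k w = 0" using G_locally_nilpotent by blast
    then have "\<forall>k\<ge>Suc K. G k w = 0" by auto
    then have "\<psi> w = (\<Sum>l<Suc K. z ^ l * \<phi> (G l w))"
      unfolding \<psi>_def by (simp only: Gam_eq L)
    also have "\<dots> = \<phi> w + (\<Sum>l<K. z ^ Suc l * \<phi> (G (Suc l) w))"
      by (subst sum.lessThan_Suc_shift) simp
    also have "(\<Sum>l<K. z ^ Suc l * \<phi> (G (Suc l) w)) = 0"
      using low[OF wt_G[OF w(1)]] w(2) by (intro sum.neutral) auto
    finally show ?thesis by simp
  qed
  have "\<psi> w = 0" if "wt k n w" "n < int m * (int m - 1)" for k n w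
    using low'[OF that(1)] low[OF that] that(2) by simp
  moreover have "\<psi> (ext m) = 1"
    using low'[OF wt_ext[of m]] ext by simp
  ultimately show ?case
    by (intro exI[of _ \<psi>]) auto
qed


text \<open>The condition at the points of a subset implies the one at all N points, as the
  polynomials involved form an ideal.\<close>

lemma fpoly_multiple:
  assumes "linfun \<phi>" "\<And>j w. j \<ge> 0 \<Longrightarrow> \<phi> (fpoly j p w) = 0" "finite T" "j \<ge> 0"
  shows "\<phi> (fpoly j (root_poly T * p) w) = 0"
  using assms(3,4)
proof (induction T arbitrary: j rule: finite_induct)
  case empty
  then show ?case using assms(2) by (simp add: root_poly_def)
next
  case (insert x T)
  have "root_poly (insert x T) * p = [:- of_nat x, 1:] * (root_poly T * p)"
    unfolding root_poly_def prod.insert[OF insert.hyps] by (rule mult.assoc)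
  then show ?case
    using insert.IH[of j] insert.IH[of "j + 1"] insert.prems
    by (simp only: fpoly_linear_factor linfunD[OF assms(1)]) simp
qed

lemma conformal_block_exists:
  assumes "S \<subseteq> {..<N}" "odd (card S)"
  shows "\<exists>\<phi>. linfun \<phi> \<and> (\<forall>j w. j \<ge> 0 \<longrightarrow> \<phi> (e j w) = 0) \<and>
    (\<forall>j w. j \<ge> 0 \<longrightarrow> \<phi> (fpoly j (root_poly {..<N}) w) = 0) \<and>
    (\<forall>j w. \<phi> (h (int j) w) = - (\<Sum>i\<in>S. of_nat i ^ j) * \<phi> w) \<and> (\<exists>w. \<phi> w = 1)"
proof -
  have fin: "finite S" using assms(1) finite_subset by blast
  obtain l where l: "card S = 2 * l + 1" using assms(2) oddE by blast
  obtain \<phi> where lin: "linfun \<phi>"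
    and e: "\<And>j w. j \<ge> int (card S) - (2 * int (Suc l) - 1) \<Longrightarrow> \<phi> (e j w) = 0"
    and f: "\<And>j w. j \<ge> 2 * int (Suc l) - 1 - int (card S) \<Longrightarrow> \<phi> (fpoly j (root_poly S) w) = 0"
    and h: "\<And>j w. j > 0 \<Longrightarrow> \<phi> (h (int j) w) = - (\<Sum>i\<in>S. of_nat i ^ j) * \<phi> w"
    and h0: "\<And>w. \<phi> (h 0 w) = - (2 * of_nat (Suc l) - 1) * \<phi> w"
    and ext: "\<phi> (ext (Suc l)) = 1"
    using functional_exists[of "Suc l" S] fin l by auto
  have "root_poly {..<N} = root_poly ({..<N} - S) * root_poly S"
    unfolding root_poly_def by (rule prod.subset_diff[OF assms(1)]) simp
  then have "\<phi> (fpoly j (root_poly {..<N}) w) = 0" if "j \<ge> 0" for j w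
    using fpoly_multiple[OF lin, of "root_poly S" "{..<N} - S" j w] f l that by simp
  \<comment> \<open>At j = 0 the power sum counts the points, including the point 0 since 0^0 = 1,
    and agrees with the eigenvalue of h_0 because \<open>card S = 2 * l + 1\<close>.\<close>
  moreover have "\<phi> (h (int j) w) = - (\<Sum>i\<in>S. of_nat i ^ j) * \<phi> w" for j w
    using h[of j w] h0[of w] l by (cases "j = 0") (auto simp: algebra_simps)
  ultimately show ?thesis
    using lin e l ext by (intro exI[of _ \<phi>]) auto
qed

section \<open>The functionals indexed by the odd subsets\<close>

definition odd_subsets :: "nat \<Rightarrow> nat set set" where
  "odd_subsets N = {S. S \<subseteq> {..<N} \<and> odd (card S)}"

definition cblock :: "nat \<Rightarrow> nat set \<Rightarrow> 'v \<Rightarrow> complex" where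
  "cblock N S = (SOME \<phi>. linfun \<phi> \<and> (\<forall>j w. j \<ge> 0 \<longrightarrow> \<phi> (e j w) = 0) \<and>
    (\<forall>j w. j \<ge> 0 \<longrightarrow> \<phi> (fpoly j (root_poly {..<N}) w) = 0) \<and>
    (\<forall>j w. \<phi> (h (int j) w) = - (\<Sum>i\<in>S. of_nat i ^ j) * \<phi> w) \<and> (\<exists>w. \<phi> w = 1))"

lemma cblock:
  assumes "S \<in> odd_subsets N"
  shows "linfun (cblock N S)" and "j \<ge> 0 \<Longrightarrow> cblock N S (e j w) = 0"
    and "j \<ge> 0 \<Longrightarrow> cblock N S (fpoly j (root_poly {..<N}) w) = 0"
    and "cblock N S (h (int i) w) = - (\<Sum>l\<in>S. of_nat l ^ i) * cblock N S w"
    and "\<exists>w. cblock N S w = 1"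
proof -
  have "\<exists>\<phi>. linfun \<phi> \<and> (\<forall>j w. j \<ge> 0 \<longrightarrow> \<phi> (e j w) = 0) \<and>
    (\<forall>j w. j \<ge> 0 \<longrightarrow> \<phi> (fpoly j (root_poly {..<N}) w) = 0) \<and>
    (\<forall>j w. \<phi> (h (int j) w) = - (\<Sum>i\<in>S. of_nat i ^ j) * \<phi> w) \<and> (\<exists>w. \<phi> w = 1)"
    by (rule conformal_block_exists) (use assms in \<open>auto simp: odd_subsets_def\<close>)
  from someI_ex[OF this] show "linfun (cblock N S)" and "j \<ge> 0 \<Longrightarrow> cblock N S (e j w) = 0"
    and "j \<ge> 0 \<Longrightarrow> cblock N S (fpoly j (root_poly {..<N}) w) = 0"
    and "cblock N S (h (int i) w) = - (\<Sum>l\<in>S. of_nat l ^ i) * cblock N S w"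
    and "\<exists>w. cblock N S w = 1"
    unfolding cblock_def[symmetric] by blast+
qed

text \<open>Lagrange interpolation turns the power sum eigenvalues into the membership indicator.\<close>
lemma membership_operator:
  assumes "i < N"
  shows "\<exists>A. \<forall>S\<in>odd_subsets N. \<forall>w. cblock N S (A w) = (if i \<in> S then cblock N S w else 0)"
proof -
  define q0 where "q0 = root_poly ({..<N} - {i})"
  define q where "q = smult (inverse (poly q0 (of_nat i))) q0"
  have q0: "poly q0 (of_nat l) = (\<Prod>k\<in>{..<N} - {i}. of_nat l - of_nat k)" for l
    by (simp add: q0_def root_poly_def poly_prod)
  have nz: "poly q0 (of_nat i) \<noteq> 0"
    unfolding q0 by (subst prod_zero_iff) auto
  have q: "poly q (of_nat l) = (if l = i then 1 else 0)" if "l < N" for l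
  proof (cases "l = i")
    case False
    then have "poly q0 (of_nat l) = 0"
      unfolding q0 using that by (subst prod_zero_iff) auto
    then show ?thesis using False by (simp add: q_def)
  qed (use nz in \<open>simp add: q_def\<close>)
  \<comment> \<open>The sign undoes that of the eigenvalues of h.\<close>
  define A where "A w = - (\<Sum>k\<le>degree q. coeff q k *s h (int k) w)" for w
  have "cblock N S (A w) = (if i \<in> S then cblock N S w else 0)" if S: "S \<in> odd_subsets N" for S w
  proof -
    have SN: "S \<subseteq> {..<N}" and fin: "finite S"
      using S finite_subset by (auto simp: odd_subsets_def)
    have "cblock N S (A w) = (\<Sum>k\<le>degree q. \<Sum>l\<in>S. coeff q k * of_nat l ^ k * cblock N S w)"
      unfolding A_def linfunD[OF cblock(1)[OF S]] cblock(4)[OF S]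
      by (simp add: sum_negf[symmetric] sum_distrib_left sum_distrib_right mult.assoc)
    also have "\<dots> = (\<Sum>l\<in>S. poly q (of_nat l)) * cblock N S w"
      by (subst sum.swap) (simp add: poly_altdef sum_distrib_right)
    also have "(\<Sum>l\<in>S. poly q (of_nat l)) = (\<Sum>l\<in>S. if l = i then 1 else 0)"
      by (rule sum.cong) (use SN q in auto)
    also have "\<dots> = (if i \<in> S then 1 else 0)"
      using fin by simp
    finally show ?thesis by simp
  qed
  then show ?thesis by blast
qed

text \<open>Start from a vector with value 1 at S0 and, point by point, apply the membership
  operator or its complement, whichever agrees with S0.\<close>

lemma dual_vector_exists:
  assumes S0: "S0 \<in> odd_subsets N"
  shows "\<exists>w. \<forall>S\<in>odd_subsets N. cblock N S w = (if S = S0 then 1 else 0)"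
proof -
  obtain w0 where w0: "cblock N S0 w0 = 1" using cblock(5)[OF S0] by blast
  have "\<exists>w. \<forall>S\<in>odd_subsets N. cblock N S w = (if S \<inter> {..<n} = S0 \<inter> {..<n} then cblock N S w0 else 0)"
    if "n \<le> N" for n
    using that
  proof (induction n)
    case 0
    show ?case by (intro exI[of _ w0]) simp
  next
    case (Suc n)
    then obtain w where w: "\<forall>S\<in>odd_subsets N. cblock N S w = (if S \<inter> {..<n} = S0 \<inter> {..<n} then cblock N S w0 else 0)"
      by auto
    obtain A where A: "\<forall>S\<in>odd_subsets N. \<forall>w. cblock N S (A w) = (if n \<in> S then cblock N S w else 0)"
      using membership_operator[of n N] Suc.prems by auto
    have split: "S \<inter> {..<Suc n} = S0 \<inter> {..<Suc n} \<longleftrightarrow> S \<inter> {..<n} = S0 \<inter> {..<n} \<and> (n \<in> S \<longleftrightarrow> n \<in> S0)" for S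
      by (auto simp: lessThan_Suc)
    show ?case
    proof (cases "n \<in> S0")
      case True
      then show ?thesis using w A unfolding split by (intro exI[of _ "A w"]) auto
    next
      case False
      then show ?thesis using w A unfolding split
        by (intro exI[of _ "w - A w"]) (auto simp: linfunD(4)[OF cblock(1)])
    qed
  qed
  from this[of N] obtain w where
    w: "\<forall>S\<in>odd_subsets N. cblock N S w = (if S \<inter> {..<N} = S0 \<inter> {..<N} then cblock N S w0 else 0)" by blast
  have "S \<inter> {..<N} = S" if "S \<in> odd_subsets N" for S
    using that by (auto simp: odd_subsets_def)
  then show ?thesis using w w0 S0 by (intro exI[of _ w]) auto
qed

text \<open>An even subset of \<open>{..<n}\<close> becomes odd by adding \<open>n\<close>; removing
  \<open>n\<close> inverts the map.\<close>

lemma card_odd_subsets: "N \<ge> 1 \<Longrightarrow> 2 ^ N \<le> 2 * card (odd_subsets N)"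
  and finite_odd_subsets: "finite (odd_subsets N)"
proof -
  show fin: "finite (odd_subsets N)" for N
    by (rule finite_subset[of _ "Pow {..<N}"]) (auto simp: odd_subsets_def)
  assume "N \<ge> 1"
  then obtain n where N: "N = Suc n" using not0_implies_Suc by force
  define t where "t T = (if even (card T) then insert n T else T)" for T :: "nat set"
  have "inj_on t (Pow {..<n})"
    by (rule inj_on_inverseI[of _ "\<lambda>S. S - {n}"]) (auto simp: t_def)
  moreover have "t ` Pow {..<n} \<subseteq> odd_subsets N"
  proof clarify
    fix T assume T: "T \<subseteq> {..<n}"
    then have "finite T" "n \<notin> T" using finite_subset by auto
    then show "t T \<in> odd_subsets N" using T by (auto simp: t_def odd_subsets_def N)
  qed
  ultimately have "card (Pow {..<n}) \<le> card (odd_subsets N)"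
    using fin by (rule card_inj_on_le)
  then show "2 ^ N \<le> 2 * card (odd_subsets N)"
    by (simp add: card_Pow N)
qed

text \<open>The map \<pi> realises the quotient by the common kernel inside the module, as a
  projection onto the span of the independent \<open>x S\<close>. A relation with nonzero
  coefficient at \<open>i\<close> would make \<open>u i\<close> redundant, and the
  \<open>x S\<close> would lie in the span of \<open>card I - 1\<close> vectors, fewer than there
  are \<open>x S\<close>.\<close>

lemma dual_family_independent:
  fixes \<phi> :: "'s \<Rightarrow> 'v \<Rightarrow> complex"
  assumes fin: "finite I" "finite \<S>" and card: "card I \<le> card \<S>"
    and lin: "\<And>S. S \<in> \<S> \<Longrightarrow> linfun (\<phi> S)"
    and dual: "\<And>S S'. S \<in> \<S> \<Longrightarrow> S' \<in> \<S> \<Longrightarrow> \<phi> S (x S') = (if S = S' then 1 else 0)"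
    and spn: "\<And>y. \<exists>z\<in>span (u ` I). \<forall>S\<in>\<S>. \<phi> S (y - z) = 0"
    and rel: "\<And>S. S \<in> \<S> \<Longrightarrow> \<phi> S (\<Sum>i\<in>I. c i *s u i) = 0" and i: "i \<in> I"
  shows "c i = 0"
proof (rule ccontr)
  assume ci: "c i \<noteq> 0"
  define \<pi> where "\<pi> w = (\<Sum>S\<in>\<S>. \<phi> S w *s x S)" for w
  have hom: "module_hom scale scale \<pi>"
    unfolding \<pi>_def module_hom_iff
    by (simp add: module_axioms linfunD[OF lin] scale_left_distrib sum.distrib scale_sum_right)
  interpret \<pi>: module_hom scale scale \<pi> by (rule hom)
  define u' where "u' = \<pi> ` u ` (I - {i})"
  have pi_x: "\<pi> (x S) = x S" if "S \<in> \<S>" for S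
  proof -
    have "\<pi> (x S) = (\<Sum>S'\<in>\<S>. if S' = S then x S else 0)"
      unfolding \<pi>_def by (rule sum.cong) (use dual that in auto)
    then show ?thesis using fin that by simp
  qed
  have rest: "(\<Sum>j\<in>I - {i}. c j *s \<pi> (u j)) \<in> span u'"
    by (intro span_sum span_scale span_base) (auto simp: u'_def)
  have "\<pi> (\<Sum>j\<in>I. c j *s u j) = 0"
    unfolding \<pi>_def using rel by simp
  then have "c i *s \<pi> (u i) + (\<Sum>j\<in>I - {i}. c j *s \<pi> (u j)) = 0"
    using fin i by (simp add: \<pi>.add \<pi>.sum \<pi>.scale sum.remove)
  then have "c i *s \<pi> (u i) = - (\<Sum>j\<in>I - {i}. c j *s \<pi> (u j))"
    by (simp add: eq_neg_iff_add_eq_0)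
  then have "c i *s \<pi> (u i) \<in> span u'"
    using span_neg[OF rest] by simp
  from span_scale[OF this, of "inverse (c i)"] have "\<pi> (u i) \<in> span u'"
    using ci by simp
  then have "\<pi> ` u ` I \<subseteq> span u'"
    using span_base[of _ u'] by (fastforce simp: u'_def)
  then have img: "\<pi> z \<in> span u'" if "z \<in> span (u ` I)" for z
    using that \<pi>.span_image[of "u ` I"] span_minimal[of "\<pi> ` u ` I" "span u'"] by auto
  have "x S \<in> span u'" if S: "S \<in> \<S>" for S
  proof -
    obtain z where z: "z \<in> span (u ` I)" "\<forall>S'\<in>\<S>. \<phi> S' (x S - z) = 0" using spn by blast
    have "\<pi> (x S - z) = 0" unfolding \<pi>_def using z(2) by simp
    then have "x S = \<pi> z" using pi_x[OF S] by (simp add: \<pi>.diff)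
    then show ?thesis using img[OF z(1)] by simp
  qed
  then have sub: "x ` \<S> \<subseteq> span u'" by blast
  have inj: "inj_on x \<S>"
    using dual by (intro inj_onI) (metis zero_neq_one)
  have "independent (x ` \<S>)"
  proof (rule independent_if_scalars_zero)
    show "finite (x ` \<S>)" using fin by simp
    fix g y assume 0: "(\<Sum>y\<in>x ` \<S>. g y *s y) = 0" and "y \<in> x ` \<S>"
    then obtain S where S: "S \<in> \<S>" "y = x S" by blast
    have "0 = \<phi> S (\<Sum>S'\<in>\<S>. g (x S') *s x S')"
      using 0 linfunD(3)[OF lin[OF S(1)]] by (simp add: sum.reindex[OF inj])
    also have "\<dots> = (\<Sum>S'\<in>\<S>. if S' = S then g (x S) else 0)"
      unfolding linfunD[OF lin[OF S(1)]] by (rule sum.cong) (use dual S in auto)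
    finally show "g y = 0" using fin S by simp
  qed
  then have "card (x ` \<S>) \<le> card u'"
    using independent_span_bound[of u' "x ` \<S>"] sub fin by (simp add: u'_def)
  also have "\<dots> \<le> card (I - {i})"
    unfolding u'_def image_image using fin by (intro card_image_le) simp
  also have "\<dots> < card I"
    using fin i by (intro card_Diff1_less)
  finally show False
    using card by (simp add: card_image[OF inj])
qed

end

subsection \<open>Specialisation of the points to 0\<close>

context level_one_module begin

definition Low :: "int \<Rightarrow> 'v set" where
  "Low n = span {w. \<exists>k n'. n' < n \<and> wt k n' w}"

lemma wt_in_Low: "wt k n' w \<Longrightarrow> n' < n \<Longrightarrow> w \<in> Low n"
  unfolding Low_def by (rule span_base) blast

lemma subspace_Low: "subspace (Low n)"
  by (simp add: Low_def)

text \<open>Takes the place of the deformed subspace, whose generators, the images of e_j and of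
  \<open>fpoly j (root_poly {..<N})\<close> for j \<ge> 0, it contains.\<close>

definition common_kernel :: "nat \<Rightarrow> 'v set" where
  "common_kernel N = {w. \<forall>S\<in>odd_subsets N. cblock N S w = 0}"

lemma subspace_common_kernel: "subspace (common_kernel N)"
  unfolding common_kernel_def by (intro subspaceI) (auto simp: linfunD[OF cblock(1)])

lemma root_poly_monic: "degree (root_poly {..<N}) = N \<and> coeff (root_poly {..<N}) N = 1"
proof (induction N)
  case (Suc N)
  have eq: "root_poly {..<Suc N} = [:- of_nat N, 1:] * root_poly {..<N}"
    by (simp add: root_poly_def lessThan_Suc del: mult_pCons_left)
  have "root_poly {..<N} \<noteq> 0" using Suc by auto
  then have "degree (root_poly {..<Suc N}) = Suc N"
    unfolding eq using Suc by (subst degree_mult_eq) auto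
  moreover have "lead_coeff (root_poly {..<Suc N}) = 1"
    unfolding eq lead_coeff_mult using Suc by simp
  ultimately show ?case by simp
qed (simp add: root_poly_def)

lemma f_eq_fpoly:
  "f (j + int N) w = fpoly j (root_poly {..<N}) w - (\<Sum>k<N. coeff (root_poly {..<N}) k *s f (j + int k) w)"
  using root_poly_monic[of N] unfolding fpoly_def lessThan_Suc_atMost[symmetric] by simp

text \<open>As \<open>root_poly\<close> is monic of degree N, f_(j+N) agrees modulo the common
  kernel with a combination of f_j, ..., f_(j+N-1), which have lower degree. The images of the e_i
  lie in the kernel outright.\<close>

lemma pr_W:
  assumes "y \<in> W 0 (int N)"
  shows "\<exists>z\<in>Low n. pr k n y - z \<in> common_kernel N"
  using assms
proof (induction rule: W_induct)
  case (e i w)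
  have "e i x \<in> common_kernel N" for x
    using e cblock(2) by (auto simp: common_kernel_def)
  then show ?case by (intro bexI[of _ 0]) (simp_all add: pr_e subspace_0[OF subspace_Low])
next
  case (f i w)
  define j where "j = i - int N"
  define w' where "w' = pr (k + 2) (n - i) w"
  define z where "z = - (\<Sum>l<N. coeff (root_poly {..<N}) l *s f (j + int l) w')"
  have "f (j + int l) w' \<in> Low n" if "l < N" for l
    using wt_f[OF pr_wt[of "k + 2" "n - i" w], of "j + int l"] that
    by (intro wt_in_Low[of k "n + (int l - int N)"]) (auto simp: w'_def j_def)
  then have "z \<in> Low n"
    unfolding z_def by (intro subspace_neg[OF subspace_Low] subspace_sum[OF subspace_Low] subspace_scale[OF subspace_Low]) auto
  moreover have "pr k n (f i w) - z = fpoly j (root_poly {..<N}) w'"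
    using f_eq_fpoly[of j N w'] by (simp add: pr_f w'_def z_def j_def)
  then have "pr k n (f i w) - z \<in> common_kernel N"
    using cblock(3) f by (auto simp: common_kernel_def j_def)
  ultimately show ?case by blast
next
  case 0
  show ?case
    by (intro bexI[of _ 0]) (simp_all add: subspace_0[OF subspace_Low] subspace_0[OF subspace_common_kernel])
next
  case (add x y)
  then obtain z z' where z: "z \<in> Low n" "z' \<in> Low n"
    "pr k n x - z \<in> common_kernel N" "pr k n y - z' \<in> common_kernel N" by blast
  have "pr k n (x + y) - (z + z') = (pr k n x - z) + (pr k n y - z')"
    by (simp add: pr_add)
  then show ?case
    using subspace_add[OF subspace_common_kernel z(3,4)] subspace_add[OF subspace_Low z(1,2)] by metis
qed

section \<open>Weights of the monomials and comparison of leading terms\<close>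

lemma mv_has_weight: "\<exists>k n. wt k n (mv K p)"
proof -
  have f: "\<exists>k n. wt k n ((f i ^^ a) w)" if "\<exists>k n. wt k n w" for i a w
    using that by (induction a) (auto intro: wt_f)
  have h: "\<exists>k n. wt k n ((h i ^^ a) w)" if "\<exists>k n. wt k n w" for i a w
    using that by (induction a) (auto intro: wt_h)
  have "\<exists>k n. wt k n (mono_vec rho v a b K)" for a b
  proof (induction K)
    case 0
    have "\<exists>k n. wt k n v" using wt_v by blast
    from f[OF this] show ?case by simp
  next
    case (Suc K)
    show ?case using f[OF h[OF Suc]] by simp
  qed
  then show ?thesis by (simp add: mv_def)
qed

text \<open>A choice, arbitrary where the monomial vanishes; \<open>pr_mv\<close> holds either
  way.\<close>

definition mwt :: "nat \<Rightarrow> (nat \<Rightarrow> nat) \<times> (nat \<Rightarrow> nat) \<Rightarrow> int \<times> int" where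
  "mwt K p = (SOME (k, n). wt k n (mv K p))"

lemma wt_mwt: "mwt K p = (k, n) \<Longrightarrow> wt k n (mv K p)"
proof -
  have "\<exists>a. case a of (k, n) \<Rightarrow> wt k n (mv K p)" using mv_has_weight[of K p] by auto
  from someI_ex[OF this] show "mwt K p = (k, n) \<Longrightarrow> wt k n (mv K p)"
    by (simp add: mwt_def)
qed

lemma pr_mv: "pr k n (mv K p) = (if mwt K p = (k, n) then mv K p else 0)"
proof (cases "mwt K p")
  case (Pair k' n')
  then show ?thesis
    using pr_same[OF wt_mwt[of K p k n]] pr_other[OF wt_mwt[OF Pair], of k n] by auto
qed

lemma pr_lincomb_mv:
  assumes "finite I"
  shows "pr k n (\<Sum>p\<in>I. c p *s mv K p) = (\<Sum>p\<in>I. (if mwt K p = (k, n) then c p else 0) *s mv K p)"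
  unfolding pr_sum pr_scale pr_mv by (rule sum.cong) auto

text \<open>For a vector of weight (k, n') write it as a combination of monomials modulo
  \<open>W 0 N\<close> and take the component of that weight. By \<open>pr_W\<close> the error is,
  modulo the common kernel, of degree below n', so induction applies; it ends because degrees are
  nonnegative.\<close>

lemma Low_subset:
  assumes N: "N \<ge> 1" and x: "x \<in> Low n"
  shows "\<exists>y\<in>span (mv (N - 1) ` {p \<in> Cpairs N. snd (mwt (N - 1) p) < n}). x - y \<in> common_kernel N"
  using x
proof (induction "nat n" arbitrary: n x rule: less_induct)
  case less
  let ?U = "\<lambda>n. span (mv (N - 1) ` {p \<in> Cpairs N. snd (mwt (N - 1) p) < n})"
  note K = subspace_common_kernel[of N]
  have fin: "finite (Cpairs N)" using finite_Cpairs_card by blast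
  have gen: "\<exists>y\<in>?U n. w - y \<in> common_kernel N" if w: "wt k n' w" "n' < n" for w k n'
  proof (cases "w = 0")
    case True
    then show ?thesis by (intro bexI[of _ 0]) (simp_all add: span_zero subspace_0[OF K])
  next
    case False
    then have "n' \<ge> 0" using wt_good[OF w(1)] by simp
    then have n': "nat n' < nat n" using w(2) by simp
    obtain y where y: "y \<in> span (mv (N - 1) ` Cpairs N)" "w - y \<in> W 0 (int N)"
      using spans_Cpairs[OF N] by (rule spansE)
    obtain c where c: "y = (\<Sum>p\<in>Cpairs N. c p *s mv (N - 1) p)"
      using span_image_eq_sum[OF y(1) fin] by blast
    define y1 where "y1 = pr k n' y"
    obtain z where z: "z \<in> Low n'" "pr k n' (w - y) - z \<in> common_kernel N"
      using pr_W[OF y(2)] by blast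
    obtain y2 where y2: "y2 \<in> ?U n'" "z - y2 \<in> common_kernel N"
      using less.hyps[OF n' z(1)] by blast
    have "y1 \<in> ?U n"
      unfolding y1_def c pr_lincomb_mv[OF fin]
    proof (intro span_sum)
      fix p assume p: "p \<in> Cpairs N"
      show "(if mwt (N - 1) p = (k, n') then c p else 0) *s mv (N - 1) p \<in> ?U n"
      proof (cases "mwt (N - 1) p = (k, n')")
        case True
        then have "mv (N - 1) p \<in> ?U n" using w(2) p by (intro span_base) auto
        then show ?thesis by (rule span_scale)
      qed (simp add: span_zero)
    qed
    moreover have "?U n' \<subseteq> ?U n"
      by (intro span_mono image_mono) (use w(2) in auto)
    then have "y2 \<in> ?U n" using y2(1) by blast
    moreover have "w - (y1 + y2) = (pr k n' (w - y) - z) + (z - y2)"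
      using pr_same[OF w(1)] by (simp add: pr_diff y1_def)
    then have "w - (y1 + y2) \<in> common_kernel N"
      using subspace_add[OF K z(2) y2(2)] by (simp only:)
    ultimately show ?thesis using span_add by blast
  qed
  from less.prems show ?case
    unfolding Low_def
  proof (induction rule: span_induct_alt)
    case base
    show ?case by (intro bexI[of _ 0]) (simp_all add: span_zero subspace_0[OF K])
  next
    case (step c x y)
    then obtain y1 y2 where "y1 \<in> ?U n" "x - y1 \<in> common_kernel N" "y2 \<in> ?U n" "y - y2 \<in> common_kernel N"
      using gen by blast
    then have "c *s y1 + y2 \<in> ?U n" "c *s (x - y1) + (y - y2) \<in> common_kernel N"
      by (auto intro: span_add span_scale subspace_add[OF K] subspace_scale[OF K])
    then show ?case
      by (intro bexI[of _ "c *s y1 + y2"]) (simp_all add: algebra_simps)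
  qed
qed

lemma in_some_Low: "\<exists>n. w \<in> Low n"
proof (induction w rule: weight_induct)
  case (wt k n w)
  then show ?case using wt_in_Low[of k n w "n + 1"] by auto
next
  case (add x y)
  then obtain n m where "x \<in> Low n" "y \<in> Low m" by blast
  moreover have "Low l \<subseteq> Low (max n m)" if "l \<le> max n m" for l
    unfolding Low_def by (rule span_mono) (use that in \<open>blast intro: less_le_trans\<close>)
  then have "Low n \<subseteq> Low (max n m)" "Low m \<subseteq> Low (max n m)" by auto
  ultimately show ?case
    using subspace_add[OF subspace_Low[of "max n m"], of x y] by blast
qed

text \<open>The monomials span modulo the common kernel, and there are at most as many as
  functionals with a dual family, which leaves no room for a relation.\<close>

lemma independent_mod_common_kernel:
  assumes N: "N \<ge> 1" and K: "(\<Sum>p\<in>Cpairs N. c p *s mv (N - 1) p) \<in> common_kernel N"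
    and p: "p \<in> Cpairs N"
  shows "c p = 0"
proof -
  have "\<forall>S0\<in>odd_subsets N. \<exists>w. \<forall>S\<in>odd_subsets N. cblock N S w = (if S = S0 then 1 else 0)"
    using dual_vector_exists by blast
  then obtain x where x: "\<forall>S0\<in>odd_subsets N. \<forall>S\<in>odd_subsets N. cblock N S (x S0) = (if S = S0 then 1 else 0)"
    by (auto dest: bchoice)
  show ?thesis
  proof (rule dual_family_independent[where I = "Cpairs N" and \<S> = "odd_subsets N" and \<phi> = "cblock N"
        and x = x and u = "mv (N - 1)" and c = c])
    show "finite (Cpairs N)" using finite_Cpairs_card by blast
    show "finite (odd_subsets N)" by (rule finite_odd_subsets)
    have "2 * card (Cpairs N) \<le> 2 ^ N" using finite_Cpairs_card by blast
    then show "card (Cpairs N) \<le> card (odd_subsets N)" using card_odd_subsets[OF N] by linarith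
    show "\<exists>z\<in>span (mv (N - 1) ` Cpairs N). \<forall>S\<in>odd_subsets N. cblock N S (y - z) = 0" for y
    proof -
      obtain n where "y \<in> Low n" using in_some_Low by blast
      then obtain z where z: "z \<in> span (mv (N - 1) ` {p \<in> Cpairs N. snd (mwt (N - 1) p) < n})" "y - z \<in> common_kernel N"
        using Low_subset[OF N] by blast
      have "z \<in> span (mv (N - 1) ` Cpairs N)"
        using z(1) span_mono[of "mv (N - 1) ` {p \<in> Cpairs N. snd (mwt (N - 1) p) < n}" "mv (N - 1) ` Cpairs N"] by auto
      then show ?thesis using z(2) unfolding common_kernel_def by blast
    qed
  qed (use x K p cblock(1) in \<open>auto simp: common_kernel_def\<close>)
qed

text \<open>Semicontinuity: the leading terms of the relations for distinct points are the relations at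
  the N-fold point 0, so independence modulo the former passes to the latter.\<close>
lemma independent_mod_W:
  assumes N: "N \<ge> 1" and W: "(\<Sum>p\<in>Cpairs N. c p *s mv (N - 1) p) \<in> W 0 (int N)" and p: "p \<in> Cpairs N"
  shows "c p = 0"
proof -
  have fin: "finite (Cpairs N)" using finite_Cpairs_card by blast
  obtain k n where kn: "mwt (N - 1) p = (k, n)" by (cases "mwt (N - 1) p")
  let ?s = "\<Sum>p\<in>Cpairs N. (if mwt (N - 1) p = (k, n) then c p else 0) *s mv (N - 1) p"
  let ?J = "{p \<in> Cpairs N. snd (mwt (N - 1) p) < n}"
  obtain z where z: "z \<in> Low n" "?s - z \<in> common_kernel N"
    using pr_W[OF W, of n k] unfolding pr_lincomb_mv[OF fin] by blast
  obtain y where y: "y \<in> span (mv (N - 1) ` ?J)" "z - y \<in> common_kernel N"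
    using Low_subset[OF N z(1)] by blast
  have finJ: "finite ?J" using fin by simp
  obtain b where b: "y = (\<Sum>p\<in>?J. b p *s mv (N - 1) p)"
    using span_image_eq_sum[OF y(1) finJ] by blast
  have "y = (\<Sum>p\<in>Cpairs N. (if snd (mwt (N - 1) p) < n then b p else 0) *s mv (N - 1) p)"
    unfolding b by (rule sum.mono_neutral_cong_left) (use fin in auto)
  \<comment> \<open>The two corrections live in different degrees, so at a monomial of weight (k, n)
    the coefficient is still that of \<open>c\<close>.\<close>
  moreover define c' where
    "c' p = (if mwt (N - 1) p = (k, n) then c p else 0) - (if snd (mwt (N - 1) p) < n then b p else 0)" for p
  ultimately have "(\<Sum>p\<in>Cpairs N. c' p *s mv (N - 1) p) = ?s - y"
    by (simp only: scale_left_diff_distrib sum_subtractf)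
  also have "?s - y \<in> common_kernel N"
    using subspace_add[OF subspace_common_kernel z(2) y(2)] by simp
  finally have "c' p = 0"
    using p by (rule independent_mod_common_kernel[OF N])
  then show ?thesis using kn by (simp add: c'_def)
qed

lemma quotient_basis_C1:
  assumes N: "N \<ge> 1"
  shows "quotient_basis scale (sl2n_sub scale rho N) (\<lambda>(a, b). mono_vec rho v a b (N - 1)) (C1 (N - 1))"
proof -
  have C: "C1 (N - 1) = Cpairs N" using N by (simp add: Cpairs_def)
  have m: "(\<lambda>(a, b). mono_vec rho v a b (N - 1)) = mv (N - 1)"
    by (auto simp: mv_def)
  have fin: "finite (Cpairs N)" using finite_Cpairs_card by blast
  have "\<exists>c. w - (\<Sum>p\<in>Cpairs N. c p *s mv (N - 1) p) \<in> W 0 (int N)" for w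
  proof -
    obtain y where y: "y \<in> span (mv (N - 1) ` Cpairs N)" "w - y \<in> W 0 (int N)"
      using spans_Cpairs[OF N] by (rule spansE)
    then show ?thesis using span_image_eq_sum[OF y(1) fin] by blast
  qed
  then show ?thesis
    unfolding quotient_basis_def C m sl2n_sub_eq_W[OF N] using independent_mod_W[OF N] by blast
qed

end

theorem theorem5p3p1:
  fixes scale :: "complex \<Rightarrow> 'v::ab_group_add \<Rightarrow> 'v"
    and rho :: "gen \<Rightarrow> 'v \<Rightarrow> 'v"
    and v :: 'v
    and N :: nat
  assumes "N \<ge> 1"
    and "affine_sl2_module scale rho"
    and "irreducible_module scale rho"
    and "integrable_module rho"
    and "\<forall>w. rho C w = w"
    and "hw_vector_L11 rho v"
  shows "finite (C1 (N - 1)) \<and>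
         quotient_basis scale (sl2n_sub scale rho N) (\<lambda>(a, b). mono_vec rho v a b (N - 1)) (C1 (N - 1))"
proof -
  have "vector_space scale"
    using assms(2) by (simp add: affine_sl2_module_def)
  then interpret level_one_module scale rho v
    using assms by (simp add: level_one_module_def level_one_module_axioms_def)
  have "finite (C1 (N - 1))"
    using finite_Cpairs_card[of N] assms(1) by (simp add: Cpairs_def)
  then show ?thesis
    using quotient_basis_C1[OF assms(1)] by blast
qed

end
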